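(* Let $E$ be a Euclidean space with $\dim E\ge 2$ and consider the Newtonian $N$-body problem in $E$ with masses $m_1,\dots,m_N>0$. Let $h>0$. Each class in $\Omega_1=\Omega/\mathbb{R}^+$ (configurations without collisions up to multiplication by positive scalars) determines a point of the Gromov boundary $\mathcal{G}_h$ of $(E^N,\phi_h)$, and this point, as an equivalence class of geodesic rays, is composed of all the geodesic rays with asymptotic direction in the given class.
   Context: $E$ is a finite-dimensional Euclidean space, $N\ge 2$, $m_1,\dots,m_N>0$. For $x=(r_1,\dots,r_N),\,y=(s_1,\dots,s_N)\in E^N$ the mass inner product is $\langle x,y\rangle=\sum_i m_i\langle r_i,s_i\rangle_E$, with norm $\|\cdot\|$. The Newtonian potential is $U(x)=\sum_{i<j}m_im_j\|r_i-r_j\|_E^{-1}\in(0,+\infty]$, and $\Omega=\{x\in E^N: U(x)<+\infty\}$. The Jacobi-Maupertuis distance of level $h$ on $E^N$ is $$\phi_h(x,y)=\inf_\gamma \int_a^b\Big(\tfrac12\|\dot\gamma\|^2+U(\gamma)+h\Big)\,dt,$$ the infimum being over all absolutely continuous curves $\gamma:[a,b]\to E^N$ (with $a<b$ arbitrary), $\gamma(a)=x$, $\gamma(b)=y$; it extends to $E^N$ the Riemannian distance of the metric $j_h=2(h+U)\,g_m$ on $\Omega$, $g_m$ being the metric of the mass inner product. A geodesic ray is a curve $\gamma:[0,+\infty)\to E^N$ with $\phi_h(\gamma(s),\gamma(t))=|t-s|$ for all $s,t\ge0$. It has asymptotic direction $a\in\Omega$ (equivalently, in the class of $a$ in $\Omega_1$)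 if $\gamma(s)=\lambda s\,a+o(s)$ as $s\to+\infty$ for some $\lambda>0$. The Gromov boundary $\mathcal{G}_h$ is the quotient of the set of geodesic rays by the equivalence relation: $\gamma\sim\gamma'$ iff $t\mapsto\phi_h(\gamma(t),\gamma'(t))$ is bounded on $[0,+\infty)$. *)

theory Defs
  imports "HOL-Analysis.Analysis" "HOL-Library.Landau_Symbols"
begin

type_synonym ('e, 'n) config = "('e, 'n) vec"

text \<open>
  The space \<open>E\<^sup>N\<close> is \<open>('e, 'n) config\<close>, i.e. \<open>'e ^ 'n\<close>, where \<open>'e :: euclidean_space\<close> is the ambient space \<open>E\<close> and
  the linearly ordered finite type \<open>'n\<close> plays the role of the index set \<open>{1, ..., N}\<close>.  The library
  norm on \<open>'e ^ 'n\<close> is not the mass norm, but the two are equivalent for positive masses, so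
  continuity, derivatives and absolute continuity of curves do not depend on the choice.
\<close>

definition mass_inner ::
    "('n::finite \<Rightarrow> real) \<Rightarrow> ('e::euclidean_space, 'n) config \<Rightarrow> ('e, 'n) config \<Rightarrow> real"
  where "mass_inner m x y = (\<Sum>i\<in>UNIV. m i * ((x $ i) \<bullet> (y $ i)))"

definition mass_norm ::
    "('n::finite \<Rightarrow> real) \<Rightarrow> ('e::euclidean_space, 'n) config \<Rightarrow> real"
  where "mass_norm m x = sqrt (mass_inner m x x)"

text \<open>In \<^typ>\<open>ennreal\<close> the inverse of \<open>0\<close> is \<open>\<infinity>\<close>, so the potential is \<open>\<infinity>\<close> at collisions.\<close>

definition newton_potential ::
    "('n::{finite,linorder} \<Rightarrow> real) \<Rightarrow> ('e::euclidean_space, 'n) config \<Rightarrow> ennreal"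
  where "newton_potential m x =
    (\<Sum>(i, j) | i < j. ennreal (m i * m j) * inverse (ennreal (norm (x $ i - x $ j))))"

definition collision_free ::
    "('n::{finite,linorder} \<Rightarrow> real) \<Rightarrow> (('e::euclidean_space, 'n) config) set"
  where "collision_free m = {x. newton_potential m x < \<infinity>}"

definition absolutely_continuous_curve :: "real \<Rightarrow> real \<Rightarrow> (real \<Rightarrow> 'v::metric_space) \<Rightarrow> bool"
  where "absolutely_continuous_curve a b \<gamma> \<longleftrightarrow>
    (\<forall>\<epsilon>>0. \<exists>\<delta>>0. \<forall>D. D division_of \<Union>D \<longrightarrow> \<Union>D \<subseteq> {a..b} \<longrightarrow>
       (\<Sum>K\<in>D. Sup K - Inf K) < \<delta> \<longrightarrow> (\<Sum>K\<in>D. dist (\<gamma> (Inf K)) (\<gamma> (Sup K))) < \<epsilon>)"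

text \<open>
  An absolutely continuous curve is differentiable almost everywhere; the unspecified values of
  \<^const>\<open>vector_derivative\<close> on the remaining null set do not affect the integral.  The Lebesgue (rather
  than Borel) \<open>\<sigma>\<close>-algebra makes the integrand measurable whatever those values are.
  The definition is meant for levels \<open>h \<ge> 0\<close>, since \<^const>\<open>ennreal\<close> truncates negative reals.
\<close>

definition JM_action ::
    "('n::{finite,linorder} \<Rightarrow> real) \<Rightarrow> real \<Rightarrow> real \<Rightarrow> real \<Rightarrow> (real \<Rightarrow> ('e::euclidean_space, 'n) config) \<Rightarrow> ennreal"
  where "JM_action m h a b \<gamma> =
    (\<integral>\<^sup>+t. (ennreal (1/2 * (mass_norm m (vector_derivative \<gamma> (at t within {a..b})))\<^sup>2)
            + newton_potential m (\<gamma> t) + ennreal h) \<partial>(lebesgue_on {a..b}))"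

definition JM_dist ::
    "('n::{finite,linorder} \<Rightarrow> real) \<Rightarrow> real \<Rightarrow> ('e::euclidean_space, 'n) config \<Rightarrow> ('e, 'n) config \<Rightarrow> ennreal"
  where "JM_dist m h x y =
    Inf {JM_action m h a b \<gamma> | a b \<gamma>.
           a < b \<and> absolutely_continuous_curve a b \<gamma> \<and> \<gamma> a = x \<and> \<gamma> b = y}"

text \<open>
  A curve on \<open>[0, \<infinity>)\<close> is a function on \<^typ>\<open>real\<close> whose values at negative times are irrelevant:
  all the notions below depend only on its restriction to \<open>[0, \<infinity>)\<close>.
\<close>

definition geodesic_ray ::
    "('n::{finite,linorder} \<Rightarrow> real) \<Rightarrow> real \<Rightarrow> (real \<Rightarrow> ('e::euclidean_space, 'n) config) \<Rightarrow> bool"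
  where "geodesic_ray m h \<gamma> \<longleftrightarrow>
    (\<forall>s\<ge>0. \<forall>t\<ge>0. JM_dist m h (\<gamma> s) (\<gamma> t) = ennreal \<bar>t - s\<bar>)"

definition has_asymptotic_direction ::
    "('n::finite \<Rightarrow> real) \<Rightarrow> (real \<Rightarrow> ('e::euclidean_space, 'n) config) \<Rightarrow> ('e, 'n) config \<Rightarrow> bool"
  where "has_asymptotic_direction m \<gamma> a \<longleftrightarrow>
    (\<exists>c>0. (\<lambda>s. mass_norm m (\<gamma> s - (c * s) *\<^sub>R a)) \<in> o[at_top](\<lambda>s. s))"

definition direction_rel ::
    "('n::{finite,linorder} \<Rightarrow> real) \<Rightarrow> ((('e::euclidean_space, 'n) config) \<times> (('e, 'n) config)) set"
  where "direction_rel m =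
    {(x, y). x \<in> collision_free m \<and> y \<in> collision_free m \<and> (\<exists>c>0. y = c *\<^sub>R x)}"

definition collision_free_directions ::
    "('n::{finite,linorder} \<Rightarrow> real) \<Rightarrow> (('e::euclidean_space, 'n) config) set set"
  where "collision_free_directions m = collision_free m // direction_rel m"

definition ray_rel ::
    "('n::{finite,linorder} \<Rightarrow> real) \<Rightarrow> real \<Rightarrow> ((real \<Rightarrow> ('e::euclidean_space, 'n) config) \<times> (real \<Rightarrow> ('e, 'n) config)) set"
  where "ray_rel m h =
    {(\<gamma>, \<gamma>'). geodesic_ray m h \<gamma> \<and> geodesic_ray m h \<gamma>' \<and>
       (\<exists>B::real. \<forall>t\<ge>0. JM_dist m h (\<gamma> t) (\<gamma>' t) \<le> ennreal B)}"

definition gromov_boundary ::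
    "('n::{finite,linorder} \<Rightarrow> real) \<Rightarrow> real \<Rightarrow> (real \<Rightarrow> ('e::euclidean_space, 'n) config) set set"
  where "gromov_boundary m h = {\<gamma>. geodesic_ray m h \<gamma>} // ray_rel m h"

end

theory Submission
  imports Defs "HOL-Real_Asymp.Real_Asymp"
begin

text \<open>Rescaling the position of particle \<open>i\<close> by the square root of \<open>m i\<close> turns the mass norm into the
  Euclidean norm, so the Jacobi-Maupertuis distance becomes the distance \<open>d\<close> that belongs to a
  potential \<open>U\<close> with values in \<open>[0, \<infinity>]\<close> on a Euclidean space.  Put \<open>c = sqrt (2 h)\<close>.  The
  argument uses the potential only through \<open>U \<ge> 0\<close>, which gives \<open>d x y \<ge> c * norm (y - x)\<close>, and
  through its size and regularity near the half line \<open>{t *\<^sub>R a | t > 0}\<close> of a direction \<open>a\<close> without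
  collisions: on the ball of radius \<open>\<delta> * t\<close> about \<open>t *\<^sub>R a\<close> the potential is \<open>O(1 / t)\<close>, its first
  differences are \<open>O(1 / t^2)\<close> and its second differences \<open>O(1 / t^3)\<close> (locale \<open>cone_potential\<close>).

  That the rays with direction \<open>a\<close> form one class of rays means three things.

  \<^item> Such a ray exists (\<open>ray_exists\<close>).  Take near minimizers from a base point \<open>R *\<^sub>R a\<close> to
    \<open>S *\<^sub>R a\<close>.  If \<open>q\<close> lies on such a curve at distance \<open>\<rho>\<close> from the base point and \<open>q'\<close> later on
    it at distance \<open>2 \<rho>\<close>, then the triangle inequality through \<open>q\<close> is nearly an equality, because
    the potential adds at most a multiple of \<open>sqrt \<rho>\<close> to \<open>c\<close> times the length of a radial segment.  Hence the
    directions of \<open>q\<close> and \<open>q'\<close> differ by at most a multiple of \<open>\<rho> powr (-1/4)\<close>.  These errors can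
    be summed over dyadic distances, starting from the far end; so the curve stays close to the
    direction \<open>a\<close>, uniformly in \<open>S\<close>, and by compactness there is a limit for \<open>S \<rightarrow> \<infinity>\<close>.

  \<^item> Two such rays stay at bounded distance (\<open>rays_bounded_distance\<close>).  In Newtonian time a ray
    becomes a curve \<open>X\<close> that minimizes the action and satisfies \<open>X t = (c * t) *\<^sub>R a + o(t)\<close>.  Given
    two of them, let \<open>z\<close> be the deviation of \<open>w = X2 - X1\<close> from its chord on \<open>[T, 4 T]\<close>.  The
    competitors \<open>X1 + z/2\<close> and \<open>X2 - z/2\<close> have the same end points; they gain a quarter of the
    squared \<open>L2\<close> norm of the velocity of \<open>z\<close> by convexity of the kinetic energy and lose only a second
    difference of the potential.  So \<open>z\<close> is at most a multiple of \<open>sup (norm w) / T\<close>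
    (\<open>pair_comparison\<close>), and a function \<open>w = o(t)\<close> that is so close to its chords is bounded
    (\<open>sublinear_bounded\<close>).

  \<^item> A ray at bounded distance from one with direction \<open>a\<close> has direction \<open>a\<close>, because \<open>d\<close> dominates a
    multiple of the Euclidean distance.

  The infimum that defines the distance runs over all absolutely continuous curves, so even the
  bound from below requires that such a curve is differentiable almost everywhere and is the
  integral of its derivative.  The first two sections prove this from the variation of the curve,
  the Radon-Nikodym theorem and Lebesgue's differentiation theorem.\<close>

section \<open>Absolute continuity in terms of packings of intervals\<close>

text \<open>Families of nonoverlapping intervals with an explicit index set replace sets of intervals: cutting
  all intervals at a point may create degenerate or equal
  intervals, and does no harm to an indexed family.\<close>
definition packing :: "real \<Rightarrow> real \<Rightarrow> 'i set \<Rightarrow> ('i \<Rightarrow> real) \<Rightarrow> ('i \<Rightarrow> real) \<Rightarrow> bool"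
  where "packing a b I u v \<longleftrightarrow> finite I \<and> (\<forall>i\<in>I. a \<le> u i \<and> u i \<le> v i \<and> v i \<le> b) \<and>
    (\<forall>i\<in>I. \<forall>j\<in>I. i \<noteq> j \<longrightarrow> v i \<le> u j \<or> v j \<le> u i)"

abbreviation total_length :: "'i set \<Rightarrow> ('i \<Rightarrow> real) \<Rightarrow> ('i \<Rightarrow> real) \<Rightarrow> real"
  where "total_length I u v \<equiv> \<Sum>i\<in>I. v i - u i"

abbreviation oscillation :: "(real \<Rightarrow> 'v::metric_space) \<Rightarrow> 'i set \<Rightarrow> ('i \<Rightarrow> real) \<Rightarrow> ('i \<Rightarrow> real) \<Rightarrow> real"
  where "oscillation \<gamma> I u v \<equiv> \<Sum>i\<in>I. dist (\<gamma> (u i)) (\<gamma> (v i))"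

lemma packing_length_le:
  assumes "packing a b I u v" "a \<le> b"
  shows "total_length I u v \<le> b - a"
proof -
  have fin: "finite I" and uv: "\<And>i. i \<in> I \<Longrightarrow> a \<le> u i \<and> u i \<le> v i \<and> v i \<le> b"
    and no: "\<And>i j. i \<in> I \<Longrightarrow> j \<in> I \<Longrightarrow> i \<noteq> j \<Longrightarrow> v i \<le> u j \<or> v j \<le> u i"
    using assms unfolding packing_def by auto
  have disj: "disjoint_family_on (\<lambda>i. {u i<..<v i}) I"
    unfolding disjoint_family_on_def
  proof (intro ballI impI)
    fix i j assume "i \<in> I" "j \<in> I" "i \<noteq> j"
    from no[OF this] show "{u i<..<v i} \<inter> {u j<..<v j} = {}" by auto
  qed
  have "ennreal (total_length I u v) = (\<Sum>i\<in>I. emeasure lborel {u i<..<v i})"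
    using uv by (subst sum_ennreal[symmetric]) (auto intro!: sum.cong)
  also have "\<dots> = emeasure lborel (\<Union>i\<in>I. {u i<..<v i})"
    by (rule sum_emeasure) (use disj fin in auto)
  also have "\<dots> \<le> emeasure lborel {a..b}"
    by (rule emeasure_mono) (use uv in force)+
  also have "\<dots> = ennreal (b - a)" using assms by simp
  finally show ?thesis using assms by (simp add: ennreal_le_iff)
qed

text \<open>Degenerate intervals contribute nothing, and the others are pairwise distinct and form a division of their union.\<close>
lemma AC_packing:
  assumes "absolutely_continuous_curve a b \<gamma>" "\<epsilon> > 0"
  obtains \<delta> where "\<delta> > 0"
    "\<And>(I::'i set) u v. packing a b I u v \<Longrightarrow> total_length I u v < \<delta> \<Longrightarrow>
       oscillation \<gamma> I u v < \<epsilon>"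
proof -
  obtain \<delta> where \<delta>: "\<delta> > 0" and D: "\<And>D. D division_of \<Union>D \<Longrightarrow> \<Union>D \<subseteq> {a..b} \<Longrightarrow>
       (\<Sum>K\<in>D. Sup K - Inf K) < \<delta> \<Longrightarrow> (\<Sum>K\<in>D. dist (\<gamma> (Inf K)) (\<gamma> (Sup K))) < \<epsilon>"
    using assms unfolding absolutely_continuous_curve_def by meson
  have "oscillation \<gamma> I u v < \<epsilon>"
    if p: "packing a b I u v" and len: "total_length I u v < \<delta>" for I :: "'i set" and u v
  proof -
    have fin: "finite I" and uv: "\<And>i. i \<in> I \<Longrightarrow> a \<le> u i \<and> u i \<le> v i \<and> v i \<le> b"
      and no: "\<And>i j. i \<in> I \<Longrightarrow> j \<in> I \<Longrightarrow> i \<noteq> j \<Longrightarrow> v i \<le> u j \<or> v j \<le> u i"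
      using p unfolding packing_def by auto
    define J where "J = {i\<in>I. u i < v i}"
    define F where "F = (\<lambda>i. {u i..v i})"
    have J: "J \<subseteq> I" "finite J" "\<And>i. i \<in> J \<Longrightarrow> u i < v i" using fin by (auto simp: J_def)
    have JI: "u i = v i" if "i \<in> I - J" for i using that uv[of i] by (auto simp: J_def)
    have inj: "inj_on F J"
    proof (rule inj_onI)
      fix i j assume ij: "i \<in> J" "j \<in> J" "F i = F j"
      then have "u i = u j" "v i = v j" using J(3)[of i] J(3)[of j] by (auto simp: F_def Icc_eq_Icc)
      then show "i = j" using no[of i j] J ij by force
    qed
    have div: "F ` J division_of \<Union>(F ` J)"
    proof (rule division_ofI)
      show "finite (F ` J)" using J by auto
      fix K assume K: "K \<in> F ` J"
      then show "K \<subseteq> \<Union>(F ` J)" by auto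
      from K obtain i where i: "i \<in> J" "K = F i" by auto
      show "K \<noteq> {}" using i J by (force simp: F_def)
      show "\<exists>a b. K = cbox a b" using i by (auto simp: F_def)
      fix L assume L: "L \<in> F ` J" "K \<noteq> L"
      from L obtain j where j: "j \<in> J" "L = F j" by auto
      have "i \<noteq> j" using L i j by auto
      then have "v i \<le> u j \<or> v j \<le> u i" using no i j J by auto
      then show "interior K \<inter> interior L = {}" using i j by (auto simp: F_def)
    qed auto
    have sub: "\<Union>(F ` J) \<subseteq> {a..b}" using uv J by (force simp: F_def)
    have SI: "Sup (F i) = v i" "Inf (F i) = u i" if "i \<in> J" for i
      using J(3)[OF that] by (auto simp: F_def)
    have "(\<Sum>K\<in>F ` J. Sup K - Inf K) = (\<Sum>i\<in>J. v i - u i)"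
      by (subst sum.reindex[OF inj]) (auto simp: SI)
    also have "\<dots> \<le> total_length I u v"
      by (rule sum_mono2) (use fin J(1) uv in auto)
    finally have "(\<Sum>K\<in>F ` J. dist (\<gamma> (Inf K)) (\<gamma> (Sup K))) < \<epsilon>"
      using D[OF div sub] len by linarith
    also have "(\<Sum>K\<in>F ` J. dist (\<gamma> (Inf K)) (\<gamma> (Sup K))) = (\<Sum>i\<in>J. dist (\<gamma> (u i)) (\<gamma> (v i)))"
      by (subst sum.reindex[OF inj]) (auto simp: SI)
    also have "\<dots> = oscillation \<gamma> I u v"
      by (rule sum.mono_neutral_left) (use fin J(1) JI in auto)
    finally show ?thesis .
  qed
  with \<delta> that show thesis by blast
qed

text \<open>Here the intervals of a division serve as their own indices.\<close>
lemma AC_packingI: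
  assumes "\<And>\<epsilon>. \<epsilon> > 0 \<Longrightarrow> \<exists>\<delta>>0. \<forall>I u v. packing a b (I::real set set) u v \<longrightarrow>
       total_length I u v < \<delta> \<longrightarrow> oscillation \<gamma> I u v < \<epsilon>"
  shows "absolutely_continuous_curve a b \<gamma>"
  unfolding absolutely_continuous_curve_def
proof (intro allI impI)
  fix \<epsilon> :: real assume "\<epsilon> > 0"
  then obtain \<delta> where \<delta>: "\<delta> > 0" and D: "\<And>I u v. packing a b (I::real set set) u v \<Longrightarrow>
       total_length I u v < \<delta> \<Longrightarrow> oscillation \<gamma> I u v < \<epsilon>"
    using assms by meson
  have "(\<Sum>K\<in>D. dist (\<gamma> (Inf K)) (\<gamma> (Sup K))) < \<epsilon>"
    if div: "D division_of \<Union>D" and sub: "\<Union>D \<subseteq> {a..b}" and len: "(\<Sum>K\<in>D. Sup K - Inf K) < \<delta>" for D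
  proof -
    note d = division_ofD[OF div]
    have K: "\<exists>p q. K = {p..q} \<and> p \<le> q \<and> Inf K = p \<and> Sup K = q \<and> a \<le> p \<and> q \<le> b" if "K \<in> D" for K
    proof -
      obtain p q where "K = cbox p q" using d(4) \<open>K \<in> D\<close> by blast
      moreover have "K \<noteq> {}" using d(3)[OF that] .
      moreover have "K \<subseteq> {a..b}" using sub that by auto
      ultimately show ?thesis by (auto simp: subset_iff)
    qed
    define E where "E = {K\<in>D. Inf K < Sup K}"
    have p: "packing a b E Inf Sup"
      unfolding packing_def
    proof (intro conjI ballI impI)
      show "finite E" using d(1) by (auto simp: E_def)
      fix K L assume KL: "K \<in> E" "L \<in> E" "K \<noteq> L"
      then have KD: "K \<in> D" "L \<in> D" by (auto simp: E_def)
      obtain p q where pq: "K = {p..q}" "p \<le> q" "Inf K = p" "Sup K = q" using K[OF KD(1)] by auto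
      obtain r s where rs: "L = {r..s}" "r \<le> s" "Inf L = r" "Sup L = s" using K[OF KD(2)] by auto
      have lt: "p < q" "r < s" using KL pq rs by (auto simp: E_def)
      have "{p<..<q} \<inter> {r<..<s} = {}" using d(5)[OF KD KL(3)] pq rs by simp
      \<comment> \<open>the midpoint of the overlap\<close>
      then have "(max p r + min q s) / 2 \<notin> {p<..<q} \<inter> {r<..<s}" by blast
      then show "Sup K \<le> Inf L \<or> Sup L \<le> Inf K" using pq rs lt by (auto simp: max_def min_def split: if_splits)
    qed (use K in \<open>auto simp: E_def\<close>)
    have fE: "finite D" "E \<subseteq> D" using d(1) by (auto simp: E_def)
    have le: "Inf K \<le> Sup K" if "K \<in> D" for K using K[OF that] by auto
    have lE: "Inf K = Sup K" if "K \<in> D - E" for K using that le[of K] by (auto simp: E_def)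
    have "(\<Sum>K\<in>E. Sup K - Inf K) \<le> (\<Sum>K\<in>D. Sup K - Inf K)"
      by (rule sum_mono2) (use fE le in auto)
    then have "(\<Sum>K\<in>E. dist (\<gamma> (Inf K)) (\<gamma> (Sup K))) < \<epsilon>"
      using D[OF p] len by linarith
    also have "(\<Sum>K\<in>E. dist (\<gamma> (Inf K)) (\<gamma> (Sup K))) = (\<Sum>K\<in>D. dist (\<gamma> (Inf K)) (\<gamma> (Sup K)))"
      by (rule sum.mono_neutral_left) (use fE lE in auto)
    finally show ?thesis .
  qed
  with \<delta> show "\<exists>\<delta>>0. \<forall>D. D division_of \<Union>D \<longrightarrow> \<Union>D \<subseteq> {a..b} \<longrightarrow>
       (\<Sum>K\<in>D. Sup K - Inf K) < \<delta> \<longrightarrow> (\<Sum>K\<in>D. dist (\<gamma> (Inf K)) (\<gamma> (Sup K))) < \<epsilon>" by blast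
qed

lemma AC_subinterval:
  assumes "absolutely_continuous_curve a b \<gamma>" "a \<le> a'" "b' \<le> b"
  shows "absolutely_continuous_curve a' b' \<gamma>"
proof (rule AC_packingI)
  fix \<epsilon> :: real assume "\<epsilon> > 0"
  then obtain \<delta> where \<delta>: "\<delta> > 0" and D: "\<And>I u v. packing a b (I::real set set) u v \<Longrightarrow>
       total_length I u v < \<delta> \<Longrightarrow> oscillation \<gamma> I u v < \<epsilon>"
    using AC_packing[OF assms(1)] by blast
  have "packing a b I u v" if "packing a' b' I u v" for I :: "real set set" and u v
    using that assms(2,3) unfolding packing_def by force
  with \<delta> D show "\<exists>\<delta>>0. \<forall>I u v. packing a' b' (I::real set set) u v \<longrightarrow>
       total_length I u v < \<delta> \<longrightarrow> oscillation \<gamma> I u v < \<epsilon>" by blast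
qed

lemma AC_shift_reverse:
  assumes "absolutely_continuous_curve a b \<gamma>"
  shows "absolutely_continuous_curve (a + r) (b + r) (\<lambda>t. \<gamma> (t - r))"
    and "absolutely_continuous_curve (- b) (- a) (\<lambda>t. \<gamma> (- t))"
proof -
  have D: "\<exists>\<delta>>0. \<forall>I u v. packing a b (I::real set set) u v \<longrightarrow>
       total_length I u v < \<delta> \<longrightarrow> oscillation \<gamma> I u v < \<epsilon>" if "\<epsilon> > 0" for \<epsilon>
    using AC_packing[OF assms that] by metis
  show "absolutely_continuous_curve (a + r) (b + r) (\<lambda>t. \<gamma> (t - r))"
  proof (rule AC_packingI)
    fix \<epsilon> :: real assume "\<epsilon> > 0"
    then obtain \<delta> where \<delta>: "\<delta> > 0" and D': "\<And>I u v. packing a b (I::real set set) u v \<Longrightarrow>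
       total_length I u v < \<delta> \<Longrightarrow> oscillation \<gamma> I u v < \<epsilon>"
      using D by meson
    have "(\<Sum>i\<in>I. dist (\<gamma> (u i - r)) (\<gamma> (v i - r))) < \<epsilon>"
      if "packing (a + r) (b + r) I u v" "total_length I u v < \<delta>" for I :: "real set set" and u v
      by (rule D') (use that in \<open>auto simp: packing_def algebra_simps\<close>)
    with \<delta> show "\<exists>\<delta>>0. \<forall>I u v. packing (a + r) (b + r) (I::real set set) u v \<longrightarrow>
       total_length I u v < \<delta> \<longrightarrow> (\<Sum>i\<in>I. dist (\<gamma> (u i - r)) (\<gamma> (v i - r))) < \<epsilon>" by blast
  qed
  show "absolutely_continuous_curve (- b) (- a) (\<lambda>t. \<gamma> (- t))"
  proof (rule AC_packingI)
    fix \<epsilon> :: real assume "\<epsilon> > 0"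
    then obtain \<delta> where \<delta>: "\<delta> > 0" and D': "\<And>I u v. packing a b (I::real set set) u v \<Longrightarrow>
       total_length I u v < \<delta> \<Longrightarrow> oscillation \<gamma> I u v < \<epsilon>"
      using D by meson
    have "(\<Sum>i\<in>I. dist (\<gamma> (- u i)) (\<gamma> (- v i))) < \<epsilon>"
      if "packing (- b) (- a) I u v" "total_length I u v < \<delta>" for I :: "real set set" and u v
    proof -
      have "(\<Sum>i\<in>I. dist (\<gamma> (- v i)) (\<gamma> (- u i))) < \<epsilon>"
        by (rule D') (use that in \<open>force simp: packing_def\<close>)+
      then show ?thesis by (simp add: dist_commute)
    qed
    with \<delta> show "\<exists>\<delta>>0. \<forall>I u v. packing (- b) (- a) (I::real set set) u v \<longrightarrow>
       total_length I u v < \<delta> \<longrightarrow> (\<Sum>i\<in>I. dist (\<gamma> (- u i)) (\<gamma> (- v i))) < \<epsilon>" by blast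
  qed
qed

text \<open>Cutting at \<open>c\<close> turns a packing into one on each side.  An interval that lies on one side of \<open>c\<close>
  becomes degenerate on the other, so lengths add up exactly, and oscillations by the triangle inequality.\<close>
lemma packing_split:
  assumes p: "packing a b I u v" and c: "a \<le> c" "c \<le> b"
  shows "packing a c I (\<lambda>i. min (u i) c) (\<lambda>i. min (v i) c)"
    and "packing c b I (\<lambda>i. max (u i) c) (\<lambda>i. max (v i) c)"
    and "total_length I u v = (\<Sum>i\<in>I. min (v i) c - min (u i) c) + (\<Sum>i\<in>I. max (v i) c - max (u i) c)"
    and "oscillation \<gamma> I u v \<le>
      (\<Sum>i\<in>I. dist (\<gamma> (min (u i) c)) (\<gamma> (min (v i) c))) + (\<Sum>i\<in>I. dist (\<gamma> (max (u i) c)) (\<gamma> (max (v i) c)))"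
proof -
  show "packing a c I (\<lambda>i. min (u i) c) (\<lambda>i. min (v i) c)"
    using p c unfolding packing_def by (simp add: min_def) (smt (verit))
  show "packing c b I (\<lambda>i. max (u i) c) (\<lambda>i. max (v i) c)"
    using p c unfolding packing_def by (simp add: max_def) (smt (verit))
  show "total_length I u v = (\<Sum>i\<in>I. min (v i) c - min (u i) c) + (\<Sum>i\<in>I. max (v i) c - max (u i) c)"
    unfolding sum.distrib[symmetric] by (rule sum.cong) (auto simp: min_def max_def)
  show "oscillation \<gamma> I u v \<le>
      (\<Sum>i\<in>I. dist (\<gamma> (min (u i) c)) (\<gamma> (min (v i) c))) + (\<Sum>i\<in>I. dist (\<gamma> (max (u i) c)) (\<gamma> (max (v i) c)))"
    unfolding sum.distrib[symmetric]
  proof (rule sum_mono)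
    fix i assume "i \<in> I"
    then have "u i \<le> v i" using p by (auto simp: packing_def)
    then show "dist (\<gamma> (u i)) (\<gamma> (v i)) \<le> dist (\<gamma> (min (u i) c)) (\<gamma> (min (v i) c)) + dist (\<gamma> (max (u i) c)) (\<gamma> (max (v i) c))"
      by (cases "v i \<le> c"; cases "c \<le> u i") (auto simp: min_def max_def dist_triangle)
  qed
qed

lemma AC_join:
  assumes "absolutely_continuous_curve a c \<gamma>" "absolutely_continuous_curve c b \<gamma>" "a \<le> c" "c \<le> b"
  shows "absolutely_continuous_curve a b \<gamma>"
proof (rule AC_packingI)
  fix \<epsilon> :: real assume "\<epsilon> > 0"
  then have e2: "\<epsilon>/2 > 0" by simp
  obtain \<delta>1 where d1: "\<delta>1 > 0" and D1: "\<And>I u v. packing a c (I::real set set) u v \<Longrightarrow>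
       total_length I u v < \<delta>1 \<Longrightarrow> oscillation \<gamma> I u v < \<epsilon>/2"
    using AC_packing[OF assms(1) e2] by blast
  obtain \<delta>2 where d2: "\<delta>2 > 0" and D2: "\<And>I u v. packing c b (I::real set set) u v \<Longrightarrow>
       total_length I u v < \<delta>2 \<Longrightarrow> oscillation \<gamma> I u v < \<epsilon>/2"
    using AC_packing[OF assms(2) e2] by blast
  have "oscillation \<gamma> I u v < \<epsilon>"
    if p: "packing a b I u v" and len: "total_length I u v < min \<delta>1 \<delta>2" for I :: "real set set" and u v
  proof -
    note s = packing_split[OF p assms(3,4)]
    have "0 \<le> (\<Sum>i\<in>I. min (v i) c - min (u i) c)" "0 \<le> (\<Sum>i\<in>I. max (v i) c - max (u i) c)"
      by (rule sum_nonneg; use p in \<open>force simp: packing_def min_def max_def\<close>)+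
    with s(3) len have "(\<Sum>i\<in>I. min (v i) c - min (u i) c) < \<delta>1" "(\<Sum>i\<in>I. max (v i) c - max (u i) c) < \<delta>2"
      by linarith+
    with D1[OF s(1)] D2[OF s(2)] s(4)[of \<gamma>] show ?thesis by linarith
  qed
  moreover have "min \<delta>1 \<delta>2 > 0" using d1 d2 by simp
  ultimately show "\<exists>\<delta>>0. \<forall>I u v. packing a b (I::real set set) u v \<longrightarrow>
       total_length I u v < \<delta> \<longrightarrow> oscillation \<gamma> I u v < \<epsilon>" by blast
qed

text \<open>Both images under a Lipschitz map and Lipschitz curves arise here, the latter by taking \<open>\<gamma>\<close> constant.\<close>
lemma AC_dominated:
  assumes "absolutely_continuous_curve a b \<gamma>" "0 \<le> L"
    and "\<And>s t. a \<le> s \<Longrightarrow> s \<le> t \<Longrightarrow> t \<le> b \<Longrightarrow> dist (\<eta> s) (\<eta> t) \<le> L * (dist (\<gamma> s) (\<gamma> t) + (t - s))"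
  shows "absolutely_continuous_curve a b \<eta>"
proof (rule AC_packingI)
  fix \<epsilon> :: real assume e: "\<epsilon> > 0"
  define \<epsilon>' where "\<epsilon>' = \<epsilon> / (2 * (L + 1))"
  have e': "\<epsilon>' > 0" using e assms(2) by (auto simp: \<epsilon>'_def)
  have "L * (\<epsilon>' + \<epsilon>') = L * \<epsilon> / (L + 1)" using assms(2) by (simp add: \<epsilon>'_def flip: add_divide_distrib) (simp add: divide_simps)
  also have "\<dots> < \<epsilon>" using e assms(2) by (simp add: field_simps)
  finally have e'': "L * (\<epsilon>' + \<epsilon>') < \<epsilon>" .
  obtain \<delta> where d: "\<delta> > 0" and D: "\<And>I u v. packing a b (I::real set set) u v \<Longrightarrow>
       total_length I u v < \<delta> \<Longrightarrow> oscillation \<gamma> I u v < \<epsilon>'"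
    using AC_packing[OF assms(1) e'] by blast
  have "oscillation \<eta> I u v < \<epsilon>"
    if p: "packing a b I u v" and len: "total_length I u v < min \<delta> \<epsilon>'" for I :: "real set set" and u v
  proof -
    have "oscillation \<eta> I u v \<le> (\<Sum>i\<in>I. L * (dist (\<gamma> (u i)) (\<gamma> (v i)) + (v i - u i)))"
      by (rule sum_mono, rule assms(3)) (use p in \<open>auto simp: packing_def\<close>)
    also have "\<dots> = L * (oscillation \<gamma> I u v + total_length I u v)"
      by (simp add: sum_distrib_left sum.distrib distrib_left)
    also have "\<dots> \<le> L * (\<epsilon>' + \<epsilon>')"
      using D[OF p] len assms(2) by (intro mult_left_mono) auto
    finally show ?thesis using e'' by linarith
  qed
  moreover have "min \<delta> \<epsilon>' > 0" using d e' by simp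
  ultimately show "\<exists>\<delta>>0. \<forall>I u v. packing a b (I::real set set) u v \<longrightarrow>
       total_length I u v < \<delta> \<longrightarrow> oscillation \<eta> I u v < \<epsilon>" by blast
qed

lemma AC_const: "absolutely_continuous_curve a b (\<lambda>t. x)"
  unfolding absolutely_continuous_curve_def by (auto intro: exI[of _ 1])

lemma AC_lipschitz:
  assumes "\<And>s t. a \<le> s \<Longrightarrow> s \<le> t \<Longrightarrow> t \<le> b \<Longrightarrow> dist (\<eta> s) (\<eta> t) \<le> L * (t - s)" "0 \<le> L"
  shows "absolutely_continuous_curve a b \<eta>"
  by (rule AC_dominated[OF AC_const[of a b "0::real"], of L]) (use assms in auto)

lemma AC_imp_continuous:
  assumes "absolutely_continuous_curve a b \<gamma>"
  shows "continuous_on {a..b} \<gamma>"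
  unfolding continuous_on_iff
proof (intro ballI allI impI)
  fix x and \<epsilon> :: real assume x: "x \<in> {a..b}" and "\<epsilon> > 0"
  obtain \<delta> where d: "\<delta> > 0" and D: "\<And>I u v. packing a b (I::nat set) u v \<Longrightarrow>
       total_length I u v < \<delta> \<Longrightarrow> oscillation \<gamma> I u v < \<epsilon>"
    using AC_packing[OF assms \<open>\<epsilon> > 0\<close>] by blast
  have "dist (\<gamma> y) (\<gamma> x) < \<epsilon>" if "y \<in> {a..b}" "dist y x < \<delta>" for y
    using D[of "{0}" "\<lambda>_. min x y" "\<lambda>_. max x y"] that x
    by (cases "x \<le> y") (auto simp: packing_def min_def max_def dist_real_def dist_commute)
  with d show "\<exists>d>0. \<forall>x'\<in>{a..b}. dist x' x < d \<longrightarrow> dist (\<gamma> x') (\<gamma> x) < \<epsilon>" by blast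
qed

section \<open>The fundamental theorem of calculus for absolutely continuous curves\<close>

definition total_variation :: "(real \<Rightarrow> 'v::metric_space) \<Rightarrow> real \<Rightarrow> real \<Rightarrow> real"
  where "total_variation \<gamma> a b =
    Sup {oscillation \<gamma> I u v |I u v. packing a b (I::nat set) u v}"

lemma packing_empty: "packing a b {} u v" by (simp add: packing_def)

text \<open>Absolute continuity bounds the oscillation by 1 on intervals shorter than some \<open>\<delta>\<close>, and finitely
  many of these cover \<open>[a, b]\<close>.\<close>
lemma AC_variation_bounded:
  assumes "absolutely_continuous_curve a b \<gamma>"
  obtains B where "\<And>I u v. packing a b (I::nat set) u v \<Longrightarrow> oscillation \<gamma> I u v \<le> B"
proof -
  obtain \<delta> where d: "\<delta> > 0" and D: "\<And>I u v. packing a b (I::nat set) u v \<Longrightarrow>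
       total_length I u v < \<delta> \<Longrightarrow> oscillation \<gamma> I u v < 1"
    using AC_packing[OF assms zero_less_one] by blast
  have step: "oscillation \<gamma> I u v \<le> real n"
    if "packing a c I u v" "c \<le> b" "c \<le> a + real n * (\<delta>/2)" for n c u v and I :: "nat set"
    using that
  proof (induction n arbitrary: c u v)
    case 0
    have "oscillation \<gamma> I u v = (\<Sum>i\<in>I. 0)"
      by (rule sum.cong) (use 0 in \<open>auto simp: packing_def\<close>, smt (verit) dist_self)
    then show ?case by simp
  next
    case (Suc n)
    show ?case
    proof (cases "c \<le> a + real n * (\<delta>/2)")
      case True
      from Suc.IH[OF Suc.prems(1,2) this] show ?thesis by simp
    next
      case False
      define c' where "c' = a + real n * (\<delta>/2)"
      have c': "a \<le> c'" "c' \<le> c" using False d by (auto simp: c'_def)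
      have cc: "c - c' < \<delta>" using Suc.prems(3) d by (auto simp: c'_def add_divide_distrib algebra_simps)
      note s = packing_split[OF Suc.prems(1) c']
      have "(\<Sum>i\<in>I. dist (\<gamma> (min (u i) c')) (\<gamma> (min (v i) c'))) \<le> real n"
        by (rule Suc.IH[OF s(1)]) (use c' Suc.prems in \<open>auto simp: c'_def\<close>)
      moreover have "(\<Sum>i\<in>I. dist (\<gamma> (max (u i) c')) (\<gamma> (max (v i) c'))) < 1"
      proof (rule D)
        show "packing a b I (\<lambda>i. max (u i) c') (\<lambda>i. max (v i) c')"
          using s(2) c' Suc.prems(2) by (auto simp: packing_def)
        show "(\<Sum>i\<in>I. max (v i) c' - max (u i) c') < \<delta>"
          using packing_length_le[OF s(2) c'(2)] cc by linarith
      qed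
      ultimately show ?thesis using s(4)[of \<gamma>] by simp
    qed
  qed
  obtain n where "b \<le> a + real n * (\<delta>/2)"
    using reals_Archimedean3[of "\<delta>/2"] d by (metis add.commute diff_le_eq half_gt_zero less_imp_le)
  from that[OF step[OF _ order_refl this]] show thesis by blast
qed

lemma
  assumes ac: "absolutely_continuous_curve a b \<gamma>" and xy: "a \<le> x" "y \<le> b"
  shows total_variation_upper: "packing x y (I::nat set) u v \<Longrightarrow> oscillation \<gamma> I u v \<le> total_variation \<gamma> x y"
    and total_variation_approx: "\<eta> > 0 \<Longrightarrow> \<exists>I u v. packing x y (I::nat set) u v \<and> total_variation \<gamma> x y - \<eta> < oscillation \<gamma> I u v"
proof -
  let ?S = "{oscillation \<gamma> I u v |I u v. packing x y (I::nat set) u v}"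
  have "absolutely_continuous_curve x y \<gamma>" using AC_subinterval[OF ac xy] .
  then obtain B where B: "\<And>I u v. packing x y (I::nat set) u v \<Longrightarrow> oscillation \<gamma> I u v \<le> B"
    by (rule AC_variation_bounded) blast
  have bdd: "bdd_above ?S" using B by (auto intro!: bdd_aboveI)
  have ne: "?S \<noteq> {}" using packing_empty by blast
  show "packing x y I u v \<Longrightarrow> oscillation \<gamma> I u v \<le> total_variation \<gamma> x y"
    unfolding total_variation_def by (rule cSup_upper[OF _ bdd]) blast
  show "\<exists>I u v. packing x y (I::nat set) u v \<and> total_variation \<gamma> x y - \<eta> < oscillation \<gamma> I u v" if "\<eta> > 0"
    using less_cSup_iff[OF ne bdd, of "total_variation \<gamma> x y - \<eta>"] that
    unfolding total_variation_def by auto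
qed

text \<open>The first part makes the variation minus any coordinate of the curve monotone, the second bounds
  the increments of the variation from above.\<close>
lemma total_variation_increment:
  assumes ac: "absolutely_continuous_curve a b \<gamma>" and xy: "a \<le> x" "x \<le> y" "y \<le> b"
  shows "total_variation \<gamma> a x + dist (\<gamma> x) (\<gamma> y) \<le> total_variation \<gamma> a y"
    and "total_variation \<gamma> a y \<le> total_variation \<gamma> a x + total_variation \<gamma> x y"
proof -
  have xb: "x \<le> b" and ay: "a \<le> y" using xy by auto
  show "total_variation \<gamma> a x + dist (\<gamma> x) (\<gamma> y) \<le> total_variation \<gamma> a y"
  proof (rule field_le_epsilon)
    fix \<eta> :: real assume "\<eta> > 0"
    then obtain I u v where p: "packing a x (I::nat set) u v" and
      lt: "total_variation \<gamma> a x - \<eta> < oscillation \<gamma> I u v"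
      using total_variation_approx[OF ac order_refl xb] by blast
    have fin: "finite I" using p by (auto simp: packing_def)
    then obtain k where k: "k \<notin> I" using ex_new_if_finite infinite_UNIV_nat by blast
    have ik: "i \<noteq> k" if "i \<in> I" for i using that k by auto
    have "packing a y (insert k I) (u(k := x)) (v(k := y))"
      using p xy k ik unfolding packing_def by fastforce
    from total_variation_upper[OF ac order_refl xy(3) this]
    have "dist (\<gamma> x) (\<gamma> y) + (\<Sum>i\<in>I. dist (\<gamma> ((u(k := x)) i)) (\<gamma> ((v(k := y)) i))) \<le> total_variation \<gamma> a y"
      using fin k by simp
    also have "(\<Sum>i\<in>I. dist (\<gamma> ((u(k := x)) i)) (\<gamma> ((v(k := y)) i))) = oscillation \<gamma> I u v"
      by (rule sum.cong) (use ik in auto)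
    finally show "total_variation \<gamma> a x + dist (\<gamma> x) (\<gamma> y) \<le> total_variation \<gamma> a y + \<eta>" using lt by linarith
  qed
  show "total_variation \<gamma> a y \<le> total_variation \<gamma> a x + total_variation \<gamma> x y"
  proof (rule field_le_epsilon)
    fix \<eta> :: real assume "\<eta> > 0"
    then obtain I u v where p: "packing a y (I::nat set) u v" and
      lt: "total_variation \<gamma> a y - \<eta> < oscillation \<gamma> I u v"
      using total_variation_approx[OF ac order_refl xy(3)] by blast
    note s = packing_split[OF p xy(1,2)]
    show "total_variation \<gamma> a y \<le> total_variation \<gamma> a x + total_variation \<gamma> x y + \<eta>"
      using lt s(4)[of \<gamma>] total_variation_upper[OF ac order_refl xb s(1)] total_variation_upper[OF ac xy(1,3) s(2)]
      by linarith
  qed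
qed

text \<open>Near-optimal packings inside the intervals of a given packing together form a packing of no greater
  total length, to which the absolute continuity of \<open>\<gamma>\<close> applies.\<close>
lemma total_variation_AC:
  assumes ac: "absolutely_continuous_curve a b \<gamma>" and e: "\<epsilon> > 0"
  obtains \<delta> where "\<delta> > 0"
    "\<And>(I::'i set) u v. packing a b I u v \<Longrightarrow> total_length I u v < \<delta> \<Longrightarrow>
       (\<Sum>i\<in>I. total_variation \<gamma> a (v i) - total_variation \<gamma> a (u i)) < \<epsilon>"
proof -
  have e2: "\<epsilon>/2 > 0" using e by simp
  obtain \<delta> where d: "\<delta> > 0" and D: "\<And>I u v. packing a b (I::('i \<times> nat) set) u v \<Longrightarrow>
       total_length I u v < \<delta> \<Longrightarrow> oscillation \<gamma> I u v < \<epsilon>/2"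
    using AC_packing[OF ac e2] by blast
  have "(\<Sum>i\<in>I. total_variation \<gamma> a (v i) - total_variation \<gamma> a (u i)) < \<epsilon>"
    if p: "packing a b I u v" and len: "total_length I u v < \<delta>" for I :: "'i set" and u v
  proof -
    have fin: "finite I" and uv: "\<And>i. i \<in> I \<Longrightarrow> a \<le> u i \<and> u i \<le> v i \<and> v i \<le> b"
      and no: "\<And>i j. i \<in> I \<Longrightarrow> j \<in> I \<Longrightarrow> i \<noteq> j \<Longrightarrow> v i \<le> u j \<or> v j \<le> u i"
      using p unfolding packing_def by auto
    \<comment> \<open>one \<open>\<eta>\<close> is lost per interval, at most \<open>\<epsilon>/2\<close> altogether\<close>
    define \<eta> where "\<eta> = \<epsilon> / (2 * (real (card I) + 1))"
    have eta: "\<eta> > 0" using e by (simp add: \<eta>_def)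
    have "\<exists>J p q. packing (u i) (v i) (J::nat set) p q \<and>
        total_variation \<gamma> (u i) (v i) - \<eta> < (\<Sum>j\<in>J. dist (\<gamma> (p j)) (\<gamma> (q j)))" if "i \<in> I" for i
      by (rule total_variation_approx[OF ac]) (use uv[OF that] eta in auto)
    then obtain J p q where J: "\<And>i. i \<in> I \<Longrightarrow> packing (u i) (v i) (J i :: nat set) (p i) (q i)"
      and near: "\<And>i. i \<in> I \<Longrightarrow> total_variation \<gamma> (u i) (v i) - \<eta> < (\<Sum>j\<in>J i. dist (\<gamma> (p i j)) (\<gamma> (q i j)))"
      by metis
    have fJ: "finite (J i)" and pq: "\<And>j. j \<in> J i \<Longrightarrow> u i \<le> p i j \<and> p i j \<le> q i j \<and> q i j \<le> v i"
      and noJ: "\<And>j k. j \<in> J i \<Longrightarrow> k \<in> J i \<Longrightarrow> j \<noteq> k \<Longrightarrow> q i j \<le> p i k \<or> q i k \<le> p i j" if "i \<in> I" for i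
      using J[OF that] unfolding packing_def by auto
    have pack: "packing a b (Sigma I J) (\<lambda>(i,j). p i j) (\<lambda>(i,j). q i j)"
      unfolding packing_def
    proof (intro conjI ballI impI)
      show "finite (Sigma I J)" using fin fJ by auto
      fix x assume "x \<in> Sigma I J"
      then obtain i j where x: "x = (i,j)" "i \<in> I" "j \<in> J i" by auto
      show "a \<le> (case x of (i, j) \<Rightarrow> p i j)" "(case x of (i, j) \<Rightarrow> q i j) \<le> b" 
        "(case x of (i, j) \<Rightarrow> p i j) \<le> (case x of (i, j) \<Rightarrow> q i j)"
        using x pq[OF x(2,3)] uv[OF x(2)] by auto
      fix y assume "y \<in> Sigma I J" "x \<noteq> y"
      then obtain k l where y: "y = (k,l)" "k \<in> I" "l \<in> J k" by auto
      show "(case x of (i, j) \<Rightarrow> q i j) \<le> (case y of (i, j) \<Rightarrow> p i j) \<or> (case y of (i, j) \<Rightarrow> q i j) \<le> (case x of (i, j) \<Rightarrow> p i j)"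
      proof (cases "i = k")
        case True
        then show ?thesis using noJ[OF x(2,3), of l] x y \<open>x \<noteq> y\<close> by auto
      next
        case False
        from no[OF x(2) y(2) this] show ?thesis using pq[OF x(2,3)] pq[OF y(2,3)] x y by auto
      qed
    qed
    have "(\<Sum>x\<in>Sigma I J. (case x of (i, j) \<Rightarrow> q i j) - (case x of (i, j) \<Rightarrow> p i j)) = (\<Sum>i\<in>I. \<Sum>j\<in>J i. q i j - p i j)"
      by (subst sum.Sigma) (use fin fJ in \<open>auto simp: split_beta\<close>)
    also have "\<dots> \<le> total_length I u v"
      by (rule sum_mono, rule packing_length_le) (use J uv in auto)
    finally have "(\<Sum>x\<in>Sigma I J. dist (\<gamma> (case x of (i, j) \<Rightarrow> p i j)) (\<gamma> (case x of (i, j) \<Rightarrow> q i j))) < \<epsilon>/2"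
      using D[OF pack] len by linarith
    also have "(\<Sum>x\<in>Sigma I J. dist (\<gamma> (case x of (i, j) \<Rightarrow> p i j)) (\<gamma> (case x of (i, j) \<Rightarrow> q i j)))
       = (\<Sum>i\<in>I. \<Sum>j\<in>J i. dist (\<gamma> (p i j)) (\<gamma> (q i j)))"
      by (subst sum.Sigma) (use fin fJ in \<open>auto simp: split_beta\<close>)
    finally have small: "(\<Sum>i\<in>I. \<Sum>j\<in>J i. dist (\<gamma> (p i j)) (\<gamma> (q i j))) < \<epsilon>/2" .
    have "(\<Sum>i\<in>I. total_variation \<gamma> a (v i) - total_variation \<gamma> a (u i)) \<le> (\<Sum>i\<in>I. (\<Sum>j\<in>J i. dist (\<gamma> (p i j)) (\<gamma> (q i j))) + \<eta>)"
    proof (rule sum_mono)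
      fix i assume i: "i \<in> I"
      have "total_variation \<gamma> a (v i) \<le> total_variation \<gamma> a (u i) + total_variation \<gamma> (u i) (v i)"
        by (rule total_variation_increment(2)[OF ac]) (use uv[OF i] in auto)
      with near[OF i] show "total_variation \<gamma> a (v i) - total_variation \<gamma> a (u i) \<le> (\<Sum>j\<in>J i. dist (\<gamma> (p i j)) (\<gamma> (q i j))) + \<eta>"
        by linarith
    qed
    also have "\<dots> = (\<Sum>i\<in>I. \<Sum>j\<in>J i. dist (\<gamma> (p i j)) (\<gamma> (q i j))) + real (card I) * \<eta>"
      by (simp add: sum.distrib)
    also have "real (card I) * \<eta> \<le> \<epsilon>/2"
      using e by (simp add: \<eta>_def field_simps)
    finally show ?thesis using small by linarith
  qed
  with d that show thesis by blast
qed

text \<open>The Stieltjes measure of \<open>F\<close> vanishes on Lebesgue null sets: such a set is covered by nonoverlapping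
  intervals of small total length, whose measure is small by absolute continuity.  The density is
  then the Radon-Nikodym derivative.\<close>
lemma monotone_AC_density:
  fixes F :: "real \<Rightarrow> real"
  assumes mono: "\<And>x y. x \<le> y \<Longrightarrow> F x \<le> F y"
    and ac: "\<And>\<epsilon>. \<epsilon> > 0 \<Longrightarrow> \<exists>\<delta>>0. \<forall>I u v. (\<exists>a b. packing a b (I::real set set) u v) \<longrightarrow>
       total_length I u v < \<delta> \<longrightarrow> (\<Sum>i\<in>I. F (v i) - F (u i)) \<le> \<epsilon>"
  obtains g where "\<And>x. 0 \<le> g x" "\<And>x y. x \<le> y \<Longrightarrow> (g has_integral (F y - F x)) {x..y}"
proof -
  have cont: "continuous_on UNIV F"
    unfolding continuous_on_iff
  proof (intro ballI allI impI)
    fix x and \<epsilon> :: real assume "\<epsilon> > 0"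
    then obtain \<delta> where d: "\<delta> > 0" and D: "\<And>I u v a b. packing a b (I::real set set) u v \<Longrightarrow>
       total_length I u v < \<delta> \<Longrightarrow> (\<Sum>i\<in>I. F (v i) - F (u i)) \<le> \<epsilon>/2"
      using ac[of "\<epsilon>/2"] by (metis half_gt_zero)
    have "dist (F y) (F x) < \<epsilon>" if "dist y x < \<delta>" for y
      using D[of "min x y" "max x y" "{{}}" "\<lambda>_. min x y" "\<lambda>_. max x y"] that \<open>\<epsilon> > 0\<close> mono[of x y] mono[of y x]
      by (cases "x \<le> y") (auto simp: packing_def min_def max_def dist_real_def)
    with d show "\<exists>d>0. \<forall>x'\<in>UNIV. dist x' x < d \<longrightarrow> dist (F x') (F x) < \<epsilon>" by blast
  qed
  then have rc: "\<And>a. continuous (at_right a) F"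
    by (metis UNIV_I continuous_at_imp_continuous_at_within continuous_on_eq_continuous_at open_UNIV)
  let ?M = "interval_measure F"
  have Icc: "emeasure ?M {x..y} = F y - F x" if "x \<le> y" for x y
    by (rule emeasure_interval_measure_Icc) (use that mono cont in auto)
  have abs: "absolutely_continuous lborel ?M"
    unfolding absolutely_continuous_def
  proof
    fix N assume N: "N \<in> null_sets (lborel :: real measure)"
    have "emeasure ?M (N \<inter> {-real k..real k}) = 0" for k
    proof -
      let ?N = "N \<inter> {-real k..real k}"
      have N0: "?N \<in> sets borel" using N by auto
      have "emeasure ?M ?N \<le> ennreal \<epsilon>" if "\<epsilon> > 0" for \<epsilon>
      proof -
        obtain \<delta> where d: "\<delta> > 0" and D: "\<And>I u v a b. packing a b (I::real set set) u v \<Longrightarrow>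
           total_length I u v < \<delta> \<Longrightarrow> (\<Sum>i\<in>I. F (v i) - F (u i)) \<le> \<epsilon>"
          using ac[OF \<open>\<epsilon> > 0\<close>] by metis
        obtain U where U: "open U" "?N \<subseteq> U" "emeasure lborel (U - ?N) < ennreal \<delta>"
          using outer_regular_lborel[OF N0 d] by blast
        have "emeasure lborel U \<le> emeasure lborel (U - ?N) + emeasure lborel ?N"
          using U N0 by (subst plus_emeasure) (auto intro!: emeasure_mono)
        moreover have "emeasure lborel ?N = 0"
          using N N0 by (metis inf_le1 null_setsD1 null_sets_subset sets_lborel)
        ultimately have Ud: "emeasure lborel U < ennreal \<delta>" using U(3) by simp
        have g: "gauge (\<lambda>x. if x \<in> U then U else UNIV)" using U(1) by (auto simp: gauge_def)
        have sub: "?N \<subseteq> cbox (- real k - 1) (real k + 1)" by auto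
        have ne: "box (- real k - 1) (real k + 1) \<noteq> {}" by (auto simp: box_real)
        \<comment> \<open>a countable cover of the null set by nonoverlapping intervals inside \<open>U\<close>\<close>
        obtain \<D> where DD: "countable \<D>" "\<And>K. K \<in> \<D> \<Longrightarrow> interior K \<noteq> {} \<and> (\<exists>c d. K = cbox c d)"
          "pairwise (\<lambda>A B. interior A \<inter> interior B = {}) \<D>"
          "\<And>K. K \<in> \<D> \<Longrightarrow> \<exists>x \<in> ?N \<inter> K. K \<subseteq> (if x \<in> U then U else UNIV)" "?N \<subseteq> \<Union>\<D>"
          by (rule covering_lemma[OF sub ne g]) blast
        have KU: "K \<subseteq> U" if "K \<in> \<D>" for K
        proof -
          obtain x where "x \<in> ?N \<inter> K" "K \<subseteq> (if x \<in> U then U else UNIV)" using DD(4)[OF \<open>K \<in> \<D>\<close>] by blast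
          then show ?thesis using U(2) by (auto split: if_splits)
        qed
        have K: "\<exists>p q. K = {p..q} \<and> p < q \<and> Inf K = p \<and> Sup K = q" if "K \<in> \<D>" for K
        proof -
          obtain p q where "K = cbox p q" using DD(2)[OF \<open>K \<in> \<D>\<close>] by blast
          then show ?thesis using DD(2)[OF \<open>K \<in> \<D>\<close>] by auto
        qed
        have fin: "emeasure ?M (\<Union>E) \<le> ennreal \<epsilon>" if E: "E \<subseteq> \<D>" "finite E" for E
        proof -
          have order: "Sup K \<le> Inf L \<or> Sup L \<le> Inf K" if KL: "K \<in> E" "L \<in> E" "K \<noteq> L" for K L
          proof -
            obtain p q where pq: "K = {p..q}" "p < q" "Inf K = p" "Sup K = q" using K[of K] KL E by auto
            obtain r s where rs: "L = {r..s}" "r < s" "Inf L = r" "Sup L = s" using K[of L] KL E by auto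
            have "{p<..<q} \<inter> {r<..<s} = {}" using DD(3) KL E pq rs unfolding pairwise_def
              by (metis interior_atLeastAtMost_real subsetD)
            then have "(max p r + min q s) / 2 \<notin> {p<..<q} \<inter> {r<..<s}" by blast
            then show ?thesis using pq rs by (auto simp: max_def min_def split: if_splits)
          qed
          define lo where "lo = Min (insert 0 (Inf ` E))"
          define hi where "hi = Max (insert 0 (Sup ` E))"
          have pack: "packing lo hi E Inf Sup"
            unfolding packing_def
          proof (intro conjI ballI impI)
            fix L assume L: "L \<in> E"
            show "lo \<le> Inf L" "Sup L \<le> hi" using E(2) L by (auto simp: lo_def hi_def)
            show "Inf L \<le> Sup L" using K[of L] L E by auto
          qed (use order E in auto)
          have "ennreal (\<Sum>K\<in>E. Sup K - Inf K) = (\<Sum>K\<in>E. emeasure lborel (interior K))"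
          proof (subst sum_ennreal[symmetric])
            show "0 \<le> Sup L - Inf L" if "L \<in> E" for L using K[of L] that E by auto
            show "(\<Sum>K\<in>E. ennreal (Sup K - Inf K)) = (\<Sum>K\<in>E. emeasure lborel (interior K))"
            proof (rule sum.cong)
              fix L assume "L \<in> E"
              then obtain p q where "L = {p..q}" "p < q" "Inf L = p" "Sup L = q" using K[of L] E by auto
              then show "ennreal (Sup L - Inf L) = emeasure lborel (interior L)" by simp
            qed simp
          qed
          also have "\<dots> = emeasure lborel (\<Union>K\<in>E. interior K)"
          proof (rule sum_emeasure)
            show "interior ` E \<subseteq> sets lborel" by auto
            show "disjoint_family_on interior E"
              using DD(3) E(1) unfolding disjoint_family_on_def pairwise_def by (meson subsetD)
          qed (rule E(2))
          also have "\<dots> \<le> emeasure lborel U"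
          proof (rule emeasure_mono)
            show "(\<Union>K\<in>E. interior K) \<subseteq> U" using KU E(1) interior_subset by (meson UN_least order_trans subsetD)
          qed (use U(1) in simp)
          finally have "ennreal (\<Sum>K\<in>E. Sup K - Inf K) < ennreal \<delta>" using Ud by (rule order_le_less_trans)
          then have "(\<Sum>K\<in>E. Sup K - Inf K) < \<delta>" by (meson ennreal_leI not_less)
          then have small: "(\<Sum>K\<in>E. F (Sup K) - F (Inf K)) \<le> \<epsilon>" using D[OF pack] by simp
          have "emeasure ?M (\<Union>K\<in>E. K) \<le> (\<Sum>K\<in>E. emeasure ?M K)"
          proof (rule emeasure_subadditive_finite)
            show "(\<lambda>K. K) ` E \<subseteq> sets (interval_measure F)"
            proof (clarsimp simp: subset_iff)
              fix L assume "L \<in> E"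
              then obtain p q where "L = {p..q}" using K[of L] E(1) by auto
              then show "L \<in> sets borel" by simp
            qed
          qed (use E in auto)
          also have "\<dots> = (\<Sum>K\<in>E. ennreal (F (Sup K) - F (Inf K)))"
          proof (rule sum.cong)
            fix L assume "L \<in> E"
            then obtain p q where "L = {p..q}" "p < q" "Inf L = p" "Sup L = q" using K[of L] E by auto
            then show "emeasure ?M L = ennreal (F (Sup L) - F (Inf L))" by (simp add: Icc)
          qed simp
          also have "\<dots> = ennreal (\<Sum>K\<in>E. F (Sup K) - F (Inf K))"
          proof (rule sum_ennreal)
            show "0 \<le> F (Sup L) - F (Inf L)" if "L \<in> E" for L using K[of L] that E mono by fastforce
          qed
          also have "\<dots> \<le> ennreal \<epsilon>" using small by (rule ennreal_leI)
          finally show ?thesis by simp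
        qed
        show ?thesis
        proof (cases "\<D> = {}")
          case True
          then show ?thesis using DD(5) by simp
        next
          case False
          define f where "f = from_nat_into \<D>"
          have f: "range f = \<D>" unfolding f_def using DD(1) False by simp
          define A where "A = (\<lambda>n. \<Union>(f ` {..<n}))"
          have Am: "range A \<subseteq> sets ?M"
          proof -
            have "f i \<in> sets borel" for i
            proof -
              have "f i \<in> \<D>" using f by blast
              then obtain p q where "f i = {p..q}" using K[of "f i"] by blast
              then show ?thesis by simp
            qed
            then show ?thesis unfolding A_def by auto
          qed
          have inc: "incseq A" unfolding A_def incseq_def by fastforce
          have "(\<Union>n. A n) = \<Union>(range f)" unfolding A_def by blast
          then have "\<Union>\<D> = (\<Union>n. A n)" by (simp only: f)
          then have "emeasure ?M (\<Union>\<D>) = (SUP n. emeasure ?M (A n))"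
            using SUP_emeasure_incseq[OF Am inc] by simp
          also have "\<dots> \<le> ennreal \<epsilon>"
          proof (rule SUP_least)
            fix n
            have "f ` {..<n} \<subseteq> \<D>" unfolding f[symmetric] by (rule image_mono) simp
            from fin[OF this] show "emeasure ?M (A n) \<le> ennreal \<epsilon>" by (simp add: A_def)
          qed
          finally have "emeasure ?M (\<Union>\<D>) \<le> ennreal \<epsilon>" .
          moreover have "\<Union>\<D> \<in> sets ?M" using \<open>\<Union>\<D> = (\<Union>n. A n)\<close> Am by auto
          ultimately show ?thesis using emeasure_mono[OF DD(5), of ?M] by (meson order_trans)
        qed
      qed
      then have "emeasure ?M ?N \<le> 0 + ennreal e" if "e > 0" for e using that by simp
      then have "emeasure ?M ?N \<le> 0" by (rule ennreal_le_epsilon)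
      then show ?thesis by simp
    qed
    moreover have "N \<in> sets borel" using N by auto
    ultimately have "emeasure ?M (\<Union>k. N \<inter> {-real k..real k}) = 0"
      by (intro emeasure_UN_eq_0) auto
    moreover have "(\<Union>k. N \<inter> {-real k..real k}) = N"
    proof -
      have "\<exists>k. - real k \<le> x \<and> x \<le> real k" for x
      proof -
        obtain k :: nat where "\<bar>x\<bar> \<le> real k" using real_arch_simple by blast
        then have "- real k \<le> x \<and> x \<le> real k" by (simp add: abs_le_iff)
        then show ?thesis by blast
      qed
      then show ?thesis by auto
    qed
    ultimately show "N \<in> null_sets ?M" using \<open>N \<in> sets borel\<close> by auto
  qed
  obtain f where f: "f \<in> borel_measurable lborel" "density lborel f = ?M"
    using sigma_finite_measure.Radon_Nikodym[OF sigma_finite_lborel abs] by auto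
  define g where "g = (\<lambda>x. enn2real (f x))"
  have "(g has_integral (F y - F x)) {x..y}" if "x \<le> y" for x y
  proof -
    have I: "(\<integral>\<^sup>+z. f z * indicator {x..y} z \<partial>lborel) = ennreal (F y - F x)"
      using Icc[OF that] emeasure_density[OF f(1), of "{x..y}"] unfolding f(2) by simp
    have "AE z in lborel. f z * indicator {x..y} z \<noteq> \<infinity>"
      by (rule nn_integral_PInf_AE) (use f I in auto)
    then have "(\<integral>\<^sup>+z. ennreal (g z * indicator {x..y} z) \<partial>lborel) = (\<integral>\<^sup>+z. f z * indicator {x..y} z \<partial>lborel)"
      by (intro nn_integral_cong_AE, eventually_elim) (auto simp: g_def indicator_def top.not_eq_extremum)
    with I have "((\<lambda>z. g z * indicator {x..y} z) has_integral (F y - F x)) UNIV"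
      by (intro nn_integral_has_integral) (use f mono[OF that] in \<open>auto simp: g_def\<close>)
    then show ?thesis
      by (subst has_integral_restrict_UNIV[symmetric], elim has_integral_eq[rotated]) (auto simp: indicator_def)
  qed
  moreover have "0 \<le> g x" for x by (simp add: g_def)
  ultimately show thesis using that by blast
qed

text \<open>Each coordinate is half the difference of two monotone functions, the variation plus and minus that
  coordinate, whose increments are at most twice those of the variation.\<close>
theorem AC_integral_representation:
  fixes \<gamma> :: "real \<Rightarrow> 'v::euclidean_space"
  assumes ac: "absolutely_continuous_curve a b \<gamma>" and ab: "a \<le> b"
  obtains g where "g absolutely_integrable_on {a..b}"
    "\<And>x y. a \<le> x \<Longrightarrow> x \<le> y \<Longrightarrow> y \<le> b \<Longrightarrow> (g has_integral (\<gamma> y - \<gamma> x)) {x..y}"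
proof -
  \<comment> \<open>extends everything to the line by constants\<close>
  define cl where "cl = (\<lambda>t. max a (min b t))"
  have cl: "a \<le> cl t" "cl t \<le> b" for t using ab by (auto simp: cl_def)
  have cl_mono: "cl x \<le> cl y" "cl y - cl x \<le> y - x" if "x \<le> y" for x y
    using that ab by (auto simp: cl_def)
  have cl_id: "cl t = t" if "a \<le> t" "t \<le> b" for t using that by (auto simp: cl_def)
  define V where "V = (\<lambda>t. total_variation \<gamma> a (cl t))"
  have dens: "\<exists>g. (\<forall>x. 0 \<le> g x) \<and> (\<forall>x y. x \<le> y \<longrightarrow> (g has_integral (F y - F x)) {x..y})"
    if F: "\<And>x y. x \<le> y \<Longrightarrow> F x \<le> F y \<and> F y - F x \<le> 2 * (V y - V x)" for F :: "real \<Rightarrow> real"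
  proof (rule monotone_AC_density[of F])
    fix \<epsilon> :: real assume "\<epsilon> > 0"
    then have "\<epsilon>/2 > 0" by simp
    from total_variation_AC[OF ac this] obtain \<delta> where d: "\<delta> > 0" and
      D: "\<And>(I::real set set) u v. packing a b I u v \<Longrightarrow> total_length I u v < \<delta> \<Longrightarrow>
       (\<Sum>i\<in>I. total_variation \<gamma> a (v i) - total_variation \<gamma> a (u i)) < \<epsilon>/2" by blast
    have "(\<Sum>i\<in>I. F (v i) - F (u i)) \<le> \<epsilon>" 
      if p: "packing a' b' I u v" and len: "total_length I u v < \<delta>" for a' b' and I :: "real set set" and u v
    proof -
      have uv: "\<And>i. i \<in> I \<Longrightarrow> u i \<le> v i" using p by (auto simp: packing_def)
      have "packing a b I (\<lambda>i. cl (u i)) (\<lambda>i. cl (v i))"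
        unfolding packing_def
      proof (intro conjI ballI impI)
        show "finite I" using p by (simp add: packing_def)
        fix i assume i: "i \<in> I"
        show "a \<le> cl (u i)" "cl (v i) \<le> b" by (rule cl)+
        show "cl (u i) \<le> cl (v i)" by (rule cl_mono(1)[OF uv[OF i]])
        fix j assume "j \<in> I" "i \<noteq> j"
        with i p have "v i \<le> u j \<or> v j \<le> u i" by (simp add: packing_def)
        then show "cl (v i) \<le> cl (u j) \<or> cl (v j) \<le> cl (u i)" using cl_mono(1) by meson
      qed
      moreover have "(\<Sum>i\<in>I. cl (v i) - cl (u i)) \<le> total_length I u v"
        by (rule sum_mono) (use uv cl_mono in auto)
      ultimately have sm: "(\<Sum>i\<in>I. V (v i) - V (u i)) < \<epsilon>/2" unfolding V_def using D len by fastforce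
      have *: "(\<Sum>i\<in>I. F (v i) - F (u i)) \<le> (\<Sum>i\<in>I. 2 * (V (v i) - V (u i)))"
        by (rule sum_mono) (use uv F in auto)
      from * have "(\<Sum>i\<in>I. F (v i) - F (u i)) \<le> 2 * (\<Sum>i\<in>I. V (v i) - V (u i))" by (simp only: sum_distrib_left)
      then show ?thesis using sm by linarith
    qed
    with d show "\<exists>\<delta>>0. \<forall>I u v. (\<exists>a b. packing a b (I::real set set) u v) \<longrightarrow>
       total_length I u v < \<delta> \<longrightarrow> (\<Sum>i\<in>I. F (v i) - F (u i)) \<le> \<epsilon>" by blast
  qed (use F in auto)
  have inc: "\<bar>\<gamma> (cl y) \<bullet> e - \<gamma> (cl x) \<bullet> e\<bar> \<le> V y - V x" if "x \<le> y" "e \<in> Basis" for x y e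
  proof -
    have "\<bar>\<gamma> (cl y) \<bullet> e - \<gamma> (cl x) \<bullet> e\<bar> \<le> dist (\<gamma> (cl x)) (\<gamma> (cl y))"
      using Basis_le_norm[OF that(2), of "\<gamma> (cl y) - \<gamma> (cl x)"] by (simp add: inner_diff_left dist_norm norm_minus_commute)
    then show ?thesis
      using total_variation_increment(1)[OF ac cl(1)[of x] cl_mono(1)[OF that(1)] cl(2)[of y]] by (simp add: V_def)
  qed
  have "\<exists>g. (\<forall>x. 0 \<le> g x) \<and> (\<forall>x y. x \<le> y \<longrightarrow> (g has_integral ((V y + \<gamma> (cl y) \<bullet> e) - (V x + \<gamma> (cl x) \<bullet> e))) {x..y})"
    if "e \<in> Basis" for e
    by (rule dens) (use inc[OF _ that] in \<open>fastforce simp: abs_le_iff\<close>)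
  then obtain p where p: "\<And>e x. e \<in> Basis \<Longrightarrow> 0 \<le> p e x" "\<And>e x y. e \<in> Basis \<Longrightarrow> x \<le> y \<Longrightarrow>
      (p e has_integral ((V y + \<gamma> (cl y) \<bullet> e) - (V x + \<gamma> (cl x) \<bullet> e))) {x..y}" by metis
  have "\<exists>g. (\<forall>x. 0 \<le> g x) \<and> (\<forall>x y. x \<le> y \<longrightarrow> (g has_integral ((V y - \<gamma> (cl y) \<bullet> e) - (V x - \<gamma> (cl x) \<bullet> e))) {x..y})"
    if "e \<in> Basis" for e
    by (rule dens) (use inc[OF _ that] in \<open>fastforce simp: abs_le_iff\<close>)
  then obtain q where q: "\<And>e x. e \<in> Basis \<Longrightarrow> 0 \<le> q e x" "\<And>e x y. e \<in> Basis \<Longrightarrow> x \<le> y \<Longrightarrow>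
      (q e has_integral ((V y - \<gamma> (cl y) \<bullet> e) - (V x - \<gamma> (cl x) \<bullet> e))) {x..y}" by metis
  define g where "g = (\<lambda>t. \<Sum>e\<in>Basis. ((p e t - q e t) / 2) *\<^sub>R e)"
  have "(g has_integral (\<gamma> y - \<gamma> x)) {x..y}" if xy: "a \<le> x" "x \<le> y" "y \<le> b" for x y
  proof -
    have "(g has_integral (\<Sum>e\<in>Basis. ((\<gamma> y - \<gamma> x) \<bullet> e) *\<^sub>R e)) {x..y}"
      unfolding g_def
    proof (rule has_integral_sum)
      fix e :: 'v assume e: "e \<in> Basis"
      from has_integral_diff[OF p(2)[OF e xy(2)] q(2)[OF e xy(2)]]
      have "((\<lambda>t. p e t - q e t) has_integral 2 * ((\<gamma> y - \<gamma> x) \<bullet> e)) {x..y}"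
        using cl_id xy by (simp add: inner_diff_left algebra_simps)
      from has_integral_divide[OF this, of 2]
      have "((\<lambda>t. (p e t - q e t) / 2) has_integral ((\<gamma> y - \<gamma> x) \<bullet> e)) {x..y}" by simp
      then show "((\<lambda>t. ((p e t - q e t) / 2) *\<^sub>R e) has_integral ((\<gamma> y - \<gamma> x) \<bullet> e) *\<^sub>R e) {x..y}"
        by (rule has_integral_scaleR_left)
    qed simp
    then show ?thesis by (simp add: euclidean_representation)
  qed
  moreover have "g absolutely_integrable_on {a..b}"
    unfolding g_def
  proof (rule absolutely_integrable_sum)
    fix e :: 'v assume e: "e \<in> Basis"
    have "p e absolutely_integrable_on {a..b}" "q e absolutely_integrable_on {a..b}"
      using p(1)[OF e] q(1)[OF e] p(2)[OF e ab] q(2)[OF e ab]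
      by (auto intro!: nonnegative_absolutely_integrable_1)
    then have "(\<lambda>t. (p e t - q e t) / 2) absolutely_integrable_on {a..b}"
      by (auto intro: set_integral_diff)
    then show "(\<lambda>t. ((p e t - q e t) / 2) *\<^sub>R e) absolutely_integrable_on {a..b}"
      by (rule absolutely_integrable_scaleR_right)
  qed simp
  ultimately show thesis using that by blast
qed

text \<open>Lebesgue's differentiation theorem yields the derivative from the right; applied to the reflected
  function it yields the derivative from the left.\<close>
lemma indefinite_integral_derivative_AE:
  fixes \<gamma> g :: "real \<Rightarrow> 'v::euclidean_space"
  assumes I: "\<And>x y. a \<le> x \<Longrightarrow> x \<le> y \<Longrightarrow> y \<le> b \<Longrightarrow> (g has_integral (\<gamma> y - \<gamma> x)) {x..y}"
    and ab: "a \<le> b"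
  obtains N where "negligible N" "\<And>t. a < t \<Longrightarrow> t < b \<Longrightarrow> t \<notin> N \<Longrightarrow> (\<gamma> has_vector_derivative g t) (at t)"
proof -
  define G where "G = (\<lambda>t. if t \<in> {a..b} then g t else 0)"
  have "g integrable_on {a..b}" using I[OF order_refl ab order_refl] by blast
  then have "G integrable_on UNIV" unfolding G_def by (subst integrable_restrict_UNIV)
  then have Gi: "G integrable_on cbox c d" for c d by (rule integrable_on_subcbox) auto
  have Hi: "(\<lambda>t. G (- t)) integrable_on cbox c d" for c d
    using Gi[of "-d" "-c"] Henstock_Kurzweil_Integration.integrable_reflect_real[where f=G and b="-c" and a="-d"] by simp
  obtain N1 where N1: "negligible N1" "\<And>x e. x \<notin> N1 \<Longrightarrow> 0 < e \<Longrightarrow> \<exists>d>0. \<forall>h. 0 < h \<and> h < d \<longrightarrow>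
        norm (integral (cbox x (x + h *\<^sub>R One)) G /\<^sub>R h ^ DIM(real) - G x) < e"
    by (rule integrable_ccontinuous_explicit[OF Gi]) blast
  obtain N2 where N2: "negligible N2" "\<And>x e. x \<notin> N2 \<Longrightarrow> 0 < e \<Longrightarrow> \<exists>d>0. \<forall>h. 0 < h \<and> h < d \<longrightarrow>
        norm (integral (cbox x (x + h *\<^sub>R One)) (\<lambda>t. G (- t)) /\<^sub>R h ^ DIM(real) - G (- x)) < e"
    by (rule integrable_ccontinuous_explicit[OF Hi]) blast
  have int: "integral {x..y} G = \<gamma> y - \<gamma> x" if "a \<le> x" "x \<le> y" "y \<le> b" for x y
  proof -
    have "integral {x..y} G = integral {x..y} g"
      by (rule integral_cong) (use that in \<open>auto simp: G_def\<close>)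
    then show ?thesis using I[OF that] by (simp add: integral_unique)
  qed
  let ?N = "N1 \<union> uminus ` N2"
  have "negligible ?N"
    using N1(1) N2(1)
    by (intro negligible_Un negligible_differentiable_image_negligible) (auto intro!: differentiable_on_minus)
  moreover have "(\<gamma> has_vector_derivative g t) (at t)" if t: "a < t" "t < b" "t \<notin> ?N" for t
    unfolding has_vector_derivative_def has_derivative_at_alt
  proof (intro conjI allI impI)
    show "bounded_linear (\<lambda>x. x *\<^sub>R g t)" by (rule bounded_linear_scaleR_left)
    fix e :: real assume e: "e > 0"
    have tn: "t \<notin> N1" "- t \<notin> N2" using t by force+
    obtain d1 where d1: "d1 > 0" "\<And>h. 0 < h \<Longrightarrow> h < d1 \<Longrightarrow> norm (integral {t..t + h} G /\<^sub>R h - G t) < e"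
      using N1(2)[OF tn(1) e] by auto
    obtain d2 where d2: "d2 > 0" "\<And>h. 0 < h \<Longrightarrow> h < d2 \<Longrightarrow> norm (integral {-t..-t + h} (\<lambda>t. G (- t)) /\<^sub>R h - G t) < e"
      using N2(2)[OF tn(2) e] by auto
    have Gt: "G t = g t" using t by (simp add: G_def)
    define d where "d = Min {d1, d2, t - a, b - t}"
    have d: "d > 0" "d \<le> d1" "d \<le> d2" "d \<le> t - a" "d \<le> b - t" using d1 d2 t by (auto simp: d_def)
    have "norm (\<gamma> y - \<gamma> t - (y - t) *\<^sub>R g t) \<le> e * norm (y - t)" if y: "norm (y - t) < d" for y
    proof (cases y t rule: linorder_cases)
      case less
      define h where "h = t - y"
      have h: "0 < h" "h < d2" "y = t - h" using less y d by (auto simp: h_def)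
      have "integral {-t..-t + h} (\<lambda>t. G (- t)) = integral {t-h..t} G"
        using Henstock_Kurzweil_Integration.integral_reflect_real[where f=G and b=t and a="t-h"] by simp
      also have "\<dots> = \<gamma> t - \<gamma> y" using h y d t by (subst int) auto
      finally have "norm ((\<gamma> t - \<gamma> y) /\<^sub>R h - g t) < e" using d2(2)[OF h(1,2)] Gt by simp
      then have "h * norm ((\<gamma> t - \<gamma> y) /\<^sub>R h - g t) \<le> h * e" using h by simp
      also have "h * norm ((\<gamma> t - \<gamma> y) /\<^sub>R h - g t) = norm (h *\<^sub>R ((\<gamma> t - \<gamma> y) /\<^sub>R h - g t))"
        using h by simp
      also have "h *\<^sub>R ((\<gamma> t - \<gamma> y) /\<^sub>R h - g t) = - (\<gamma> y - \<gamma> t - (y - t) *\<^sub>R g t)"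
        using h by (simp add: scaleR_diff_right)
      finally show ?thesis using h by (simp only: norm_minus_cancel) (simp add: mult.commute)
    next
      case equal
      then show ?thesis by simp
    next
      case greater
      define h where "h = y - t"
      have h: "0 < h" "h < d1" "y = t + h" using greater y d by (auto simp: h_def)
      have "integral {t..t + h} G = \<gamma> y - \<gamma> t" using h y d t by (subst int) auto
      then have "norm ((\<gamma> y - \<gamma> t) /\<^sub>R h - g t) < e" using d1(2)[OF h(1,2)] Gt by simp
      then have "h * norm ((\<gamma> y - \<gamma> t) /\<^sub>R h - g t) \<le> h * e" using h by simp
      also have "h * norm ((\<gamma> y - \<gamma> t) /\<^sub>R h - g t) = norm (h *\<^sub>R ((\<gamma> y - \<gamma> t) /\<^sub>R h - g t))"
        using h by simp
      also have "h *\<^sub>R ((\<gamma> y - \<gamma> t) /\<^sub>R h - g t) = \<gamma> y - \<gamma> t - (y - t) *\<^sub>R g t"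
        using h by (simp add: scaleR_diff_right)
      finally show ?thesis using h by (simp add: mult.commute)
    qed
    with d(1) show "\<exists>d>0. \<forall>y. norm (y - t) < d \<longrightarrow> norm (\<gamma> y - \<gamma> t - (y - t) *\<^sub>R g t) \<le> e * norm (y - t)" by blast
  qed
  ultimately show thesis using that by blast
qed

section \<open>The action of a potential and its distance\<close>

text \<open>A derivative that may be changed on a null set, together with the fundamental theorem of calculus.
  All computations with actions use such a function instead of \<^const>\<open>vector_derivative\<close>, whose values
  at exceptional times obey no rules.\<close>
definition velocity :: "real \<Rightarrow> real \<Rightarrow> (real \<Rightarrow> 'v::euclidean_space) \<Rightarrow> (real \<Rightarrow> 'v) \<Rightarrow> bool"
  where "velocity a b \<gamma> g \<longleftrightarrow> g absolutely_integrable_on {a..b} \<and>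
    (\<forall>x y. a \<le> x \<longrightarrow> x \<le> y \<longrightarrow> y \<le> b \<longrightarrow> (g has_integral (\<gamma> y - \<gamma> x)) {x..y}) \<and>
    (\<exists>N. negligible N \<and> (\<forall>t. a < t \<longrightarrow> t < b \<longrightarrow> t \<notin> N \<longrightarrow> (\<gamma> has_vector_derivative g t) (at t)))"

lemma velocity_has_integral:
  "velocity a b \<gamma> g \<Longrightarrow> a \<le> x \<Longrightarrow> x \<le> y \<Longrightarrow> y \<le> b \<Longrightarrow> (g has_integral (\<gamma> y - \<gamma> x)) {x..y}"
  unfolding velocity_def by blast

lemma AC_velocity:
  assumes "absolutely_continuous_curve a b \<gamma>" "a \<le> b"
  obtains g where "velocity a b \<gamma> g"
proof -
  obtain g where g: "g absolutely_integrable_on {a..b}"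
    "\<And>x y. a \<le> x \<Longrightarrow> x \<le> y \<Longrightarrow> y \<le> b \<Longrightarrow> (g has_integral (\<gamma> y - \<gamma> x)) {x..y}"
    using AC_integral_representation[OF assms] by blast
  obtain N where "negligible N" "\<And>t. a < t \<Longrightarrow> t < b \<Longrightarrow> t \<notin> N \<Longrightarrow> (\<gamma> has_vector_derivative g t) (at t)"
    using indefinite_integral_derivative_AE[OF g(2) assms(2)] by blast
  with g that show thesis unfolding velocity_def by blast
qed

text \<open>Two derivatives of a curve agree almost everywhere, so the integral representation with one of
  them carries over to the other.\<close>
lemma velocityI:
  assumes "absolutely_continuous_curve a b \<gamma>" "a \<le> b" "negligible N"
    and "\<And>t. a < t \<Longrightarrow> t < b \<Longrightarrow> t \<notin> N \<Longrightarrow> (\<gamma> has_vector_derivative g' t) (at t)"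
  shows "velocity a b \<gamma> g'"
proof -
  obtain g where g: "velocity a b \<gamma> g" using AC_velocity assms(1,2) by blast
  then obtain M where M: "negligible M" "\<And>t. a < t \<Longrightarrow> t < b \<Longrightarrow> t \<notin> M \<Longrightarrow> (\<gamma> has_vector_derivative g t) (at t)"
    unfolding velocity_def by blast
  define S where "S = insert a (insert b (M \<union> N))"
  have S: "negligible S" using assms(3) M(1) by (simp add: S_def)
  have eq: "g' t = g t" if "t \<in> {a..b} - S" for t
  proof -
    have t: "a < t" "t < b" "t \<notin> M" "t \<notin> N" using that by (auto simp: S_def)
    show ?thesis using vector_derivative_unique_at[OF assms(4)[OF t(1,2,4)] M(2)[OF t(1-3)]] .
  qed
  have "g' absolutely_integrable_on {a..b}"
    by (rule absolutely_integrable_spike[OF _ S eq]) (use g in \<open>simp add: velocity_def\<close>)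
  moreover have "(g' has_integral (\<gamma> y - \<gamma> x)) {x..y}" if "a \<le> x" "x \<le> y" "y \<le> b" for x y
    by (rule has_integral_spike[OF S _ velocity_has_integral[OF g that]]) (use eq that in auto)
  ultimately show ?thesis unfolding velocity_def using assms(3,4) by blast
qed

lemma velocity_subinterval:
  assumes "velocity a b \<gamma> g" "a \<le> a'" "b' \<le> b"
  shows "velocity a' b' \<gamma> g"
proof -
  have "g absolutely_integrable_on {a'..b'}"
    by (rule set_integrable_subset[where A="{a..b}"]) (use assms in \<open>auto simp: velocity_def\<close>)
  moreover obtain N where "negligible N" "\<forall>t. a < t \<longrightarrow> t < b \<longrightarrow> t \<notin> N \<longrightarrow> (\<gamma> has_vector_derivative g t) (at t)"
    using assms(1) unfolding velocity_def by blast
  moreover have "(g has_integral (\<gamma> y - \<gamma> x)) {x..y}" if "a' \<le> x" "x \<le> y" "y \<le> b'" for x y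
    by (rule velocity_has_integral[OF assms(1)]) (use that assms in auto)
  ultimately show ?thesis unfolding velocity_def using assms(2,3) by (meson order_le_less_trans order_less_le_trans)
qed

definition action ::
    "('v::euclidean_space \<Rightarrow> ennreal) \<Rightarrow> real \<Rightarrow> real \<Rightarrow> real \<Rightarrow> (real \<Rightarrow> 'v) \<Rightarrow> ennreal"
  where "action U h a b \<gamma> =
    (\<integral>\<^sup>+t. (ennreal (1/2 * (norm (vector_derivative \<gamma> (at t within {a..b})))\<^sup>2) + U (\<gamma> t) + ennreal h)
      \<partial>(lebesgue_on {a..b}))"

definition jdist :: "('v::euclidean_space \<Rightarrow> ennreal) \<Rightarrow> real \<Rightarrow> 'v \<Rightarrow> 'v \<Rightarrow> ennreal"
  where "jdist U h x y = Inf {action U h a b \<gamma> | a b \<gamma>.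
           a < b \<and> absolutely_continuous_curve a b \<gamma> \<and> \<gamma> a = x \<and> \<gamma> b = y}"

definition lagrangian ::
    "('v::euclidean_space \<Rightarrow> ennreal) \<Rightarrow> real \<Rightarrow> (real \<Rightarrow> 'v) \<Rightarrow> (real \<Rightarrow> 'v) \<Rightarrow> real \<Rightarrow> ennreal"
  where "lagrangian U h \<gamma> g t = ennreal (1/2 * (norm (g t))\<^sup>2) + U (\<gamma> t) + ennreal h"

lemma action_velocity:
  assumes "velocity a b \<gamma> g"
  shows "action U h a b \<gamma> = (\<integral>\<^sup>+t. lagrangian U h \<gamma> g t * indicator {a..b} t \<partial>lebesgue)"
proof -
  obtain N where N: "negligible N" "\<And>t. a < t \<Longrightarrow> t < b \<Longrightarrow> t \<notin> N \<Longrightarrow> (\<gamma> has_vector_derivative g t) (at t)"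
    using assms unfolding velocity_def by blast
  have "negligible (insert a (insert b N))" using N(1) by simp
  then have "AE t in lebesgue. t \<notin> insert a (insert b N)"
    by (intro AE_not_in) (simp only: negligible_iff_null_sets)
  then have "AE t in lebesgue. (ennreal (1/2 * (norm (vector_derivative \<gamma> (at t within {a..b})))\<^sup>2) + U (\<gamma> t) + ennreal h) * indicator {a..b} t
    = lagrangian U h \<gamma> g t * indicator {a..b} t"
  proof eventually_elim
    case (elim t)
    show ?case
    proof (cases "t \<in> {a..b}")
      case True
      then have t: "a < t" "t < b" "t \<notin> N" using elim by auto
      have "vector_derivative \<gamma> (at t within {a..b}) = g t"
        using vector_derivative_at[OF N(2)[OF t]] t by (simp add: at_within_Icc_at)
      then show ?thesis by (simp add: lagrangian_def)
    qed simp
  qed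
  then show ?thesis
    unfolding action_def by (subst nn_integral_restrict_space) (auto intro!: nn_integral_cong_AE)
qed

locale potential =
  fixes U :: "'v::euclidean_space \<Rightarrow> ennreal" and h :: real
  assumes U_meas: "U \<in> borel_measurable borel" and h_pos: "h > 0"
begin

text \<open>The speed at infinity of motions of energy \<open>h\<close>, and the ratio of \<open>d\<close> to the Euclidean distance at
  places where the potential is negligible.\<close>
definition c :: real where "c = sqrt (2 * h)"

lemma c_pos: "c > 0" and c_sq: "c * c = 2 * h"
  using h_pos by (auto simp: c_def)

abbreviation act where "act \<equiv> action U h"
abbreviation d where "d \<equiv> jdist U h"

lemma lagrangian_measurable:
  assumes g: "velocity a b \<gamma> g"
  shows "(\<lambda>t. lagrangian U h \<gamma> g t * indicator {a..b} t) \<in> borel_measurable lebesgue"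
proof -
  have cont: "continuous_on {a..b} \<gamma>"
  proof (cases "a \<le> b")
    case True
    have gi: "g integrable_on {a..b}"
      using g unfolding velocity_def by (simp add: absolutely_integrable_on_def)
    have "continuous_on {a..b} (\<lambda>x. \<gamma> a + integral {a..x} g)"
      by (intro continuous_intros indefinite_integral_continuous_1 gi)
    then show ?thesis
    proof (rule continuous_on_eq)
      fix x assume "x \<in> {a..b}"
      then show "\<gamma> a + integral {a..x} g = \<gamma> x"
        using integral_unique[OF velocity_has_integral[OF g, of a x]] by simp
    qed
  qed simp
  have gm: "g \<in> borel_measurable (lebesgue_on {a..b})"
    using g unfolding velocity_def by (subst (asm) absolutely_integrable_measurable) auto
  have \<gamma>m: "\<gamma> \<in> borel_measurable (lebesgue_on {a..b})"
    by (rule continuous_imp_measurable_on_sets_lebesgue[OF cont]) simp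
  have [measurable]: "(\<lambda>t. U (\<gamma> t)) \<in> borel_measurable (lebesgue_on {a..b})"
    by (rule measurable_compose[OF \<gamma>m U_meas])
  note gm[measurable]
  have "(\<lambda>t. lagrangian U h \<gamma> g t) \<in> borel_measurable (lebesgue_on {a..b})"
    unfolding lagrangian_def by measurable
  then show ?thesis by (subst (asm) borel_measurable_restrict_space_iff_ennreal) (auto simp: mult.commute)
qed

lemma action_split:
  assumes g: "velocity a b \<gamma> g" and "a \<le> x" "x \<le> y" "y \<le> z" "z \<le> b"
  shows "act x z \<gamma> = act x y \<gamma> + act y z \<gamma>"
proof -
  let ?L = "lagrangian U h \<gamma> g"
  have v: "velocity x z \<gamma> g" "velocity x y \<gamma> g" "velocity y z \<gamma> g"
    using assms by (auto intro: velocity_subinterval[OF g])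
  have "AE t in lebesgue. t \<notin> {y}" by (intro AE_not_in) (simp add: negligible_iff_null_sets[symmetric])
  then have "(\<integral>\<^sup>+t. ?L t * indicator {x..z} t \<partial>lebesgue) =
    (\<integral>\<^sup>+t. ?L t * indicator {x..y} t + ?L t * indicator {y..z} t \<partial>lebesgue)"
    by (intro nn_integral_cong_AE, eventually_elim) (use assms in \<open>auto simp: indicator_def\<close>)
  also have "\<dots> = (\<integral>\<^sup>+t. ?L t * indicator {x..y} t \<partial>lebesgue) + (\<integral>\<^sup>+t. ?L t * indicator {y..z} t \<partial>lebesgue)"
    by (intro nn_integral_add lagrangian_measurable v)
  finally show ?thesis using action_velocity[OF v(1)] action_velocity[OF v(2)] action_velocity[OF v(3)] by simp
qed

lemma velocity_shift_reverse:
  assumes ac: "absolutely_continuous_curve a b \<gamma>" and ab: "a \<le> b" and g: "velocity a b \<gamma> g"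
  shows "velocity (a + r) (b + r) (\<lambda>t. \<gamma> (t - r)) (\<lambda>t. g (t - r))"
    and "velocity (- b) (- a) (\<lambda>t. \<gamma> (- t)) (\<lambda>t. - g (- t))"
proof -
  obtain N where N: "negligible N" "\<And>t. a < t \<Longrightarrow> t < b \<Longrightarrow> t \<notin> N \<Longrightarrow> (\<gamma> has_vector_derivative g t) (at t)"
    using g unfolding velocity_def by blast
  show "velocity (a + r) (b + r) (\<lambda>t. \<gamma> (t - r)) (\<lambda>t. g (t - r))"
  proof (rule velocityI[OF AC_shift_reverse(1)[OF ac]])
    show "negligible ((+) r ` N)" using N(1) by (rule negligible_translation)
    fix t assume t: "a + r < t" "t < b + r" "t \<notin> (+) r ` N"
    have tn: "t - r \<notin> N" using t(3) by (metis add.commute diff_add_cancel image_eqI)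
    have "((\<lambda>t. t - r) has_vector_derivative 1) (at t)" by (auto intro!: derivative_eq_intros)
    from vector_diff_chain_at[OF this N(2)[OF _ _ tn]] t
    show "((\<lambda>t. \<gamma> (t - r)) has_vector_derivative g (t - r)) (at t)" by (simp add: o_def)
  qed (use ab in simp)
  show "velocity (- b) (- a) (\<lambda>t. \<gamma> (- t)) (\<lambda>t. - g (- t))"
  proof (rule velocityI[OF AC_shift_reverse(2)[OF ac]])
    show "negligible (uminus ` N)" using N(1)
      by (intro negligible_differentiable_image_negligible) (auto intro!: differentiable_on_minus)
    fix t assume t: "- b < t" "t < - a" "t \<notin> uminus ` N"
    have tn: "- t \<notin> N" using t(3) by (metis add.inverse_inverse image_eqI)
    have "((\<lambda>t. - t) has_vector_derivative - 1) (at t)" by (auto intro!: derivative_eq_intros)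
    from vector_diff_chain_at[OF this N(2)[OF _ _ tn]] t
    show "((\<lambda>t. \<gamma> (- t)) has_vector_derivative - g (- t)) (at t)" by (simp add: o_def)
  qed (use ab in simp)
qed

lemma action_shift_reverse:
  assumes ac: "absolutely_continuous_curve a b \<gamma>" and ab: "a \<le> b"
  shows "act (a + r) (b + r) (\<lambda>t. \<gamma> (t - r)) = act a b \<gamma>"
    and "act (- b) (- a) (\<lambda>t. \<gamma> (- t)) = act a b \<gamma>"
proof -
  obtain g where g: "velocity a b \<gamma> g" using AC_velocity[OF ac ab] by blast
  note v = velocity_shift_reverse[OF ac ab g]
  let ?L = "\<lambda>t. lagrangian U h \<gamma> g t * indicator {a..b} t"
  have "act a b \<gamma> = (\<integral>\<^sup>+t. ?L (- r + 1 * t) \<partial>lebesgue)"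
    unfolding action_velocity[OF g]
    by (subst nn_integral_real_affine_lebesgue[OF lagrangian_measurable[OF g], of 1 "- r"]) auto
  also have "\<dots> = act (a + r) (b + r) (\<lambda>t. \<gamma> (t - r))"
    unfolding action_velocity[OF v(1)]
    by (rule nn_integral_cong) (auto simp: indicator_def lagrangian_def)
  finally show "act (a + r) (b + r) (\<lambda>t. \<gamma> (t - r)) = act a b \<gamma>" ..
  have "act a b \<gamma> = (\<integral>\<^sup>+t. ?L (0 + (-1) * t) \<partial>lebesgue)"
    unfolding action_velocity[OF g]
    by (subst nn_integral_real_affine_lebesgue[OF lagrangian_measurable[OF g], of "-1" 0]) auto
  also have "\<dots> = act (- b) (- a) (\<lambda>t. \<gamma> (- t))"
    unfolding action_velocity[OF v(2)]
    by (rule nn_integral_cong) (auto simp: indicator_def lagrangian_def)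
  finally show "act (- b) (- a) (\<lambda>t. \<gamma> (- t)) = act a b \<gamma>" ..
qed

text \<open>From \<open>(q - norm v)^2 \<ge> 0\<close>: at potential at least \<open>q^2 / 2 - h\<close> a unit of length costs at least \<open>q\<close>,
  whatever the speed.\<close>
lemma action_lower:
  assumes ac: "absolutely_continuous_curve a b \<gamma>" and ab: "a \<le> b" and q: "0 \<le> q"
    and le: "\<And>t. a \<le> t \<Longrightarrow> t \<le> b \<Longrightarrow> ennreal (q\<^sup>2 / 2) \<le> U (\<gamma> t) + ennreal h"
  shows "ennreal (q * norm (\<gamma> b - \<gamma> a)) \<le> act a b \<gamma>"
proof -
  obtain g where g: "velocity a b \<gamma> g" using AC_velocity[OF ac ab] by blast
  have ai: "g absolutely_integrable_on {a..b}" using g unfolding velocity_def by blast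
  have "norm (\<gamma> b - \<gamma> a) = norm (integral {a..b} g)"
    using integral_unique[OF velocity_has_integral[OF g order_refl ab order_refl]] by simp
  also have "\<dots> \<le> integral {a..b} (\<lambda>t. norm (g t))"
    using ai by (intro integral_norm_bound_integral) (auto simp: absolutely_integrable_on_def)
  finally have n: "norm (\<gamma> b - \<gamma> a) \<le> integral {a..b} (\<lambda>t. norm (g t))" .
  have "((\<lambda>t. q * norm (g t)) has_integral (q * integral {a..b} (\<lambda>t. norm (g t)))) {a..b}"
    using ai by (intro has_integral_mult_right integrable_integral) (auto simp: absolutely_integrable_on_def)
  from nn_integral_has_integral_lebesgue'[OF _ this]
  have "ennreal (q * integral {a..b} (\<lambda>t. norm (g t))) = (\<integral>\<^sup>+t. ennreal (q * norm (g t)) * indicator {a..b} t \<partial>lebesgue)"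
    using q by (simp add: nn_integral_completion)
  also have "\<dots> \<le> act a b \<gamma>"
    unfolding action_velocity[OF g]
  proof (rule nn_integral_mono)
    fix t
    show "ennreal (q * norm (g t)) * indicator {a..b} t \<le> lagrangian U h \<gamma> g t * indicator {a..b} t"
    proof (cases "t \<in> {a..b}")
      case True
      have "0 \<le> (q - norm (g t))\<^sup>2" by simp
      then have "q * norm (g t) \<le> 1/2 * (norm (g t))\<^sup>2 + q\<^sup>2 / 2" by (simp add: power2_diff)
      then have "ennreal (q * norm (g t)) \<le> ennreal (1/2 * (norm (g t))\<^sup>2 + q\<^sup>2 / 2)" by (rule ennreal_leI)
      also have "\<dots> = ennreal (1/2 * (norm (g t))\<^sup>2) + ennreal (q\<^sup>2 / 2)" by (rule ennreal_plus) auto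
      also have "\<dots> \<le> lagrangian U h \<gamma> g t"
        unfolding lagrangian_def using le[of t] True by (simp add: add.assoc add_left_mono)
      finally show ?thesis using True by simp
    qed simp
  qed
  finally show ?thesis using n q by (meson ennreal_leI mult_left_mono order_trans)
qed

lemma action_ge_length:
  assumes "absolutely_continuous_curve a b \<gamma>" "a \<le> b"
  shows "ennreal (c * norm (\<gamma> b - \<gamma> a)) \<le> act a b \<gamma>"
  by (rule action_lower[OF assms]) (use c_pos c_sq in \<open>auto simp: power2_eq_square intro: add_increasing\<close>)

lemma jdist_le_action:
  assumes "absolutely_continuous_curve a b \<gamma>" "a < b"
  shows "d (\<gamma> a) (\<gamma> b) \<le> act a b \<gamma>"
  unfolding jdist_def by (rule Inf_lower) (use assms in blast)

lemma jdist_geI: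
  assumes "\<And>a b \<gamma>. a < b \<Longrightarrow> absolutely_continuous_curve a b \<gamma> \<Longrightarrow> \<gamma> a = x \<Longrightarrow> \<gamma> b = y \<Longrightarrow> r \<le> act a b \<gamma>"
  shows "r \<le> d x y"
  unfolding jdist_def by (rule Inf_greatest) (use assms in blast)

lemma jdist_ge_norm: "ennreal (c * norm (y - x)) \<le> d x y"
  by (rule jdist_geI) (use action_ge_length in fastforce)

lemma jdist_commute: "d x y = d y x"
proof -
  have le: "d x y \<le> d y x" for x y
  proof (rule jdist_geI)
    fix a b \<gamma> assume A: "a < b" "absolutely_continuous_curve a b \<gamma>" "\<gamma> a = y" "\<gamma> b = x"
    have "d ((\<lambda>t. \<gamma> (- t)) (- b)) ((\<lambda>t. \<gamma> (- t)) (- a)) \<le> act (- b) (- a) (\<lambda>t. \<gamma> (- t))"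
      by (rule jdist_le_action[OF AC_shift_reverse(2)[OF A(2)]]) (use A in simp)
    then show "d x y \<le> act a b \<gamma>" using action_shift_reverse(2)[OF A(2)] A by simp
  qed
  show ?thesis using le[of x y] le[of y x] by simp
qed

lemma jdist_approx:
  assumes "d x y < r"
  obtains a b \<gamma> where "a < b" "absolutely_continuous_curve a b \<gamma>" "\<gamma> a = x" "\<gamma> b = y" "act a b \<gamma> < r"
  using assms unfolding jdist_def Inf_less_iff by blast

lemma action_cong:
  assumes "\<And>t. a \<le> t \<Longrightarrow> t \<le> b \<Longrightarrow> \<gamma> t = \<eta> t"
  shows "act a b \<gamma> = act a b \<eta>"
  unfolding action_def
proof (rule nn_integral_cong)
  fix t assume "t \<in> space (lebesgue_on {a..b})"
  then have t: "t \<in> {a..b}" by simp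
  have "vector_derivative \<gamma> (at t within {a..b}) = vector_derivative \<eta> (at t within {a..b})"
    by (rule vector_derivative_cong_eq) (use assms t in \<open>auto intro!: always_eventually\<close>)
  then show "ennreal (1/2 * (norm (vector_derivative \<gamma> (at t within {a..b})))\<^sup>2) + U (\<gamma> t) + ennreal h =
    ennreal (1/2 * (norm (vector_derivative \<eta> (at t within {a..b})))\<^sup>2) + U (\<eta> t) + ennreal h"
    using assms t by simp
qed

text \<open>Near minimizers of the two distances are concatenated after a shift of time.\<close>
lemma jdist_triangle: "d x z \<le> d x y + d y z"
proof (rule ennreal_le_epsilon)
  fix \<epsilon> :: real assume fin: "d x y + d y z < top" and e: "0 < \<epsilon>"
  then have fin2: "d x y < top" "d y z < top" by (auto simp: ennreal_add_less_top)
  have lt: "p < p + ennreal (\<epsilon>/2)" if "p < top" for p :: ennreal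
    using that e by (simp add: ennreal_add_left_cancel_less[of p 0, simplified] ennreal_zero_less_divide)
  obtain a b \<gamma> where 1: "a < b" "absolutely_continuous_curve a b \<gamma>" "\<gamma> a = x" "\<gamma> b = y" "act a b \<gamma> < d x y + ennreal (\<epsilon>/2)"
    using jdist_approx[OF lt[OF fin2(1)]] by blast
  obtain a' b' \<eta> where 2: "a' < b'" "absolutely_continuous_curve a' b' \<eta>" "\<eta> a' = y" "\<eta> b' = z" "act a' b' \<eta> < d y z + ennreal (\<epsilon>/2)"
    using jdist_approx[OF lt[OF fin2(2)]] by blast
  define r where "r = b - a'"
  define \<eta>' where "\<eta>' = (\<lambda>t. \<eta> (t - r))"
  define \<zeta> where "\<zeta> = (\<lambda>t. if t \<le> b then \<gamma> t else \<eta>' t)"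
  have ac': "absolutely_continuous_curve b (b' + r) \<eta>'"
    using AC_shift_reverse(1)[OF 2(2), of r] by (simp add: \<eta>'_def r_def)
  have \<zeta>1: "\<zeta> t = \<gamma> t" if "t \<le> b" for t using that by (simp add: \<zeta>_def)
  have \<zeta>2: "\<zeta> t = \<eta>' t" if "b \<le> t" for t using that 1 2 by (auto simp: \<zeta>_def \<eta>'_def r_def)
  have br: "b < b' + r" using 2(1) by (simp add: r_def)
  have z1: "absolutely_continuous_curve a b \<zeta>"
    by (rule AC_dominated[OF 1(2), of 1]) (auto simp: \<zeta>1)
  have z2: "absolutely_continuous_curve b (b' + r) \<zeta>"
    by (rule AC_dominated[OF ac', of 1]) (auto simp: \<zeta>2)
  have z: "absolutely_continuous_curve a (b' + r) \<zeta>"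
    by (rule AC_join[OF z1 z2]) (use 1 br in auto)
  obtain g where g: "velocity a (b' + r) \<zeta> g" using AC_velocity[OF z] 1 br by force
  have "d x z \<le> act a (b' + r) \<zeta>"
    using jdist_le_action[OF z] 1 br \<zeta>1[of a] \<zeta>2[of "b' + r"] 2 by (simp add: \<eta>'_def)
  also have "\<dots> = act a b \<zeta> + act b (b' + r) \<zeta>"
    by (rule action_split[OF g]) (use 1 br in auto)
  also have "act a b \<zeta> = act a b \<gamma>" by (rule action_cong) (simp add: \<zeta>1)
  also have "act b (b' + r) \<zeta> = act b (b' + r) \<eta>'" by (rule action_cong) (simp add: \<zeta>2)
  also have "\<dots> = act a' b' \<eta>"
    using action_shift_reverse(1)[OF 2(2), of r] 2 by (simp add: \<eta>'_def r_def)
  also have "act a b \<gamma> + act a' b' \<eta> \<le> (d x y + ennreal (\<epsilon>/2)) + (d y z + ennreal (\<epsilon>/2))"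
    using 1 2 by (intro add_mono) auto
  also have "\<dots> = d x y + d y z + (ennreal (\<epsilon>/2) + ennreal (\<epsilon>/2))" by (simp add: ac_simps)
  also have "ennreal (\<epsilon>/2) + ennreal (\<epsilon>/2) = ennreal \<epsilon>" using e by (subst ennreal_plus[symmetric]) auto
  finally show "d x z \<le> d x y + d y z + ennreal \<epsilon>" .
qed

text \<open>The segment is run through at speed \<open>c\<close>, which is optimal for the kinetic part and \<open>h\<close>.  The bound \<open>B\<close>
  on the potential enters through its primitive \<open>P\<close>.\<close>
lemma jdist_segment:
  assumes u: "norm u = 1" and \<rho>: "0 < \<rho>"
    and P: "\<And>\<theta>. 0 \<le> \<theta> \<Longrightarrow> \<theta> \<le> \<rho> \<Longrightarrow> (P has_real_derivative B \<theta>) (at \<theta> within {0..\<rho>})"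
    and B: "\<And>\<theta>. 0 \<le> \<theta> \<Longrightarrow> \<theta> \<le> \<rho> \<Longrightarrow> 0 \<le> B \<theta> \<and> U (x + \<theta> *\<^sub>R u) \<le> ennreal (B \<theta>)"
  shows "d x (x + \<rho> *\<^sub>R u) \<le> ennreal (c * \<rho> + (P \<rho> - P 0) / c)"
proof -
  define \<gamma> where "\<gamma> = (\<lambda>t. x + (c * t) *\<^sub>R u)"
  define T where "T = \<rho> / c"
  have T: "0 < T" "c * T = \<rho>" using \<rho> c_pos by (auto simp: T_def)
  have in01: "0 \<le> c * t \<and> c * t \<le> \<rho>" if "0 \<le> t" "t \<le> T" for t
    using that c_pos T(2) mult_left_mono[of t T c] by auto
  have ac: "absolutely_continuous_curve 0 T \<gamma>"
  proof (rule AC_lipschitz[where L=c])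
    fix s t :: real assume "s \<le> t"
    have "\<gamma> s - \<gamma> t = (c * (s - t)) *\<^sub>R u" by (simp add: \<gamma>_def algebra_simps)
    then show "dist (\<gamma> s) (\<gamma> t) \<le> c * (t - s)" using \<open>s \<le> t\<close> c_pos u by (simp add: dist_norm abs_mult)
  qed (use c_pos in simp)
  have v: "velocity 0 T \<gamma> (\<lambda>_. c *\<^sub>R u)"
  proof (rule velocityI[OF ac _ negligible_empty])
    show "(\<gamma> has_vector_derivative c *\<^sub>R u) (at t)" for t
      unfolding \<gamma>_def by (auto intro!: derivative_eq_intros simp: mult.commute)
  qed (use T in simp)
  have I: "((\<lambda>t. c * c + B (c * t)) has_integral ((c * c * T + P (c * T) / c) - (c * c * 0 + P (c * 0) / c))) {0..T}"
  proof (rule fundamental_theorem_of_calculus)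
    fix t assume t: "t \<in> {0..T}"
    have *: "((\<lambda>t. c * t) has_real_derivative c) (at t within {0..T})" by (auto intro!: derivative_eq_intros)
    have "((\<lambda>t. P (c * t)) has_real_derivative B (c * t) * c) (at t within {0..T})"
    proof (rule DERIV_image_chain[unfolded o_def, OF _ *])
      have sub: "(*) c ` {0..T} \<subseteq> {0..\<rho>}" using in01 by auto
      show "(P has_real_derivative B (c * t)) (at (c * t) within (*) c ` {0..T})"
        by (rule DERIV_subset[OF P sub]) (use in01 t in auto)
    qed
    then have "((\<lambda>t. c * c * t + P (c * t) / c) has_real_derivative c * c + B (c * t)) (at t within {0..T})"
      using c_pos by (auto intro!: derivative_eq_intros)
    then show "((\<lambda>t. c * c * t + P (c * t) / c) has_vector_derivative c * c + B (c * t)) (at t within {0..T})"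
      by (simp add: has_real_derivative_iff_has_vector_derivative)
  qed (use T in simp)
  have "act 0 T \<gamma> \<le> (\<integral>\<^sup>+t. ennreal (c * c + B (c * t)) * indicator {0..T} t \<partial>lebesgue)"
    unfolding action_velocity[OF v]
  proof (rule nn_integral_mono)
    fix t
    show "lagrangian U h \<gamma> (\<lambda>_. c *\<^sub>R u) t * indicator {0..T} t \<le> ennreal (c * c + B (c * t)) * indicator {0..T} t"
    proof (cases "t \<in> {0..T}")
      case True
      then have b: "0 \<le> B (c * t)" "U (\<gamma> t) \<le> ennreal (B (c * t))" using B[of "c * t"] in01[of t] by (auto simp: \<gamma>_def)
      have "lagrangian U h \<gamma> (\<lambda>_. c *\<^sub>R u) t \<le> ennreal (1/2 * (c * c)) + ennreal (B (c * t)) + ennreal h"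
        unfolding lagrangian_def using b u c_pos by (intro add_mono) (auto simp: power2_eq_square)
      also have "\<dots> = ennreal (c * c + B (c * t))"
        using b h_pos c_sq by (simp flip: ennreal_plus)
      finally show ?thesis using True by simp
    qed simp
  qed
  also have "\<dots> = ennreal ((c * c * T + P (c * T) / c) - (c * c * 0 + P (c * 0) / c))"
  proof -
    have nn: "0 \<le> c * c + B (c * t)" if "t \<in> {0..T}" for t
      using B[of "c * t"] in01[of t] that c_pos by (auto intro: add_nonneg_nonneg)
    show ?thesis using nn_integral_has_integral_lebesgue'[OF nn I] by (simp add: nn_integral_completion)
  qed
  also have "(c * c * T + P (c * T) / c) - (c * c * 0 + P (c * 0) / c) = c * \<rho> + (P \<rho> - P 0) / c"
    using T by (simp add: diff_divide_distrib mult.assoc)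
  finally show ?thesis
    using jdist_le_action[OF ac T(1)] T by (simp add: \<gamma>_def)
qed

text \<open>For \<open>x = y\<close> constant curves on short time intervals are used: here the distance vanishes because
  the potential is finite at \<open>x\<close>.\<close>
lemma jdist_bounded_segment:
  assumes M: "\<And>z. z \<in> closed_segment x y \<Longrightarrow> U z \<le> ennreal M" and M0: "0 \<le> M"
  shows "d x y \<le> ennreal ((c + M / c) * norm (y - x))"
proof (cases "x = y")
  case True
  have "d x x \<le> 0 + ennreal e" if e: "e > 0" for e
  proof -
    define T where "T = e / (M + h)"
    have T: "0 < T" "(M + h) * T = e" using e M0 h_pos by (auto simp: T_def)
    have v: "velocity 0 T (\<lambda>_. x) (\<lambda>_. 0)"
      by (rule velocityI[OF AC_const _ negligible_empty]) (use T in auto)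
    have "d x x \<le> act 0 T (\<lambda>_. x)" using jdist_le_action[OF AC_const T(1), of x] by simp
    also have "\<dots> \<le> (\<integral>\<^sup>+t. ennreal (M + h) * indicator {0..T} t \<partial>lebesgue)"
      unfolding action_velocity[OF v]
      by (rule nn_integral_mono) (use M True M0 h_pos in \<open>auto simp: lagrangian_def indicator_def ennreal_plus intro!: add_right_mono\<close>)
    also have "\<dots> = ennreal (M + h) * ennreal T"
      using T by (subst nn_integral_cmult_indicator) auto
    also have "\<dots> = ennreal ((M + h) * T)" using T M0 h_pos by (intro ennreal_mult[symmetric]) auto
    also have "\<dots> = ennreal e" using T by simp
    finally show ?thesis by simp
  qed
  then have "d x x \<le> 0" by (rule ennreal_le_epsilon)
  then show ?thesis using True by simp
next
  case ne: False
  define \<rho> where "\<rho> = norm (y - x)"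
  define u where "u = (y - x) /\<^sub>R \<rho>"
  have \<rho>: "0 < \<rho>" and u: "norm u = 1" and y: "y = x + \<rho> *\<^sub>R u" using ne by (auto simp: \<rho>_def u_def)
  have "d x (x + \<rho> *\<^sub>R u) \<le> ennreal (c * \<rho> + (M * \<rho> - M * 0) / c)"
  proof (rule jdist_segment[OF u \<rho>, where P="\<lambda>t. M * t" and B="\<lambda>_. M"])
    fix \<theta> assume th: "0 \<le> \<theta>" "\<theta> \<le> \<rho>"
    have "x + \<theta> *\<^sub>R u = (1 - \<theta>/\<rho>) *\<^sub>R x + (\<theta>/\<rho>) *\<^sub>R y" using \<rho> by (simp add: y algebra_simps)
    then have "x + \<theta> *\<^sub>R u \<in> closed_segment x y"
      unfolding in_segment using th \<rho> by (intro exI[of _ "\<theta>/\<rho>"]) auto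
    then show "0 \<le> M \<and> U (x + \<theta> *\<^sub>R u) \<le> ennreal M" using M M0 by blast
  qed (auto intro!: derivative_eq_intros)
  then show ?thesis unfolding y[symmetric] by (simp add: \<rho>_def algebra_simps)
qed

text \<open>Continuity of the accumulated action makes it possible to choose points on a curve at prescribed
  values of the action.\<close>
lemma action_primitive:
  assumes ac: "absolutely_continuous_curve a b \<gamma>" and ab: "a \<le> b" and fin: "act a b \<gamma> < \<infinity>"
  obtains f where "continuous_on {a..b} f" "f a = (0::real)"
    "\<And>s t. a \<le> s \<Longrightarrow> s \<le> t \<Longrightarrow> t \<le> b \<Longrightarrow> f s \<le> f t \<and> act s t \<gamma> = ennreal (f t - f s)"
proof -
  obtain g where g: "velocity a b \<gamma> g" using AC_velocity[OF ac ab] by blast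
  define F where "F = (\<lambda>t. lagrangian U h \<gamma> g t * indicator {a..b} t)"
  have F: "F \<in> borel_measurable lebesgue" unfolding F_def by (rule lagrangian_measurable[OF g])
  have Fi: "(\<integral>\<^sup>+t. F t \<partial>lebesgue) < \<infinity>" using fin unfolding action_velocity[OF g] F_def .
  have AEF: "AE t in lebesgue. F t \<noteq> \<infinity>" by (rule nn_integral_PInf_AE[OF F]) (use Fi in auto)
  define f0 where "f0 = (\<lambda>t. enn2real (F t))"
  have AE0: "AE t in lebesgue. ennreal (f0 t) = F t" using AEF by eventually_elim (simp add: f0_def top.not_eq_extremum)
  have "integrable lebesgue f0"
  proof (rule integrableI_bounded)
    show "f0 \<in> borel_measurable lebesgue" unfolding f0_def using F by measurable
    have "(\<integral>\<^sup>+t. ennreal (norm (f0 t)) \<partial>lebesgue) = (\<integral>\<^sup>+t. F t \<partial>lebesgue)"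
      by (rule nn_integral_cong_AE) (use AE0 in \<open>auto simp: f0_def\<close>)
    with Fi show "(\<integral>\<^sup>+t. ennreal (norm (f0 t)) \<partial>lebesgue) < \<infinity>" by simp
  qed
  then have "f0 integrable_on UNIV" using integrable_on_lebesgue by blast
  then have f0i: "f0 integrable_on {s..t}" for s t by (metis integrable_on_subinterval subset_UNIV)
  have nn: "0 \<le> f0 t" for t by (simp add: f0_def)
  define f where "f = (\<lambda>t. integral {a..t} f0)"
  have diff: "f t - f s = integral {s..t} f0" if "a \<le> s" "s \<le> t" for s t
    using Henstock_Kurzweil_Integration.integral_combine[OF that f0i] by (simp add: f_def)
  show thesis
  proof
    show "continuous_on {a..b} f" unfolding f_def by (rule indefinite_integral_continuous_1[OF f0i])
    show "f a = 0" by (simp add: f_def)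
    fix s t assume st: "a \<le> s" "s \<le> t" "t \<le> b"
    have "0 \<le> integral {s..t} f0" by (rule integral_nonneg[OF f0i]) (use nn in auto)
    then have le: "f s \<le> f t" using diff[OF st(1,2)] by simp
    have "act s t \<gamma> = (\<integral>\<^sup>+x. lagrangian U h \<gamma> g x * indicator {s..t} x \<partial>lebesgue)"
      by (rule action_velocity[OF velocity_subinterval[OF g st(1,3)]])
    also have "\<dots> = (\<integral>\<^sup>+x. ennreal (f0 x) * indicator {s..t} x \<partial>lebesgue)"
      by (rule nn_integral_cong_AE) (use AE0 in eventually_elim, use st in \<open>auto simp: F_def indicator_def\<close>)
    also have "\<dots> = ennreal (integral {s..t} f0)"
      using nn_integral_has_integral_lebesgue'[OF nn integrable_integral[OF f0i]] by (simp add: nn_integral_completion)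
    finally show "f s \<le> f t \<and> act s t \<gamma> = ennreal (f t - f s)" using le diff[OF st(1,2)] by simp
  qed
qed

end

section \<open>Near minimizers stay close to their direction\<close>

text \<open>With an excess \<open>e\<close> in the triangle inequality, \<open>v\<close> loses at most \<open>e\<close> of its length in the projection to
  the direction of \<open>w\<close>, and the squared distance of the two unit vectors is twice the relative loss.\<close>
lemma direction_excess:
  fixes v w :: "'v::real_inner"
  assumes v: "v \<noteq> 0" and w: "w \<noteq> 0" and le: "norm v + norm (w - v) \<le> norm w + e"
  shows "norm (v /\<^sub>R norm v - w /\<^sub>R norm w) \<le> sqrt (2 * e / norm v)"
proof -
  define b where "b = w /\<^sub>R norm w"
  have b: "norm b = 1" "w \<bullet> b = norm w" using w by (auto simp: b_def dot_square_norm power2_eq_square)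
  have "(w - v) \<bullet> b \<le> norm (w - v)" using norm_cauchy_schwarz[of "w - v" b] b by simp
  then have vb: "norm v - v \<bullet> b \<le> e" using le b by (simp add: inner_diff_left)
  have "(norm (v /\<^sub>R norm v - b))\<^sup>2 = 2 * (norm v - v \<bullet> b) / norm v"
  proof -
    have "(norm (v /\<^sub>R norm v - b))\<^sup>2 = (v /\<^sub>R norm v) \<bullet> (v /\<^sub>R norm v) - 2 * ((v /\<^sub>R norm v) \<bullet> b) + b \<bullet> b"
      by (simp add: power2_norm_eq_inner inner_diff inner_commute)
    also have "(v /\<^sub>R norm v) \<bullet> (v /\<^sub>R norm v) = 1" using v by (simp add: dot_square_norm power2_eq_square)
    also have "b \<bullet> b = 1" using b by (simp add: dot_square_norm)
    finally show ?thesis using v by (simp add: field_simps)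
  qed
  also have "\<dots> \<le> 2 * e / norm v" using vb v by (intro divide_right_mono) auto
  finally show ?thesis unfolding b_def using real_le_rsqrt by blast
qed

lemma ln_one_plus_le_sqrt: "0 \<le> y \<Longrightarrow> ln (1 + y) \<le> 2 * sqrt y"
proof -
  assume y: "0 \<le> (y::real)"
  have "1 + y \<le> (1 + sqrt y)\<^sup>2" using y by (simp add: power2_sum)
  then have "ln (1 + y) \<le> ln ((1 + sqrt y)\<^sup>2)" using y by (intro ln_mono) auto
  also have "\<dots> = 2 * ln (1 + sqrt y)" using y by (subst ln_realpow) (auto intro: add_pos_nonneg)
  also have "\<dots> \<le> 2 * sqrt y" using ln_add_one_self_le_self[of "sqrt y"] y by simp
  finally show ?thesis .
qed

context potential begin

text \<open>If a piece exceeded the distance of its end points by more than \<open>\<epsilon>\<close>, then replacing it would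
  improve the whole curve by more than \<open>\<epsilon>\<close>.\<close>
lemma near_minimizer_pieces:
  assumes ac: "absolutely_continuous_curve \<alpha> \<beta> X"
    and f: "\<And>s t. \<alpha> \<le> s \<Longrightarrow> s \<le> t \<Longrightarrow> t \<le> \<beta> \<Longrightarrow> f s \<le> f t \<and> act s t X = ennreal (f t - f s)"
    and f0: "f \<alpha> = 0"
    and near: "ennreal (f \<beta>) \<le> d (X \<alpha>) (X \<beta>) + ennreal \<epsilon>" and e: "0 \<le> \<epsilon>"
    and st: "\<alpha> \<le> s" "s \<le> t" "t \<le> \<beta>"
  shows "ennreal (f t - f s) \<le> d (X s) (X t) + ennreal \<epsilon>"
    and "s < t \<Longrightarrow> d (X s) (X t) \<le> ennreal (f t - f s)"
proof -
  have piece: "d (X s) (X t) \<le> ennreal (f t - f s)" if "\<alpha> \<le> s" "s < t" "t \<le> \<beta>" for s t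
    using jdist_le_action[OF AC_subinterval[OF ac that(1,3)] that(2)] f[of s t] that by simp
  show "s < t \<Longrightarrow> d (X s) (X t) \<le> ennreal (f t - f s)" using piece st by simp
  \<comment> \<open>the case distinction avoids \<open>d (X \<alpha>) (X \<alpha>)\<close>, whose bound by short constant curves would need a finite potential\<close>
  have 1: "d (X \<alpha>) (X \<beta>) \<le> ennreal (f s) + d (X s) (X \<beta>)"
  proof (cases "\<alpha> = s")
    case False
    then show ?thesis using jdist_triangle[of "X \<alpha>" "X \<beta>" "X s"] piece[of \<alpha> s] st f0
      by (auto intro: order_trans[OF _ add_right_mono])
  qed (use f0 in simp)
  have 2: "d (X s) (X \<beta>) \<le> d (X s) (X t) + ennreal (f \<beta> - f t)"
  proof (cases "t = \<beta>")
    case False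
    then show ?thesis using jdist_triangle[of "X s" "X \<beta>" "X t"] piece[of t \<beta>] st
      by (auto intro: order_trans[OF _ add_left_mono])
  qed simp
  have ff: "0 \<le> f s" "f s \<le> f t" "f t \<le> f \<beta>"
    using f[of \<alpha> s] f[of s t] f[of t \<beta>] st f0 by auto
  show "ennreal (f t - f s) \<le> d (X s) (X t) + ennreal \<epsilon>"
  proof (cases "d (X s) (X t)")
    case (real r)
    have "ennreal (f \<beta>) \<le> ennreal (f s) + (ennreal r + ennreal (f \<beta> - f t)) + ennreal \<epsilon>"
      using order_trans[OF near add_right_mono[OF order_trans[OF 1 add_left_mono[OF 2]]]] real(2) by simp
    also have "\<dots> = ennreal (f s + (r + (f \<beta> - f t)) + \<epsilon>)"
      using ff real(1) e by (simp add: ennreal_plus)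
    finally have "f \<beta> \<le> f s + (r + (f \<beta> - f t)) + \<epsilon>" using ff real(1) e by (subst (asm) ennreal_le_iff) auto
    then have "ennreal (f t - f s) \<le> ennreal (r + \<epsilon>)" by (intro ennreal_leI) simp
    then show ?thesis using real e by (simp add: ennreal_plus)
  qed (use e in simp)
qed

end

text \<open>The three estimates hold on a cone about the half line through \<open>a\<close>.  They are homogeneous: for the
  Newtonian potential they all follow from those at \<open>t = 1\<close> by scaling.\<close>
locale cone_potential = potential U h for U :: "'v::euclidean_space \<Rightarrow> ennreal" and h +
  fixes a :: 'v and \<delta> C K :: real
  assumes a_unit: "norm a = 1" and \<delta>_pos: "0 < \<delta>" and C_pos: "0 < C" and K_pos: "0 < K"
    and cone_bound: "\<And>t x. 0 < t \<Longrightarrow> norm (x - t *\<^sub>R a) \<le> \<delta> * t \<Longrightarrow> U x \<le> ennreal (C / t)"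
    and cone_lipschitz: "\<And>t x y. 0 < t \<Longrightarrow> norm (x - t *\<^sub>R a) \<le> \<delta> * t \<Longrightarrow> norm (y - t *\<^sub>R a) \<le> \<delta> * t \<Longrightarrow>
       \<bar>enn2real (U x) - enn2real (U y)\<bar> \<le> K * norm (x - y) / t^2"
    and cone_second_difference: "\<And>t x y u. 0 < t \<Longrightarrow> norm (x - t *\<^sub>R a) \<le> \<delta> * t \<Longrightarrow> norm (y - t *\<^sub>R a) \<le> \<delta> * t \<Longrightarrow>
       norm (x + u - t *\<^sub>R a) \<le> \<delta> * t \<Longrightarrow> norm (y + u - t *\<^sub>R a) \<le> \<delta> * t \<Longrightarrow>
       (enn2real (U (x + u)) - enn2real (U x)) - (enn2real (U (y + u)) - enn2real (U y)) \<le> K * norm u * norm (x - y) / t^3"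
begin

text \<open>Along the segment the potential is at most \<open>C / (R + \<theta>)\<close>, which contributes a logarithm.  The
  square root that bounds it is easier to sum and still sublinear.\<close>
lemma radial_jdist:
  assumes R: "0 < R" and u: "norm u = 1" "norm (u - a) \<le> \<delta>" and \<rho>: "0 < \<rho>"
  shows "d (R *\<^sub>R a) (R *\<^sub>R a + \<rho> *\<^sub>R u) \<le> ennreal (c * \<rho> + 2 * C / (c * sqrt R) * sqrt \<rho>)"
proof -
  have "d (R *\<^sub>R a) (R *\<^sub>R a + \<rho> *\<^sub>R u) \<le> ennreal (c * \<rho> + (C * ln (R + \<rho>) - C * ln (R + 0)) / c)"
  proof (rule jdist_segment[OF u(1) \<rho>, where P="\<lambda>\<theta>. C * ln (R + \<theta>)" and B="\<lambda>\<theta>. C / (R + \<theta>)"])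
    fix \<theta> :: real assume th: "0 \<le> \<theta>" "\<theta> \<le> \<rho>"
    show "((\<lambda>\<theta>. C * ln (R + \<theta>)) has_real_derivative C / (R + \<theta>)) (at \<theta> within {0..\<rho>})"
      using R th by (auto intro!: derivative_eq_intros)
    have "norm (R *\<^sub>R a + \<theta> *\<^sub>R u - (R + \<theta>) *\<^sub>R a) = \<theta> * norm (u - a)"
      using th by (simp add: algebra_simps flip: scaleR_diff_right)
    also have "\<dots> \<le> \<theta> * \<delta>" using th u by (intro mult_left_mono) auto
    also have "\<dots> \<le> \<delta> * (R + \<theta>)" using \<delta>_pos R by (simp add: algebra_simps)
    finally have "U (R *\<^sub>R a + \<theta> *\<^sub>R u) \<le> ennreal (C / (R + \<theta>))" using R th by (intro cone_bound) auto
    then show "0 \<le> C / (R + \<theta>) \<and> U (R *\<^sub>R a + \<theta> *\<^sub>R u) \<le> ennreal (C / (R + \<theta>))"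
      using R th C_pos by auto
  qed
  also have "C * ln (R + \<rho>) - C * ln (R + 0) = C * ln (1 + \<rho> / R)"
    using R \<rho> by (simp add: ln_div[symmetric] right_diff_distrib[symmetric] field_simps flip: ln_divide_pos)
  also have "ennreal (c * \<rho> + C * ln (1 + \<rho> / R) / c) \<le> ennreal (c * \<rho> + 2 * C / (c * sqrt R) * sqrt \<rho>)"
  proof (rule ennreal_leI)
    have "C * ln (1 + \<rho> / R) / c \<le> C * (2 * sqrt (\<rho> / R)) / c"
      using R \<rho> C_pos c_pos by (intro divide_right_mono mult_left_mono ln_one_plus_le_sqrt) auto
    then show "c * \<rho> + C * ln (1 + \<rho> / R) / c \<le> c * \<rho> + 2 * C / (c * sqrt R) * sqrt \<rho>"
      by (simp add: real_sqrt_divide field_simps)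
  qed
  finally show ?thesis .
qed

text \<open>If the error at distance \<open>\<rho>\<close> is \<open>\<rho> powr (-1/4)\<close>, the error allowed at distance \<open>2 \<rho>\<close> is smaller by this
  fraction; this is what one dyadic step may cost.\<close>
definition dyadic_gap :: real where "dyadic_gap = 1 - 2 powr (-1/4)"
text \<open>The rate at which a radial distance from the base point may exceed \<open>c\<close> times the length (per square
  root of the length), chosen such that one dyadic step costs \<open>\<delta> / 2 * dyadic_gap\<close> (see
  \<open>direction_step\<close> below).\<close>
definition excess_rate :: real where "excess_rate = c * (\<delta> * dyadic_gap / 2)\<^sup>2 / 6"
text \<open>So large that the potential beyond this radius respects \<open>excess_rate\<close>, and that the ball of radius 1
  about the base point lies in the cone.\<close>
definition base_radius :: real where "base_radius = 2 / \<delta> + (2 * C / (c * excess_rate))\<^sup>2"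

lemma excess_constants: "0 < dyadic_gap" "0 < excess_rate" "0 < base_radius" "2 * C / (c * sqrt base_radius) \<le> excess_rate" "1 \<le> \<delta> / 2 * base_radius"
proof -
  have "(2::real) powr (-1/4) < 2 powr 0" by (intro powr_less_mono) auto
  then show k: "0 < dyadic_gap" by (simp add: dyadic_gap_def)
  show B: "0 < excess_rate" using k \<delta>_pos c_pos by (simp add: excess_rate_def)
  show R: "0 < base_radius" using \<delta>_pos by (simp add: base_radius_def add_pos_nonneg)
  have "sqrt ((2 * C / (c * excess_rate))\<^sup>2) \<le> sqrt base_radius" using \<delta>_pos by (simp add: base_radius_def del: real_sqrt_abs)
  then have "2 * C / (c * excess_rate) \<le> sqrt base_radius" using C_pos c_pos B by simp
  then show "2 * C / (c * sqrt base_radius) \<le> excess_rate" using R B c_pos by (simp add: field_simps)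
  show "1 \<le> \<delta> / 2 * base_radius" using \<delta>_pos by (simp add: base_radius_def field_simps)
qed

abbreviation basepoint where "basepoint \<equiv> base_radius *\<^sub>R a"

text \<open>The closed set in which the near minimizers stay.  Seen from the base point, its points have a
  direction that converges to \<open>a\<close> with the distance.\<close>
definition near_axis :: "'v \<Rightarrow> bool" where
  "near_axis q \<longleftrightarrow> norm (q - basepoint) \<le> 1 \<or>
     norm (q - basepoint - norm (q - basepoint) *\<^sub>R a) \<le> norm (q - basepoint) * (\<delta> / 2 * norm (q - basepoint) powr (-1/4))"

lemma near_axis_cone:
  assumes "near_axis q"
  obtains t where "base_radius \<le> t" "norm (q - t *\<^sub>R a) \<le> \<delta> / 2 * t"
proof (cases "norm (q - basepoint) \<le> 1")
  case True
  then show ?thesis using that[of base_radius] excess_constants(5) by simp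
next
  case False
  define r where "r = norm (q - basepoint)"
  have r: "1 < r" using False by (simp add: r_def)
  have "norm (q - basepoint - r *\<^sub>R a) \<le> r * (\<delta> / 2 * r powr (-1/4))"
    using assms False unfolding near_axis_def r_def by auto
  also have "\<dots> \<le> r * (\<delta> / 2 * 1)"
  proof -
    have "r powr (-1/4) \<le> r powr 0" using r by (intro powr_mono) auto
    then show ?thesis using r \<delta>_pos by (intro mult_left_mono) auto
  qed
  also have "\<dots> \<le> \<delta> / 2 * (base_radius + r)" using excess_constants(3) \<delta>_pos by (simp add: algebra_simps)
  finally have "norm (q - (base_radius + r) *\<^sub>R a) \<le> \<delta> / 2 * (base_radius + r)" by (simp add: algebra_simps)
  then show ?thesis using that[of "base_radius + r"] r by simp
qed

lemma near_axis_potential_le: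
  assumes "near_axis q" "norm (x - q) \<le> \<delta> / 2 * base_radius"
  shows "U x \<le> ennreal (C / base_radius)"
proof -
  obtain t where t: "base_radius \<le> t" "norm (q - t *\<^sub>R a) \<le> \<delta> / 2 * t" using near_axis_cone[OF assms(1)] .
  have "norm (x - t *\<^sub>R a) \<le> norm (x - q) + norm (q - t *\<^sub>R a)" by (metis diff_add_cancel norm_triangle_ineq add_diff_eq)
  also have "\<dots> \<le> \<delta> / 2 * t + \<delta> / 2 * t"
    using assms(2) t \<delta>_pos by (intro add_mono) (auto intro: order_trans[OF _ mult_left_mono])
  finally have "norm (x - t *\<^sub>R a) \<le> \<delta> * t" by simp
  then have "U x \<le> ennreal (C / t)" using t excess_constants(3) by (intro cone_bound) auto
  also have "\<dots> \<le> ennreal (C / base_radius)" using t excess_constants(3) C_pos by (intro ennreal_leI divide_left_mono) auto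
  finally show ?thesis .
qed

text \<open>So \<open>d\<close> is locally Lipschitz at points near the axis, with a uniform constant.\<close>
lemma near_axis_jdist_le:
  assumes "near_axis q" "norm (x - q) \<le> \<delta> / 2 * base_radius"
  shows "d q x \<le> ennreal ((c + C / base_radius / c) * norm (x - q))"
proof (rule jdist_bounded_segment)
  show "0 \<le> C / base_radius" using C_pos excess_constants(3) by simp
  fix z assume "z \<in> closed_segment q x"
  then obtain u where "0 \<le> u" "u \<le> 1" "z = (1 - u) *\<^sub>R q + u *\<^sub>R x" unfolding in_segment by blast
  then have "z - q = u *\<^sub>R (x - q)" by (simp add: algebra_simps)
  then have "norm (z - q) \<le> norm (x - q)" using \<open>0 \<le> u\<close> \<open>u \<le> 1\<close> by (simp add: mult_left_le_one_le)
  then show "U z \<le> ennreal (C / base_radius)" using assms by (intro near_axis_potential_le[OF assms(1)]) auto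
qed

end

section \<open>Existence of rays\<close>

lemma powr_quarter_le_one: "1 \<le> x \<Longrightarrow> x powr (-1/4) \<le> (1::real)"
  using powr_mono[of "-1/4" 0 x] by simp

context cone_potential begin

lemma basepoint_jdist:
  assumes w: "w \<noteq> 0" "norm (w /\<^sub>R norm w - a) \<le> \<delta>"
  shows "d basepoint (basepoint + w) \<le> ennreal (c * norm w + excess_rate * sqrt (norm w))"
proof -
  have "d basepoint (basepoint + norm w *\<^sub>R (w /\<^sub>R norm w)) \<le> ennreal (c * norm w + 2 * C / (c * sqrt base_radius) * sqrt (norm w))"
    by (rule radial_jdist) (use w excess_constants in auto)
  also have "\<dots> \<le> ennreal (c * norm w + excess_rate * sqrt (norm w))"
    using excess_constants(4) by (intro ennreal_leI add_left_mono mult_right_mono) auto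
  finally show ?thesis using w by simp
qed

text \<open>The excess is at most \<open>3 * excess_rate * sqrt (norm v) / c\<close>; \<open>excess_rate\<close> was chosen for the angle
  that follows.\<close>
lemma direction_step:
  fixes v w :: 'v
  assumes v: "1 \<le> norm v" and w: "w \<noteq> 0" "norm w \<le> 2 * norm v"
    and le: "c * (norm v + norm (w - v)) \<le> c * norm w + excess_rate * sqrt (norm w) + \<epsilon>" and e: "\<epsilon> \<le> excess_rate"
  shows "norm (v /\<^sub>R norm v - w /\<^sub>R norm w) \<le> \<delta> / 2 * dyadic_gap * norm v powr (-1/4)"
proof -
  let ?r = "norm v"
  have r: "0 < ?r" using v by linarith
  have "sqrt (norm w) \<le> sqrt (4 * ?r)" using w(2) v by (intro real_sqrt_le_mono) linarith
  then have "excess_rate * sqrt (norm w) \<le> excess_rate * (2 * sqrt ?r)"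
    using excess_constants(2) by (intro mult_left_mono) (auto simp: real_sqrt_mult)
  moreover have "\<epsilon> \<le> excess_rate * sqrt ?r" 
  proof -
    have "1 \<le> sqrt ?r" using v by simp
    then have "excess_rate * 1 \<le> excess_rate * sqrt ?r" using excess_constants(2) by (intro mult_left_mono) auto
    then show ?thesis using e by linarith
  qed
  ultimately have "c * (?r + norm (w - v)) \<le> c * norm w + 3 * excess_rate * sqrt ?r" using le by linarith
  then have "c * (?r + norm (w - v)) \<le> c * (norm w + 3 * excess_rate * sqrt ?r / c)" using c_pos by (simp add: distrib_left)
  then have ex: "?r + norm (w - v) \<le> norm w + 3 * excess_rate * sqrt ?r / c" using c_pos by simp
  have "v \<noteq> 0" using r by auto
  from direction_excess[OF this w(1) ex]
  have "norm (v /\<^sub>R ?r - w /\<^sub>R norm w) \<le> sqrt (2 * (3 * excess_rate * sqrt ?r / c) / ?r)" .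
  also have "2 * (3 * excess_rate * sqrt ?r / c) / ?r = (\<delta> * dyadic_gap / 2)\<^sup>2 * (sqrt ?r / ?r)"
    using c_pos by (simp add: excess_rate_def)
  also have "sqrt ?r / ?r = (?r powr (-1/4))\<^sup>2"
  proof -
    have "(?r powr (-1/4))\<^sup>2 = ?r powr (-1/2)" using r by (simp add: power2_eq_square flip: powr_add)
    also have "\<dots> = sqrt ?r / ?r" using r by (simp add: powr_minus powr_half_sqrt field_simps)
    finally show ?thesis ..
  qed
  also have "sqrt ((\<delta> * dyadic_gap / 2)\<^sup>2 * (?r powr (-1/4))\<^sup>2) = \<delta> / 2 * dyadic_gap * ?r powr (-1/4)"
    using \<delta>_pos excess_constants(1) by (simp add: real_sqrt_mult)
  finally show ?thesis .
qed

text \<open>Induction on the number of doublings that lead from the distance of \<open>X t\<close> to that of the end point,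
  which has direction exactly \<open>a\<close>.  The point at twice the distance is close to the axis by induction
  hypothesis, therefore its distance to the base point is well estimated, and \<open>direction_step\<close>
  transfers its direction to \<open>X t\<close>.\<close>
lemma near_minimizer_near_axis:
  assumes ac: "absolutely_continuous_curve \<alpha> \<beta> X" and ab: "\<alpha> < \<beta>"
    and f: "\<And>s t. \<alpha> \<le> s \<Longrightarrow> s \<le> t \<Longrightarrow> t \<le> \<beta> \<Longrightarrow> f s \<le> f t \<and> act s t X = ennreal (f t - f s)"
    and f0: "f \<alpha> = 0"
    and near: "ennreal (f \<beta>) \<le> d (X \<alpha>) (X \<beta>) + ennreal \<epsilon>" and e: "0 \<le> \<epsilon>" "\<epsilon> \<le> excess_rate"
    and X\<alpha>: "X \<alpha> = basepoint" and X\<beta>: "X \<beta> = basepoint + D *\<^sub>R a" and D: "0 < D"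
    and t: "\<alpha> \<le> t" "t \<le> \<beta>"
  shows "near_axis (X t)"
proof -
  define v where "v = (\<lambda>t. X t - basepoint)"
  have cont: "continuous_on {\<alpha>..\<beta>} X" by (rule AC_imp_continuous[OF ac])
  have step: "norm (v t /\<^sub>R norm (v t) - v t2 /\<^sub>R norm (v t2)) \<le> \<delta> / 2 * dyadic_gap * norm (v t) powr (-1/4)"
    if t: "\<alpha> \<le> t" "t \<le> t2" "t2 \<le> \<beta>" and v1: "1 \<le> norm (v t)" and w: "v t2 \<noteq> 0" "norm (v t2) \<le> 2 * norm (v t)"
      "norm (v t2 /\<^sub>R norm (v t2) - a) \<le> \<delta>" for t t2
  proof (rule direction_step[OF v1 w(1,2)])
    show "\<epsilon> \<le> excess_rate" by fact
    have at2: "\<alpha> \<le> t2" using t by simp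
    have "ennreal (f t2) \<le> d (X \<alpha>) (X t2) + ennreal \<epsilon>"
      by (rule near_minimizer_pieces(1)[OF ac f f0 near e(1) order_refl at2 t(3), unfolded f0 diff_zero])
    also have "\<dots> \<le> ennreal (c * norm (v t2) + excess_rate * sqrt (norm (v t2))) + ennreal \<epsilon>"
      using basepoint_jdist[OF w(1,3)] by (intro add_right_mono) (simp add: X\<alpha> v_def)
    also have "\<dots> = ennreal (c * norm (v t2) + excess_rate * sqrt (norm (v t2)) + \<epsilon>)"
      using e(1) excess_constants(2) c_pos by (intro ennreal_plus[symmetric]) auto
    finally have "f t2 \<le> c * norm (v t2) + excess_rate * sqrt (norm (v t2)) + \<epsilon>"
      using f0 e(1) excess_constants(2) c_pos by (subst (asm) ennreal_le_iff) auto
    moreover have "c * norm (v t) \<le> f t"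
      using action_ge_length[OF AC_subinterval[OF ac, of \<alpha> t]] f[of \<alpha> t] t f0
      by (auto simp: v_def X\<alpha> ennreal_le_iff2)
    moreover have "c * norm (v t2 - v t) \<le> f t2 - f t"
      using action_ge_length[OF AC_subinterval[OF ac, of t t2]] f[of t t2] t
      by (auto simp: v_def ennreal_le_iff2)
    ultimately show "c * (norm (v t) + norm (v t2 - v t)) \<le> c * norm (v t2) + excess_rate * sqrt (norm (v t2)) + \<epsilon>"
      by (simp add: distrib_left)
  qed
  have v\<beta>: "v \<beta> = D *\<^sub>R a" "norm (v \<beta>) = D" "v \<beta> /\<^sub>R norm (v \<beta>) = a" "v \<beta> \<noteq> 0"
    using X\<beta> D a_unit by (auto simp: v_def)
  have last: "norm (v t /\<^sub>R norm (v t) - a) \<le> \<delta> / 2 * norm (v t) powr (-1/4)"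
    if "\<alpha> \<le> t" "t \<le> \<beta>" "1 \<le> norm (v t)" "D \<le> 2 * norm (v t)" for t
  proof -
    have "norm (v t /\<^sub>R norm (v t) - a) \<le> \<delta> / 2 * dyadic_gap * norm (v t) powr (-1/4)"
      using step[of t \<beta>] that \<delta>_pos unfolding v\<beta>(3) by (simp only: v\<beta>(2,4)) simp
    also have "\<dots> \<le> \<delta> / 2 * 1 * norm (v t) powr (-1/4)"
      using \<delta>_pos by (intro mult_right_mono mult_left_mono) (auto simp: dyadic_gap_def)
    finally show ?thesis by simp
  qed
  have main: "norm (v t /\<^sub>R norm (v t) - a) \<le> \<delta> / 2 * norm (v t) powr (-1/4)"
    if "\<alpha> \<le> t" "t \<le> \<beta>" "1 \<le> norm (v t)" "D \<le> 2 ^ n * norm (v t)" for n t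
    using that
  proof (induction n arbitrary: t)
    case 0
    then show ?case by (intro last) auto
  next
    case (Suc n)
    show ?case
    proof (cases "D \<le> 2 * norm (v t)")
      case True
      then show ?thesis using Suc.prems by (intro last) auto
    next
      case False
      have "\<exists>t2. t \<le> t2 \<and> t2 \<le> \<beta> \<and> norm (v t2) = 2 * norm (v t)"
      proof (rule IVT')
        show "continuous_on {t..\<beta>} (\<lambda>t. norm (v t))"
          unfolding v_def using Suc.prems by (intro continuous_intros continuous_on_subset[OF cont]) auto
      qed (use False v\<beta> Suc.prems in auto)
      then obtain t2 where t2: "t \<le> t2" "t2 \<le> \<beta>" "norm (v t2) = 2 * norm (v t)" by blast
      let ?r = "norm (v t)"
      have IH: "norm (v t2 /\<^sub>R norm (v t2) - a) \<le> \<delta> / 2 * norm (v t2) powr (-1/4)"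
        using Suc.prems t2 by (intro Suc.IH) auto
      also have "\<dots> \<le> \<delta> * 1"
      proof -
        have "norm (v t2) powr (-1/4) \<le> 1" using t2 Suc.prems by (intro powr_quarter_le_one) linarith
        then have "\<delta> / 2 * norm (v t2) powr (-1/4) \<le> \<delta> / 2 * 1"
          using \<delta>_pos by (intro mult_left_mono) simp_all
        then show ?thesis using \<delta>_pos by linarith
      qed
      finally have cone: "norm (v t2 /\<^sub>R norm (v t2) - a) \<le> \<delta>" by simp
      have "norm (v t /\<^sub>R ?r - v t2 /\<^sub>R norm (v t2)) \<le> \<delta> / 2 * dyadic_gap * ?r powr (-1/4)"
        by (rule step) (use t2 Suc.prems cone in auto)
      moreover have "norm (v t /\<^sub>R ?r - a) \<le> norm (v t /\<^sub>R ?r - v t2 /\<^sub>R norm (v t2)) + norm (v t2 /\<^sub>R norm (v t2) - a)"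
        using norm_triangle_ineq[of "v t /\<^sub>R ?r - v t2 /\<^sub>R norm (v t2)" "v t2 /\<^sub>R norm (v t2) - a"] by simp
      moreover have "norm (v t2) powr (-1/4) = 2 powr (-1/4) * ?r powr (-1/4)"
        by (simp add: t2 powr_mult)
      ultimately have "norm (v t /\<^sub>R ?r - a) \<le> \<delta> / 2 * dyadic_gap * ?r powr (-1/4) + \<delta> / 2 * (2 powr (-1/4) * ?r powr (-1/4))"
        using IH by simp
      then show ?thesis by (simp add: dyadic_gap_def algebra_simps)
    qed
  qed
  show ?thesis
  proof (cases "norm (v t) \<le> 1")
    case True
    then show ?thesis by (simp add: near_axis_def v_def)
  next
    case False
    let ?r = "norm (v t)"
    obtain n :: nat where "D / ?r \<le> 2 ^ n" using real_arch_pow[of 2 "D / ?r"] by (auto intro: less_imp_le)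
    moreover have "0 < ?r" using False by linarith
    ultimately have "D \<le> 2 ^ n * ?r" by (simp add: pos_divide_le_eq)
    then have m: "norm (v t /\<^sub>R ?r - a) \<le> \<delta> / 2 * ?r powr (-1/4)" using False t by (intro main) auto
    have "v t \<noteq> 0" using False by auto
    then have "v t - ?r *\<^sub>R a = ?r *\<^sub>R (v t /\<^sub>R ?r - a)" by (simp add: scaleR_diff_right)
    then have "norm (v t - ?r *\<^sub>R a) = ?r * norm (v t /\<^sub>R ?r - a)" by simp
    also have "\<dots> \<le> ?r * (\<delta> / 2 * ?r powr (-1/4))" using m by (intro mult_left_mono) auto
    finally show ?thesis by (simp add: near_axis_def v_def)
  qed
qed

text \<open>Near minimizers to more and more distant points of the axis, parametrized by their action, are
  geodesics up to an error that tends to 0.\<close>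
lemma approximate_rays:
  obtains P :: "nat \<Rightarrow> real \<Rightarrow> 'v" where
    "\<And>n s. near_axis (P n s)" "\<And>n s. c * norm (P n s - basepoint) \<le> max 0 s" "\<And>n. P n 0 = basepoint"
    "\<And>n s t. 0 \<le> s \<Longrightarrow> s \<le> t \<Longrightarrow> t \<le> real n \<Longrightarrow> d (P n s) (P n t) \<le> ennreal (t - s)"
    "\<And>n s t. 0 \<le> s \<Longrightarrow> s \<le> t \<Longrightarrow> t \<le> real n \<Longrightarrow> ennreal (t - s) \<le> d (P n s) (P n t) + ennreal (1 / (real n + 1))"
proof -
  have "\<exists>p :: real \<Rightarrow> 'v. (\<forall>s. near_axis (p s)) \<and> (\<forall>s. c * norm (p s - basepoint) \<le> max 0 s) \<and> p 0 = basepoint \<and>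
    (\<forall>s t. 0 \<le> s \<longrightarrow> s \<le> t \<longrightarrow> t \<le> real n \<longrightarrow> d (p s) (p t) \<le> ennreal (t - s)) \<and>
    (\<forall>s t. 0 \<le> s \<longrightarrow> s \<le> t \<longrightarrow> t \<le> real n \<longrightarrow> ennreal (t - s) \<le> d (p s) (p t) + ennreal (1 / (real n + 1)))" for n
  proof -
    \<comment> \<open>far enough for the action to exceed \<open>n\<close>\<close>
    define D where "D = (real n + 1) / c"
    define \<epsilon> where "\<epsilon> = min excess_rate (1 / (real n + 1))"
    have D: "0 < D" "c * D = real n + 1" using c_pos by (auto simp: D_def)
    have e: "0 < \<epsilon>" "\<epsilon> \<le> excess_rate" "\<epsilon> \<le> 1 / (real n + 1)" using excess_constants(2) by (auto simp: \<epsilon>_def)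
    have "d basepoint (basepoint + D *\<^sub>R a) \<le> ennreal (c * norm (D *\<^sub>R a) + excess_rate * sqrt (norm (D *\<^sub>R a)))"
      by (rule basepoint_jdist) (use D a_unit \<delta>_pos in auto)
    then have fin: "d basepoint (basepoint + D *\<^sub>R a) < top" by (rule order_le_less_trans) simp
    then have "d basepoint (basepoint + D *\<^sub>R a) < d basepoint (basepoint + D *\<^sub>R a) + ennreal \<epsilon>"
      using e(1) by (cases "d basepoint (basepoint + D *\<^sub>R a)") (auto simp flip: ennreal_plus intro!: ennreal_lessI)
    from jdist_approx[OF this] obtain \<alpha> \<beta> X where X: "\<alpha> < \<beta>" "absolutely_continuous_curve \<alpha> \<beta> X"
      "X \<alpha> = basepoint" "X \<beta> = basepoint + D *\<^sub>R a" "act \<alpha> \<beta> X < d basepoint (basepoint + D *\<^sub>R a) + ennreal \<epsilon>" by blast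
    have "act \<alpha> \<beta> X < \<infinity>" using X(5) by (rule order_less_trans) (use fin in \<open>simp add: ennreal_add_less_top\<close>)
    from action_primitive[OF X(2) less_imp_le[OF X(1)] this] obtain f where cf: "continuous_on {\<alpha>..\<beta>} f" and f0: "f \<alpha> = 0"
      and f: "\<And>s t. \<alpha> \<le> s \<Longrightarrow> s \<le> t \<Longrightarrow> t \<le> \<beta> \<Longrightarrow> f s \<le> f t \<and> act s t X = ennreal (f t - f s)" by blast
    have near: "ennreal (f \<beta>) \<le> d (X \<alpha>) (X \<beta>) + ennreal \<epsilon>"
      using X(5) f[of \<alpha> \<beta>] X(1,3,4) f0 by simp
    have "c * norm (X \<beta> - X \<alpha>) \<le> f \<beta>"
      using action_ge_length[OF X(2)] f[of \<alpha> \<beta>] X(1) f0 by (auto simp: ennreal_le_iff2)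
    then have f\<beta>: "real n \<le> f \<beta>" using X(3,4) D a_unit by simp
    have "\<exists>x. \<alpha> \<le> x \<and> x \<le> \<beta> \<and> f x = s" if "0 \<le> s" "s \<le> real n" for s
      by (rule IVT'[OF _ _ _ cf]) (use that f0 f\<beta> X(1) in auto)
    then obtain \<tau> where \<tau>: "\<And>s. 0 \<le> s \<Longrightarrow> s \<le> real n \<Longrightarrow> \<alpha> \<le> \<tau> s \<and> \<tau> s \<le> \<beta> \<and> f (\<tau> s) = s" by metis
    define p where "p = (\<lambda>s. if 0 < s \<and> s \<le> real n then X (\<tau> s) else basepoint)"
    have p: "\<exists>x. \<alpha> \<le> x \<and> x \<le> \<beta> \<and> f x = s \<and> p s = X x" if "0 \<le> s" "s \<le> real n" for s
    proof (cases "s = 0")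
      case True
      then show ?thesis using X(1,3) f0 by (intro exI[of _ \<alpha>]) (auto simp: p_def)
    next
      case False
      then show ?thesis using \<tau>[OF that] that by (intro exI[of _ "\<tau> s"]) (auto simp: p_def)
    qed
    have gp0: "near_axis basepoint" by (simp add: near_axis_def)
    have gp: "near_axis (p s)" for s
    proof (cases "0 < s \<and> s \<le> real n")
      case True
      then show ?thesis
        using near_minimizer_near_axis[OF X(2,1) f f0 near _ e(2) X(3,4) D(1), of "\<tau> s"] \<tau>[of s] e(1) by (simp add: p_def)
    next
      case False
      then have "p s = basepoint" by (auto simp: p_def)
      then show ?thesis using gp0 by simp
    qed
    have np: "c * norm (p s - basepoint) \<le> max 0 s" for s
    proof (cases "0 < s \<and> s \<le> real n")
      case True
      with p[of s] obtain x where x: "\<alpha> \<le> x" "x \<le> \<beta>" "f x = s" "p s = X x" by auto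
      show ?thesis using action_ge_length[OF AC_subinterval[OF X(2), of \<alpha> x]] f[of \<alpha> x] x f0 X(3) True
        by (auto simp: ennreal_le_iff2)
    qed (auto simp: p_def)
    have dp: "d (p s) (p t) \<le> ennreal (t - s)" "ennreal (t - s) \<le> d (p s) (p t) + ennreal (1 / (real n + 1))"
      if st: "0 \<le> s" "s \<le> t" "t \<le> real n" for s t
    proof -
      obtain x where x: "\<alpha> \<le> x" "x \<le> \<beta>" "f x = s" "p s = X x" using p[of s] st by auto
      obtain y where y: "\<alpha> \<le> y" "y \<le> \<beta>" "f y = t" "p t = X y" using p[of t] st by auto
      show "d (p s) (p t) \<le> ennreal (t - s)"
      proof (cases "s = t")
        case True
        then show ?thesis using near_axis_jdist_le[OF gp, of "p s" s] excess_constants(3) \<delta>_pos by simp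
      next
        case False
        then have xy: "x < y" using f[of y x] x y st by (cases "y \<le> x") auto
        show ?thesis using near_minimizer_pieces(2)[OF X(2) f f0 near _ x(1) _ y(2) xy] e(1) xy x y by simp
      qed
      show "ennreal (t - s) \<le> d (p s) (p t) + ennreal (1 / (real n + 1))"
      proof (cases "s = t")
        case False
        then have xy: "x < y" using f[of y x] x y st by (cases "y \<le> x") auto
        have "ennreal (t - s) \<le> d (p s) (p t) + ennreal \<epsilon>"
          using near_minimizer_pieces(1)[OF X(2) f f0 near _ x(1) _ y(2)] e(1) xy x y by simp
        also have "\<dots> \<le> d (p s) (p t) + ennreal (1 / (real n + 1))"
          using e(3) by (intro add_left_mono ennreal_leI)
        finally show ?thesis .
      qed simp
    qed
    show ?thesis by (rule exI[of _ p]) (use gp np dp in \<open>auto simp: p_def\<close>)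
  qed
  then obtain P :: "nat \<Rightarrow> real \<Rightarrow> 'v" where "\<And>n. (\<forall>s. near_axis (P n s)) \<and> (\<forall>s. c * norm (P n s - basepoint) \<le> max 0 s) \<and> P n 0 = basepoint \<and>
    (\<forall>s t. 0 \<le> s \<longrightarrow> s \<le> t \<longrightarrow> t \<le> real n \<longrightarrow> d (P n s) (P n t) \<le> ennreal (t - s)) \<and>
    (\<forall>s t. 0 \<le> s \<longrightarrow> s \<le> t \<longrightarrow> t \<le> real n \<longrightarrow> ennreal (t - s) \<le> d (P n s) (P n t) + ennreal (1 / (real n + 1)))"
    by metis
  then show thesis using that[of P] by blast
qed

lemma closed_near_axis: "closed (Collect near_axis)"
proof -
  have "Collect near_axis = {q. norm (q - basepoint) \<le> 1 \<or>
     norm (q - basepoint - norm (q - basepoint) *\<^sub>R a) \<le> norm (q - basepoint) * (\<delta> / 2 * (max 1 (norm (q - basepoint))) powr (-1/4))}"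
    by (auto simp: near_axis_def max_def)
  also have "closed \<dots>"
    by (intro closed_Collect_disj closed_Collect_le continuous_intros) auto
  finally show ?thesis .
qed

text \<open>By Tychonoff's theorem the curves have a cluster point for pointwise convergence.  Since all conditions on
  a ray involve at most two times, approximation at two times is all that is needed.\<close>
lemma cluster_ray:
  fixes P :: "nat \<Rightarrow> real \<Rightarrow> 'v"
  assumes P: "\<And>n s. norm (P n s - basepoint) \<le> r s"
  shows "\<exists>\<gamma> :: real \<Rightarrow> 'v. \<forall>s t \<eta> N. 0 < \<eta> \<longrightarrow> (\<exists>n\<ge>N. norm (P n s - \<gamma> s) < \<eta> \<and> norm (P n t - \<gamma> t) < \<eta>)"
proof -
  let ?K = "Pi\<^sub>E UNIV (\<lambda>s. cball basepoint (r s))"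
  have "compactin (product_topology (\<lambda>i. euclidean) UNIV) ?K"
    by (simp add: compactin_PiE)
  then have K: "compact ?K" by (simp add: euclidean_product_topology)
  have PK: "P n \<in> ?K" for n using P by (auto simp: dist_norm norm_minus_commute)
  obtain \<gamma> where \<gamma>: "inf (nhds \<gamma>) (filtermap P sequentially) \<noteq> bot"
    using compact_filter[THEN iffD1, OF K, rule_format, of "filtermap P sequentially"] PK
    by (auto simp: eventually_filtermap filtermap_bot_iff)
  have "\<exists>n\<ge>N. norm (P n s - \<gamma> s) < \<eta> \<and> norm (P n t - \<gamma> t) < \<eta>" if \<eta>: "0 < \<eta>" for s t \<eta> N
  proof (rule ccontr)
    assume no: "\<not> ?thesis"
    let ?O = "{f :: real \<Rightarrow> 'v. norm (f s - \<gamma> s) < \<eta>} \<inter> {f. norm (f t - \<gamma> t) < \<eta>}"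
    have "open ?O"
      by (intro open_Int open_Collect_less continuous_intros continuous_on_product_coordinates)
    moreover have "\<gamma> \<in> ?O" using \<eta> by simp
    ultimately have 1: "eventually (\<lambda>f. f \<in> ?O) (nhds \<gamma>)" by (rule eventually_nhds_in_open)
    have 2: "eventually (\<lambda>f. f \<notin> ?O) (filtermap P sequentially)"
      unfolding eventually_filtermap eventually_sequentially using no by auto
    have "eventually (\<lambda>f. False) (inf (nhds \<gamma>) (filtermap P sequentially))"
      unfolding eventually_inf using 1 2 by blast
    with \<gamma> show False by (simp add: trivial_limit_def)
  qed
  then show ?thesis by blast
qed

text \<open>The cluster point is a geodesic because \<open>d\<close> is continuous near the axis.  The point at time \<open>s\<close> has
  distance \<open>s / c + O(sqrt s)\<close> from the base point and a direction at distance \<open>O(s powr (-1/4))\<close>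
  from \<open>a\<close>.\<close>
lemma ray_exists:
  obtains \<gamma> :: "real \<Rightarrow> 'v" where
    "\<And>s t. 0 \<le> s \<Longrightarrow> 0 \<le> t \<Longrightarrow> d (\<gamma> s) (\<gamma> t) = ennreal \<bar>t - s\<bar>"
    "((\<lambda>s. norm (\<gamma> s - (s / c) *\<^sub>R a) / s) \<longlongrightarrow> 0) at_top"
proof -
  obtain P :: "nat \<Rightarrow> real \<Rightarrow> 'v" where P:
    "\<And>n s. near_axis (P n s)" "\<And>n s. c * norm (P n s - basepoint) \<le> max 0 s" "\<And>n. P n 0 = basepoint"
    "\<And>n s t. 0 \<le> s \<Longrightarrow> s \<le> t \<Longrightarrow> t \<le> real n \<Longrightarrow> d (P n s) (P n t) \<le> ennreal (t - s)"
    "\<And>n s t. 0 \<le> s \<Longrightarrow> s \<le> t \<Longrightarrow> t \<le> real n \<Longrightarrow> ennreal (t - s) \<le> d (P n s) (P n t) + ennreal (1 / (real n + 1))"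
    using approximate_rays by metis
  have Pb: "norm (P n s - basepoint) \<le> max 0 s / c" for n s using P(2)[of n s] c_pos by (simp add: field_simps)
  obtain \<gamma> where "\<forall>s t \<eta> N. 0 < \<eta> \<longrightarrow> (\<exists>n\<ge>N. norm (P n s - \<gamma> s) < \<eta> \<and> norm (P n t - \<gamma> t) < \<eta>)"
    using cluster_ray[of P "\<lambda>s. max 0 s / c", OF Pb] by (rule exE)
  then have \<gamma>: "\<And>s t \<eta> N. 0 < \<eta> \<Longrightarrow> \<exists>n\<ge>N. norm (P n s - \<gamma> s) < \<eta> \<and> norm (P n t - \<gamma> t) < \<eta>"
    by simp
  have near_axis: "near_axis (\<gamma> s)" for s
  proof -
    have "\<gamma> s \<in> Collect near_axis"
      unfolding closed_approachable[OF closed_near_axis, symmetric]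
    proof (intro allI impI)
      fix e :: real assume "0 < e"
      from \<gamma>[OF this, of 0 s s] P(1) show "\<exists>y\<in>Collect near_axis. dist y (\<gamma> s) < e" by (auto simp: dist_norm)
    qed
    then show ?thesis by simp
  qed
  have \<gamma>0: "\<gamma> 0 = basepoint"
  proof (rule ccontr)
    assume "\<gamma> 0 \<noteq> basepoint"
    then have "0 < norm (basepoint - \<gamma> 0)" by simp
    from \<gamma>[OF this, of 0 0 0] show False using P(3) by auto
  qed
  \<comment> \<open>the Lipschitz constant of \<open>near_axis_jdist_le\<close>\<close>
  define M where "M = c + C / base_radius / c"
  have M: "0 < M" using c_pos C_pos excess_constants(3) by (simp add: M_def add_pos_pos)
  have dist: "d (\<gamma> s) (\<gamma> t) = ennreal (t - s)" if st: "0 \<le> s" "s \<le> t" for s t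
  proof -
    have main: "d (\<gamma> s) (\<gamma> t) \<le> ennreal (t - s) + ennreal \<epsilon> \<and> ennreal (t - s) \<le> d (\<gamma> s) (\<gamma> t) + ennreal \<epsilon>"
      if e: "0 < \<epsilon>" for \<epsilon>
    proof -
      define \<eta> where "\<eta> = min (\<delta> / 2 * base_radius) (\<epsilon> / (3 * M))"
      have \<eta>: "0 < \<eta>" "\<eta> \<le> \<delta> / 2 * base_radius" "M * \<eta> \<le> \<epsilon> / 3"
        using e M excess_constants(3) \<delta>_pos by (auto simp: \<eta>_def min_def field_simps)
      obtain N :: nat where N: "3 / \<epsilon> \<le> real N" "t \<le> real N"
        using real_arch_simple[of "max (3 / \<epsilon>) t"] by auto
      obtain n where n: "n \<ge> N" "norm (P n s - \<gamma> s) < \<eta>" "norm (P n t - \<gamma> t) < \<eta>" using \<gamma>[OF \<eta>(1)] by blast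
      have tn: "t \<le> real n" using N n by simp
      have near: "d (P n x) (\<gamma> x) \<le> ennreal (\<epsilon>/3)" if "norm (P n x - \<gamma> x) < \<eta>" for x
      proof -
        have "d (P n x) (\<gamma> x) \<le> ennreal (M * norm (\<gamma> x - P n x))"
          unfolding M_def by (rule near_axis_jdist_le[OF P(1)]) (use that \<eta> in \<open>simp add: norm_minus_commute\<close>)
        also have "\<dots> \<le> ennreal (\<epsilon>/3)"
          using that \<eta> M by (intro ennreal_leI order_trans[OF mult_left_mono \<eta>(3)]) (auto simp: norm_minus_commute)
        finally show ?thesis .
      qed
      have tri: "d x y \<le> d x z + (d z w + d w y)" for x y z w
        by (rule order_trans[OF jdist_triangle add_left_mono[OF jdist_triangle]])
      have e3: "ennreal (\<epsilon>/3) + (X + ennreal (\<epsilon>/3)) + ennreal (\<epsilon>/3) = X + ennreal \<epsilon>" for X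
      proof -
        have "ennreal (\<epsilon>/3) + ennreal (\<epsilon>/3) + ennreal (\<epsilon>/3) = ennreal \<epsilon>"
          using e by (simp flip: ennreal_plus)
        then show ?thesis by (simp add: ac_simps)
      qed
      have "d (\<gamma> s) (\<gamma> t) \<le> d (\<gamma> s) (P n s) + (d (P n s) (P n t) + d (P n t) (\<gamma> t))" by (rule tri)
      also have "\<dots> \<le> ennreal (\<epsilon>/3) + (ennreal (t - s) + ennreal (\<epsilon>/3))"
        using near[OF n(2)] near[OF n(3)] P(4)[OF st tn] jdist_commute by (intro add_mono) auto
      also have "\<dots> \<le> ennreal (\<epsilon>/3) + (ennreal (t - s) + ennreal (\<epsilon>/3)) + ennreal (\<epsilon>/3)" by simp
      also have "\<dots> = ennreal (t - s) + ennreal \<epsilon>" by (rule e3)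
      finally have 1: "d (\<gamma> s) (\<gamma> t) \<le> ennreal (t - s) + ennreal \<epsilon>" .
      have "3 / \<epsilon> \<le> real n + 1" using N(1) n(1) by linarith
      then have "1 / (real n + 1) \<le> \<epsilon>/3" using e by (simp add: field_simps)
      then have n3: "ennreal (1 / (real n + 1)) \<le> ennreal (\<epsilon>/3)" by (rule ennreal_leI)
      have "ennreal (t - s) \<le> d (P n s) (P n t) + ennreal (1 / (real n + 1))" by (rule P(5)[OF st tn])
      also have "\<dots> \<le> (d (P n s) (\<gamma> s) + (d (\<gamma> s) (\<gamma> t) + d (\<gamma> t) (P n t))) + ennreal (\<epsilon>/3)"
        using n3 by (intro add_mono tri)
      also have "\<dots> \<le> (ennreal (\<epsilon>/3) + (d (\<gamma> s) (\<gamma> t) + ennreal (\<epsilon>/3))) + ennreal (\<epsilon>/3)"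
        using near[OF n(2)] near[OF n(3)] jdist_commute by (intro add_mono) auto
      also have "\<dots> = d (\<gamma> s) (\<gamma> t) + ennreal \<epsilon>" by (rule e3)
      finally show ?thesis using 1 by blast
    qed
    show ?thesis
    proof (rule antisym)
      show "d (\<gamma> s) (\<gamma> t) \<le> ennreal (t - s)" by (rule ennreal_le_epsilon) (use main in blast)
      show "ennreal (t - s) \<le> d (\<gamma> s) (\<gamma> t)" by (rule ennreal_le_epsilon) (use main in blast)
    qed
  qed
  have dist': "d (\<gamma> s) (\<gamma> t) = ennreal \<bar>t - s\<bar>" if "0 \<le> s" "0 \<le> t" for s t
    using dist[of s t] dist[of t s] jdist_commute[of "\<gamma> s" "\<gamma> t"] that by (cases "s \<le> t") auto
  have bound: "norm (\<gamma> s - (s / c) *\<^sub>R a) / s \<le> (base_radius + \<delta> / 2 * (s / c) powr (3/4) + excess_rate / c * sqrt (s / c)) / s" if s: "M < s" for s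
  proof (rule divide_right_mono)
    show s0: "0 \<le> s" using s M by simp
    define w where "w = \<gamma> s - basepoint"
    have ds: "d basepoint (\<gamma> s) = ennreal s" using dist[of 0 s] s0 \<gamma>0 by simp
    have up: "c * norm w \<le> s" using jdist_ge_norm[of "\<gamma> s" basepoint] s0 unfolding ds w_def by (simp add: ennreal_le_iff)
    have big: "1 < norm w"
    proof (rule ccontr)
      assume "\<not> ?thesis"
      then have n1: "norm w \<le> 1" by simp
      have "near_axis basepoint" by (simp add: near_axis_def)
      then have "ennreal s \<le> ennreal (M * norm w)"
        using near_axis_jdist_le[of basepoint "\<gamma> s"] n1 excess_constants(5) ds by (simp add: w_def M_def)
      also have "\<dots> \<le> ennreal M" using n1 M by (intro ennreal_leI) (simp add: mult_left_le)
      finally show False using s M by (simp add: ennreal_le_iff)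
    qed
    have wd: "norm (w - norm w *\<^sub>R a) \<le> norm w * (\<delta> / 2 * norm w powr (-1/4))"
      using near_axis[of s] big unfolding near_axis_def w_def by auto
    have "w \<noteq> 0" using big by auto
    then have "w - norm w *\<^sub>R a = norm w *\<^sub>R (w /\<^sub>R norm w - a)" by (simp add: scaleR_diff_right)
    then have "norm (w - norm w *\<^sub>R a) = norm w * norm (w /\<^sub>R norm w - a)" by simp
    then have "norm w * norm (w /\<^sub>R norm w - a) \<le> norm w * (\<delta> / 2 * norm w powr (-1/4))" using wd by simp
    then have "norm (w /\<^sub>R norm w - a) \<le> \<delta> / 2 * norm w powr (-1/4)"
      by (rule mult_left_le_imp_le) (use big in linarith)
    also have "\<dots> \<le> \<delta> * 1"
    proof -
      have "norm w powr (-1/4) \<le> 1" using big by (intro powr_quarter_le_one) simp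
      then have "\<delta> / 2 * norm w powr (-1/4) \<le> \<delta> / 2 * 1"
        using \<delta>_pos by (intro mult_left_mono) simp_all
      then show ?thesis using \<delta>_pos by linarith
    qed
    finally have "norm (w /\<^sub>R norm w - a) \<le> \<delta>" by simp
    moreover have "w \<noteq> 0" using big by auto
    ultimately have "ennreal s \<le> ennreal (c * norm w + excess_rate * sqrt (norm w))"
      using basepoint_jdist[of w] ds by (simp add: w_def)
    then have low: "s \<le> c * norm w + excess_rate * sqrt (norm w)"
      using c_pos excess_constants(2) by (subst (asm) ennreal_le_iff) auto
    have nw: "norm w \<le> s / c" using up c_pos by (simp add: field_simps)
    have "norm (\<gamma> s - (s / c) *\<^sub>R a) \<le> norm basepoint + norm (w - norm w *\<^sub>R a) + norm ((norm w - s / c) *\<^sub>R a)"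
    proof -
      have "\<gamma> s - (s / c) *\<^sub>R a = basepoint + (w - norm w *\<^sub>R a) + (norm w - s / c) *\<^sub>R a" by (simp add: w_def algebra_simps)
      then show ?thesis using norm_triangle_ineq[of "basepoint + (w - norm w *\<^sub>R a)" "(norm w - s / c) *\<^sub>R a"]
          norm_triangle_ineq[of basepoint "w - norm w *\<^sub>R a"] by simp
    qed
    moreover have "norm basepoint = base_radius" using a_unit excess_constants(3) by simp
    moreover have "norm (w - norm w *\<^sub>R a) \<le> \<delta> / 2 * (s / c) powr (3/4)"
    proof -
      have "norm w * norm w powr (-1/4) = norm w powr (3/4)"
        using big powr_add[of "norm w" 1 "-1/4"] by (simp add: powr_one)
      moreover have "norm w powr (3/4) \<le> (s / c) powr (3/4)" using nw big by (intro powr_mono2) auto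
      ultimately have "\<delta> / 2 * (norm w * norm w powr (-1/4)) \<le> \<delta> / 2 * (s / c) powr (3/4)"
        using \<delta>_pos by (intro mult_left_mono) auto
      with wd show ?thesis by (simp add: mult.left_commute)
    qed
    moreover have "norm ((norm w - s / c) *\<^sub>R a) \<le> excess_rate / c * sqrt (s / c)"
    proof -
      have "norm ((norm w - s / c) *\<^sub>R a) = s / c - norm w" using nw a_unit by simp
      also have "\<dots> \<le> excess_rate / c * sqrt (norm w)"
        using divide_right_mono[OF low, of c] c_pos by (simp add: add_divide_distrib)
      also have "\<dots> \<le> excess_rate / c * sqrt (s / c)" using nw excess_constants(2) c_pos by (intro mult_left_mono) auto
      finally show ?thesis .
    qed
    ultimately show "norm (\<gamma> s - (s / c) *\<^sub>R a) \<le> base_radius + \<delta> / 2 * (s / c) powr (3/4) + excess_rate / c * sqrt (s / c)" by linarith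
  qed
  have "((\<lambda>s. norm (\<gamma> s - (s / c) *\<^sub>R a) / s) \<longlongrightarrow> 0) at_top"
  proof (rule tendsto_sandwich)
    show "eventually (\<lambda>s. 0 \<le> norm (\<gamma> s - (s / c) *\<^sub>R a) / s) at_top"
      using eventually_ge_at_top[of 0] by eventually_elim simp
    show "eventually (\<lambda>s. norm (\<gamma> s - (s / c) *\<^sub>R a) / s \<le> (base_radius + \<delta> / 2 * (s / c) powr (3/4) + excess_rate / c * sqrt (s / c)) / s) at_top"
      using eventually_gt_at_top[of M] by eventually_elim (rule bound)
    show "((\<lambda>s. (base_radius + \<delta> / 2 * (s / c) powr (3/4) + excess_rate / c * sqrt (s / c)) / s) \<longlongrightarrow> 0) at_top"
      using c_pos by real_asymp
  qed simp
  with dist' that show thesis by blast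
qed

end

section \<open>Doubling estimates and a change of time\<close>

lemma doubling_induct:
  fixes T0 :: real
  assumes T0: "0 < T0" and base: "\<And>t. T0 \<le> t \<Longrightarrow> t \<le> 2 * T0 \<Longrightarrow> Q t"
    and step: "\<And>t. T0 \<le> t \<Longrightarrow> Q t \<Longrightarrow> Q (2 * t)" and t: "T0 \<le> t"
  shows "Q t"
proof -
  have "Q t" if "T0 \<le> t" "t \<le> 2 ^ n * T0" for n t
    using that
  proof (induction n arbitrary: t)
    case 0
    then show ?case using T0 by (intro base) auto
  next
    case (Suc n)
    show ?case
    proof (cases "t \<le> 2 * T0")
      case True
      then show ?thesis using base Suc.prems by simp
    next
      case False
      then have "Q (t / 2)" using Suc.prems by (intro Suc.IH) auto
      then show ?thesis using step[of "t / 2"] False by simp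
    qed
  qed
  moreover obtain n where "t / T0 \<le> 2 ^ n" using real_arch_pow[of 2 "t / T0"] by (auto intro: less_imp_le)
  ultimately show ?thesis using t T0 by (simp add: field_simps)
qed

lemma slope_difference:
  fixes x y z :: "'v::real_vector"
  assumes "0 < S"
  shows "(y - x) /\<^sub>R S - (z - y) /\<^sub>R (2 * S) = (1 / (2 * S)) *\<^sub>R (3 *\<^sub>R y - 2 *\<^sub>R x - z)"
proof -
  have "inverse S = 1 / (2 * S) * 2" "inverse (2 * S) = 1 / (2 * S)" using assms by (simp_all add: field_simps)
  then have "(y - x) /\<^sub>R S - (z - y) /\<^sub>R (2 * S) = (1 / (2 * S)) *\<^sub>R (2 *\<^sub>R (y - x) - (z - y))"
    by (metis scaleR_diff_right scaleR_scaleR)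
  moreover have "2 *\<^sub>R (y - x) - (z - y) = 3 *\<^sub>R y - 2 *\<^sub>R x - z"
    using scaleR_add_left[of 2 1 y] by (simp add: scaleR_diff_right)
  ultimately show ?thesis by simp
qed

text \<open>The hypothesis \<open>block\<close> controls the difference of the slopes of \<open>w\<close> over \<open>[T, 2 T]\<close> and \<open>[2 T, 4 T]\<close>.
  The slopes tend to 0 because \<open>w\<close> is sublinear, so the slope over \<open>[T, 2 T]\<close> is the sum of all these
  differences, which a geometric series dominates.\<close>
lemma doubling_increment:
  fixes w :: "real \<Rightarrow> 'v::real_normed_vector"
  assumes T0: "0 < T0" and A: "0 \<le> A"
    and block: "\<And>T W. T0 \<le> T \<Longrightarrow> (\<And>t. T \<le> t \<Longrightarrow> t \<le> 4 * T \<Longrightarrow> norm (w t) \<le> W) \<Longrightarrow>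
      norm (3 *\<^sub>R w (2 * T) - 2 *\<^sub>R w T - w (4 * T)) \<le> A * W / T"
    and sub: "((\<lambda>t. norm (w t) / t) \<longlongrightarrow> 0) at_top"
    and p: "0 \<le> p" "p \<le> 1" and D: "\<And>t. T0 \<le> t \<Longrightarrow> norm (w t) \<le> D * t powr p" and T: "T0 \<le> T"
  shows "norm (w (2 * T) - w T) \<le> 4 * A * D * T powr (p - 1)"
proof -
  have Tp: "0 < T" using T T0 by simp
  have D0: "0 \<le> D" using order_trans[OF norm_ge_zero D[OF T]] Tp by (simp add: zero_le_mult_iff)
  define v where "v = (\<lambda>S. (w (2 * S) - w S) /\<^sub>R S)"
  define E where "E = 2 * A * D * T powr (p - 2)"
  have E0: "0 \<le> E" using A D0 by (simp add: E_def)
  have slope: "norm (v (2 ^ k * T) - v (2 ^ Suc k * T)) \<le> E / 2 ^ k" for k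
  proof -
    define S where "S = 2 ^ k * T"
    have S: "T \<le> S" using Tp by (simp add: S_def)
    have ST: "0 < S" "T0 \<le> S" using S T Tp by auto
    have "v S - v (2 * S) = (1 / (2 * S)) *\<^sub>R (3 *\<^sub>R w (2 * S) - 2 *\<^sub>R w S - w (4 * S))"
      unfolding v_def using slope_difference[OF ST(1)] by simp
    then have "norm (v S - v (2 * S)) = norm (3 *\<^sub>R w (2 * S) - 2 *\<^sub>R w S - w (4 * S)) / (2 * S)"
      using ST(1) by simp
    also have "\<dots> \<le> (A * (D * (4 * S powr p)) / S) / (2 * S)"
    proof (intro divide_right_mono block[OF ST(2)])
      fix t assume t: "S \<le> t" "t \<le> 4 * S"
      have "norm (w t) \<le> D * t powr p" using t ST by (intro D) auto
      also have "t powr p \<le> (4 * S) powr p" using t ST p by (intro powr_mono2) auto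
      also have "(4 * S) powr p = 4 powr p * S powr p" using ST by (simp add: powr_mult)
      also have "4 powr p \<le> (4::real) powr 1" using p by (intro powr_mono) auto
      finally show "norm (w t) \<le> D * (4 * S powr p)" using D0 by (simp add: mult_left_mono mult_right_mono)
    qed (use ST in auto)
    also have "\<dots> = 2 * A * D * (S powr p / (S * S))" by simp
    also have "S powr p / (S * S) = S powr (p - 2)"
      using ST by (simp add: powr_diff powr_numeral power2_eq_square)
    also have "S powr (p - 2) = (2 ^ k) powr (p - 2) * T powr (p - 2)" using Tp by (simp add: S_def powr_mult)
    also have "(2 ^ k) powr (p - 2) \<le> ((2 ^ k) :: real) powr (-1)" using p by (intro powr_mono) auto
    also have "((2 ^ k) :: real) powr (-1) = 1 / 2 ^ k" by (simp add: powr_minus_divide)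
    finally have "norm (v S - v (2 * S)) \<le> 2 * A * D * (1 / 2 ^ k * T powr (p - 2))"
      using A D0 by (simp add: mult_left_mono mult_right_mono)
    then show ?thesis by (simp add: S_def E_def mult_ac)
  qed
  have tele: "norm (v T) \<le> norm (v (2 ^ n * T)) + 2 * E * (1 - 1 / 2 ^ n)" for n
  proof (induction n)
    case (Suc n)
    have "norm (v (2 ^ n * T)) \<le> norm (v (2 ^ Suc n * T)) + E / 2 ^ n"
      using slope[of n] norm_triangle_ineq2[of "v (2 ^ n * T)" "v (2 ^ Suc n * T)"] by linarith
    with Suc have "norm (v T) \<le> norm (v (2 ^ Suc n * T)) + (E / 2 ^ n + 2 * E * (1 - 1 / 2 ^ n))" by linarith
    also have "E / 2 ^ n + 2 * E * (1 - 1 / 2 ^ n) = 2 * E * (1 - 1 / 2 ^ Suc n)" by (simp add: field_simps)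
    finally show ?case .
  qed simp
  have lim: "filterlim (\<lambda>n. 2 ^ n * T) at_top sequentially"
    using Tp by real_asymp
  have lim2: "filterlim (\<lambda>n. 2 * (2 ^ n * T)) at_top sequentially"
    using Tp by real_asymp
  have l0: "((\<lambda>n. 2 * (norm (w (2 * (2 ^ n * T))) / (2 * (2 ^ n * T))) + norm (w (2 ^ n * T)) / (2 ^ n * T)) \<longlongrightarrow> 2 * 0 + 0) sequentially"
    by (intro tendsto_intros filterlim_compose[OF sub lim] filterlim_compose[OF sub lim2])
  have "((\<lambda>n. norm (v (2 ^ n * T))) \<longlongrightarrow> 0) sequentially"
  proof (rule tendsto_sandwich[OF _ _ tendsto_const l0[unfolded mult_zero_right add_0_right]])
    show "\<forall>\<^sub>F n in sequentially. norm (v (2 ^ n * T)) \<le> 2 * (norm (w (2 * (2 ^ n * T))) / (2 * (2 ^ n * T))) + norm (w (2 ^ n * T)) / (2 ^ n * T)"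
    proof (rule always_eventually, rule allI)
      fix n
      define S where "S = 2 ^ n * T"
      have "0 < S" using Tp by (simp add: S_def)
      then have "norm (v S) = norm (w (2 * S) - w S) / S" by (simp add: v_def divide_inverse mult.commute)
      also have "\<dots> \<le> (norm (w (2 * S)) + norm (w S)) / S"
        using \<open>0 < S\<close> by (intro divide_right_mono norm_triangle_ineq4) auto
      finally show "norm (v (2 ^ n * T)) \<le> 2 * (norm (w (2 * (2 ^ n * T))) / (2 * (2 ^ n * T))) + norm (w (2 ^ n * T)) / (2 ^ n * T)"
        using \<open>0 < S\<close> by (simp add: S_def add_divide_distrib)
    qed
  qed simp_all
  then have "((\<lambda>n. norm (v (2 ^ n * T)) + 2 * E) \<longlongrightarrow> 0 + 2 * E) sequentially" by (intro tendsto_intros)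
  moreover have "norm (v T) \<le> norm (v (2 ^ n * T)) + 2 * E" for n
  proof -
    have "2 * E * (1 - 1 / 2 ^ n) \<le> 2 * E * 1" using E0 by (intro mult_left_mono) auto
    then show ?thesis using tele[of n] by simp
  qed
  ultimately have "norm (v T) \<le> 0 + 2 * E" by (intro tendsto_lowerbound[where F=sequentially]) auto
  then have "T * norm (v T) \<le> T * (2 * E)" using Tp by (intro mult_left_mono) auto
  moreover have "T * norm (v T) = norm (w (2 * T) - w T)" using Tp by (simp add: v_def)
  moreover have "T * (2 * E) = 4 * A * D * T powr (p - 1)"
  proof -
    have "T powr (p - 1) = T * T powr (p - 2)" using Tp powr_add[of T 1 "p - 2"] by simp
    then show ?thesis by (simp add: E_def)
  qed
  ultimately show ?thesis by simp
qed

text \<open>A bootstrap: linear growth makes the increments \<open>w (2 T) - w T\<close> bounded, so \<open>w\<close> grows at most like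
  a square root, and then the increments decay like \<open>1 / sqrt T\<close> and can be summed.  Both sums are
  hidden in comparison functions that absorb one increment per doubling.\<close>
lemma sublinear_bounded:
  fixes w :: "real \<Rightarrow> 'v::real_normed_vector"
  assumes T0: "0 < T0" and A: "0 \<le> A"
    and block: "\<And>T W. T0 \<le> T \<Longrightarrow> (\<And>t. T \<le> t \<Longrightarrow> t \<le> 4 * T \<Longrightarrow> norm (w t) \<le> W) \<Longrightarrow>
      norm (3 *\<^sub>R w (2 * T) - 2 *\<^sub>R w T - w (4 * T)) \<le> A * W / T"
    and sub: "((\<lambda>t. norm (w t) / t) \<longlongrightarrow> 0) at_top"
    and lin: "\<And>t. T0 \<le> t \<Longrightarrow> norm (w t) \<le> D * t"
  obtains B where "\<And>t. T0 \<le> t \<Longrightarrow> norm (w t) \<le> B"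
proof -
  have D0: "0 \<le> D" using order_trans[OF norm_ge_zero lin[OF order_refl]] T0 by (simp add: zero_le_mult_iff)
  have D1: "norm (w t) \<le> D * t powr 1" if "T0 \<le> t" for t using lin[OF that] that T0 by simp
  have inc1: "norm (w (2 * T)) \<le> norm (w T) + 4 * A * D" if "T0 \<le> T" for T
  proof -
    have "norm (w (2 * T) - w T) \<le> 4 * A * D * T powr (1 - 1)"
      by (rule doubling_increment[OF T0 A block sub _ _ D1 that]) simp_all
    also have "T powr (1 - 1) = 1" using that T0 by simp
    finally show ?thesis using norm_triangle_ineq2[of "w (2 * T)" "w T"] by linarith
  qed
  have w0: "norm (w t) \<le> D * (2 * T0)" if "T0 \<le> t" "t \<le> 2 * T0" for t
    using lin[OF that(1)] that(2) D0 by (meson mult_left_mono order_trans)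
  define r where "r = sqrt 2 - 1"
  have r: "0 < r" by (simp add: r_def)
  \<comment> \<open>the first term covers \<open>[T0, 2 T0]\<close>, the second one absorbs a bounded increment\<close>
  define G where "G = max (D * (2 * T0) / sqrt T0) (4 * A * D / (r * sqrt T0))"
  have G0: "0 \<le> G" using D0 T0 by (simp add: G_def le_max_iff_disj)
  have sT: "0 < sqrt T0" using T0 by simp
  have G1: "D * (2 * T0) \<le> G * sqrt T0"
    unfolding pos_divide_le_eq[OF sT, symmetric] by (simp only: G_def max.cobounded1)
  have G2: "4 * A * D \<le> G * (r * sqrt T0)"
    unfolding pos_divide_le_eq[OF mult_pos_pos[OF r sT], symmetric] by (simp only: G_def max.cobounded2)
  have half: "norm (w t) \<le> G * sqrt t" if "T0 \<le> t" for t
  proof (rule doubling_induct[OF T0 _ _ that])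
    fix t assume t: "T0 \<le> t" "t \<le> 2 * T0"
    have "G * sqrt T0 \<le> G * sqrt t" using t G0 by (intro mult_left_mono) auto
    then show "norm (w t) \<le> G * sqrt t" using w0[OF t] G1 by linarith
  next
    fix t assume t: "T0 \<le> t" "norm (w t) \<le> G * sqrt t"
    have "G * (r * sqrt T0) \<le> G * (r * sqrt t)" using t r G0 by (intro mult_left_mono) auto
    then have "norm (w (2 * t)) \<le> G * sqrt t + G * (r * sqrt t)" using inc1[OF t(1)] t(2) G2 by linarith
    also have "\<dots> = G * sqrt (2 * t)" by (simp add: r_def real_sqrt_mult algebra_simps)
    finally show "norm (w (2 * t)) \<le> G * sqrt (2 * t)" .
  qed
  have D2: "norm (w t) \<le> G * t powr (1/2)" if "T0 \<le> t" for t using half[OF that] that T0 by (simp add: powr_half_sqrt)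
  have inc2: "norm (w (2 * T)) \<le> norm (w T) + 4 * A * G / sqrt T" if "T0 \<le> T" for T
  proof -
    have "T powr (1/2 - 1) = 1 / sqrt T" using that T0 by (simp add: powr_minus_divide powr_half_sqrt)
    moreover have "norm (w (2 * T) - w T) \<le> 4 * A * G * T powr (1/2 - 1)"
      by (rule doubling_increment[OF T0 A block sub _ _ D2 that]) simp_all
    ultimately show ?thesis using norm_triangle_ineq2[of "w (2 * T)" "w T"] by simp
  qed
  define r2 where "r2 = 1 - 1 / sqrt 2"
  have r2: "0 < r2" by (simp add: r2_def)
  \<comment> \<open>\<open>H / sqrt t\<close> decreases from \<open>t\<close> to \<open>2 t\<close> by exactly the bound on the increment\<close>
  define H where "H = 4 * A * G / r2"
  have H: "0 \<le> H" "H * r2 = 4 * A * G" using A G0 r2 by (auto simp: H_def)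
  define B where "B = D * (2 * T0) + H / sqrt T0"
  have fin: "norm (w t) \<le> B - H / sqrt t" if "T0 \<le> t" for t
  proof (rule doubling_induct[OF T0 _ _ that])
    fix t assume t: "T0 \<le> t" "t \<le> 2 * T0"
    have "H / sqrt t \<le> H / sqrt T0" using t T0 H by (intro divide_left_mono) auto
    then show "norm (w t) \<le> B - H / sqrt t" using w0[OF t] by (simp add: B_def)
  next
    fix t assume t: "T0 \<le> t" "norm (w t) \<le> B - H / sqrt t"
    have "norm (w (2 * t)) \<le> B - H / sqrt t + H * r2 / sqrt t" using inc2[OF t(1)] t(2) H by simp
    also have "\<dots> = B - H / sqrt (2 * t)" using t T0 by (simp add: r2_def real_sqrt_mult field_simps)
    finally show "norm (w (2 * t)) \<le> B - H / sqrt (2 * t)" .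
  qed
  have "norm (w t) \<le> B" if "T0 \<le> t" for t
  proof -
    have "0 \<le> H / sqrt t" using H that T0 by simp
    then show ?thesis using fin[OF that] by linarith
  qed
  with that show thesis by blast
qed

text \<open>The solution of \<open>\<sigma>' = g \<sigma>\<close> with \<open>\<sigma> 0 = s1\<close>, constructed as the inverse function of a primitive of
  \<open>1 / g\<close>.  The primitive is differentiable, so it maps null sets to null sets.\<close>
lemma time_change:
  fixes g :: "real \<Rightarrow> real"
  assumes cont: "continuous_on {s1..} g" and m: "0 < m" and g: "\<And>s. s1 \<le> s \<Longrightarrow> m \<le> g s \<and> g s \<le> M"
  shows "\<exists>\<sigma> :: real \<Rightarrow> real. (\<forall>t\<ge>0. s1 \<le> \<sigma> t) \<and> \<sigma> 0 = s1 \<and>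
    (\<forall>t>0. (\<sigma> has_real_derivative g (\<sigma> t)) (at t)) \<and>
    (\<forall>t t'. 0 \<le> t \<longrightarrow> t \<le> t' \<longrightarrow> m * (t' - t) \<le> \<sigma> t' - \<sigma> t \<and> \<sigma> t' - \<sigma> t \<le> M * (t' - t)) \<and>
    (\<forall>s\<ge>s1. \<exists>t\<ge>0. \<sigma> t = s) \<and>
    (\<forall>N. negligible N \<longrightarrow> negligible {t. 0 < t \<and> \<sigma> t \<in> N})"
proof -
  have mM: "m \<le> M" "0 < M" using g[of s1] m by auto
  have gp: "0 < g s" if "s1 \<le> s" for s using g[OF that] m by linarith
  have ci: "continuous_on {s1..} (\<lambda>s. 1 / g s)"
    by (intro continuous_intros cont) (use gp in force)
  have ci': "continuous_on {x..y} (\<lambda>s. 1 / g s)" if "s1 \<le> x" for x y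
    by (rule continuous_on_subset[OF ci]) (use that in auto)
  have int: "(\<lambda>s. 1 / g s) integrable_on {x..y}" if "s1 \<le> x" for x y
    by (rule integrable_continuous_real[OF ci'[OF that]])
  define \<tau> where "\<tau> = (\<lambda>s. integral {s1..s} (\<lambda>s. 1 / g s))"
  have diff: "\<tau> y - \<tau> x = integral {x..y} (\<lambda>s. 1 / g s)" if "s1 \<le> x" "x \<le> y" for x y
    using Henstock_Kurzweil_Integration.integral_combine[OF that int] by (simp add: \<tau>_def)
  have bounds: "(y - x) / M \<le> \<tau> y - \<tau> x \<and> \<tau> y - \<tau> x \<le> (y - x) / m" if xy: "s1 \<le> x" "x \<le> y" for x y
  proof -
    have "integral {x..y} (\<lambda>s. 1 / M) \<le> integral {x..y} (\<lambda>s. 1 / g s)"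
      by (rule integral_le[OF _ int[OF xy(1)]]) (use g gp xy mM m in \<open>auto intro!: divide_left_mono mult_pos_pos\<close>)
    moreover have "integral {x..y} (\<lambda>s. 1 / g s) \<le> integral {x..y} (\<lambda>s. 1 / m)"
      by (rule integral_le[OF int[OF xy(1)]]) (use g gp xy mM m in \<open>auto intro!: divide_left_mono mult_pos_pos\<close>)
    ultimately show ?thesis using diff[OF xy] xy by simp
  qed
  have strict: "\<tau> x < \<tau> y" if "s1 \<le> x" "x < y" for x y
  proof -
    have "0 < (y - x) / M" using that mM by simp
    then show ?thesis using bounds[of x y] that by linarith
  qed
  have \<tau>0: "\<tau> s1 = 0" by (simp add: \<tau>_def)
  have D\<tau>w: "(\<tau> has_real_derivative 1 / g s) (at s within {s1..b})" if "s1 \<le> s" "s \<le> b" for s b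
    unfolding \<tau>_def using that by (intro integral_has_real_derivative ci') auto
  have D\<tau>: "(\<tau> has_real_derivative 1 / g s) (at s)" if "s1 < s" for s
    using D\<tau>w[of s "s + 1"] that by (simp add: at_within_Icc_at)
  have onto: "\<exists>s. s1 \<le> s \<and> \<tau> s = t" if t: "0 \<le> t" for t
  proof -
    let ?b = "s1 + M * t"
    have c: "continuous_on {s1..?b} \<tau>"
      unfolding continuous_on_eq_continuous_within
      by (auto intro!: DERIV_continuous D\<tau>w)
    have "t \<le> \<tau> ?b" using bounds[of s1 ?b] t mM \<tau>0 by simp
    with IVT'[OF _ _ _ c, of t] t mM \<tau>0 show ?thesis by auto
  qed
  then obtain \<sigma> where \<sigma>: "\<And>t. 0 \<le> t \<Longrightarrow> s1 \<le> \<sigma> t \<and> \<tau> (\<sigma> t) = t" by metis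
  have uniq: "x = y" if "s1 \<le> x" "s1 \<le> y" "\<tau> x = \<tau> y" for x y
    using strict[of x y] strict[of y x] that by (cases x y rule: linorder_cases) auto
  have \<sigma>\<tau>: "\<sigma> (\<tau> s) = s" "0 \<le> \<tau> s" if "s1 \<le> s" for s
  proof -
    have "(s - s1) / M \<le> \<tau> s" using bounds[of s1 s] that \<tau>0 by simp
    moreover have "0 \<le> (s - s1) / M" using that mM by simp
    ultimately show "0 \<le> \<tau> s" by linarith
    then show "\<sigma> (\<tau> s) = s" using \<sigma>[of "\<tau> s"] that uniq by blast
  qed
  have mono: "\<sigma> t \<le> \<sigma> t'" if "0 \<le> t" "t \<le> t'" for t t'
    using \<sigma>[of t] \<sigma>[of t'] strict[of "\<sigma> t'" "\<sigma> t"] that by (cases "\<sigma> t \<le> \<sigma> t'") auto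
  have lip: "m * (t' - t) \<le> \<sigma> t' - \<sigma> t \<and> \<sigma> t' - \<sigma> t \<le> M * (t' - t)" if tt: "0 \<le> t" "t \<le> t'" for t t'
    using bounds[OF _ mono[OF tt]] \<sigma>[of t] \<sigma>[of t'] tt m mM
    by (auto simp: field_simps)
  have \<sigma>0: "\<sigma> 0 = s1" using \<sigma>\<tau>[of s1] \<tau>0 by simp
  show ?thesis
  proof (rule exI[of _ \<sigma>], intro conjI allI impI)
    show "s1 \<le> \<sigma> t" if "0 \<le> t" for t using \<sigma>[OF that] by simp
    show "\<sigma> 0 = s1" by (rule \<sigma>0)
    show "m * (t' - t) \<le> \<sigma> t' - \<sigma> t" "\<sigma> t' - \<sigma> t \<le> M * (t' - t)" if "0 \<le> t" "t \<le> t'" for t t'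
      using lip[OF that] by auto
    show "\<exists>t\<ge>0. \<sigma> t = s" if "s1 \<le> s" for s using \<sigma>\<tau>[OF that] by blast
    show "(\<sigma> has_real_derivative g (\<sigma> t)) (at t)" if t: "0 < t" for t
    proof -
      have gt: "s1 < \<sigma> t" using lip[of 0 t] t \<sigma>0 mult_pos_pos[OF m t] by simp
      have "isCont \<sigma> t"
        unfolding continuous_at_eps_delta
      proof (intro allI impI)
        fix e :: real assume e: "0 < e"
        show "\<exists>d>0. \<forall>x'. dist x' t < d \<longrightarrow> dist (\<sigma> x') (\<sigma> t) < e"
        proof (intro exI conjI allI impI)
          show "0 < min t (e / M)" using t e mM by simp
          fix x assume x: "dist x t < min t (e / M)"
          then have "0 \<le> x" "\<bar>x - t\<bar> < e / M" by (auto simp: dist_real_def)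
          then have "M * \<bar>x - t\<bar> < e" using mM by (simp add: field_simps)
          then show "dist (\<sigma> x) (\<sigma> t) < e"
            using lip[of x t] lip[of t x] mono[of x t] mono[of t x] t \<open>0 \<le> x\<close> by (cases "x \<le> t") (auto simp: dist_real_def)
        qed
      qed
      from DERIV_inverse_function[OF D\<tau>[OF gt] _ _ _ _ this, of 0 "t + 1"]
      show ?thesis using \<sigma> t gp[of "\<sigma> t"] gt by auto
    qed
    show "negligible {t. 0 < t \<and> \<sigma> t \<in> N}" if N: "negligible N" for N
    proof (rule negligible_subset)
      show "negligible (\<tau> ` (N \<inter> {s1<..}))"
      proof (rule negligible_differentiable_image_negligible)
        show "negligible (N \<inter> {s1<..})" using N by (simp add: negligible_Int)
        show "\<tau> differentiable_on (N \<inter> {s1<..})"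
          unfolding differentiable_on_def
        proof
          fix x assume "x \<in> N \<inter> {s1<..}"
          then have "(\<tau> has_real_derivative 1 / g x) (at x)" by (intro D\<tau>) auto
          then show "\<tau> differentiable at x within N \<inter> {s1<..}"
            unfolding has_field_derivative_def differentiable_def by (blast intro: has_derivative_at_withinI)
        qed
      qed simp
      show "{t. 0 < t \<and> \<sigma> t \<in> N} \<subseteq> \<tau> ` (N \<inter> {s1<..})"
      proof
        fix t assume "t \<in> {t. 0 < t \<and> \<sigma> t \<in> N}"
        then have t: "0 < t" "\<sigma> t \<in> N" by auto
        have "s1 < \<sigma> t" using lip[of 0 t] t \<sigma>0 mult_pos_pos[OF m t(1)] by simp
        then show "t \<in> \<tau> ` (N \<inter> {s1<..})" using t \<sigma>[of t] by (intro image_eqI[of _ _ "\<sigma> t"]) auto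
      qed
    qed
  qed
qed

section \<open>Rays in Newtonian time\<close>

context potential begin

text \<open>A curve that leaves the ball about \<open>x\<close> is too long already, since a unit of length costs at least \<open>c\<close>
  everywhere.\<close>
lemma jdist_local_lower:
  assumes q: "0 \<le> q" and U: "\<And>z. norm (z - x) \<le> r \<Longrightarrow> ennreal (q\<^sup>2 / 2) \<le> U z + ennreal h"
    and near: "q * norm (y - x) \<le> c * r"
  shows "ennreal (q * norm (y - x)) \<le> d x y"
proof (rule jdist_geI)
  fix \<alpha> \<beta> X assume X: "\<alpha> < \<beta>" "absolutely_continuous_curve \<alpha> \<beta> X" "X \<alpha> = x" "X \<beta> = y"
  show "ennreal (q * norm (y - x)) \<le> act \<alpha> \<beta> X"
  proof (cases "\<forall>t. \<alpha> \<le> t \<longrightarrow> t \<le> \<beta> \<longrightarrow> norm (X t - x) \<le> r")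
    case True
    have "ennreal (q * norm (X \<beta> - X \<alpha>)) \<le> act \<alpha> \<beta> X"
      by (rule action_lower[OF X(2) _ q]) (use True U X in auto)
    then show ?thesis using X by simp
  next
    case False
    then obtain t where t: "\<alpha> \<le> t" "t \<le> \<beta>" "r < norm (X t - x)" by force
    obtain g where g: "velocity \<alpha> \<beta> X g" using AC_velocity[OF X(2)] X(1) by force
    have "ennreal (q * norm (y - x)) \<le> ennreal (c * norm (X t - X \<alpha>))"
      using near t(3) c_pos X(3) by (intro ennreal_leI order_trans[OF near] mult_left_mono) auto
    also have "\<dots> \<le> act \<alpha> t X"
      by (rule action_ge_length[OF AC_subinterval[OF X(2)]]) (use t in auto)
    also have "\<dots> \<le> act \<alpha> t X + act t \<beta> X" by simp
    also have "\<dots> = act \<alpha> \<beta> X" by (rule action_split[OF g, symmetric]) (use t in auto)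
    finally show ?thesis .
  qed
qed

definition ray :: "(real \<Rightarrow> 'v) \<Rightarrow> bool"
  where "ray \<gamma> \<longleftrightarrow> (\<forall>s\<ge>0. \<forall>t\<ge>0. d (\<gamma> s) (\<gamma> t) = ennreal \<bar>t - s\<bar>)"

lemma rayD: "ray \<gamma> \<Longrightarrow> 0 \<le> s \<Longrightarrow> 0 \<le> t \<Longrightarrow> d (\<gamma> s) (\<gamma> t) = ennreal \<bar>t - s\<bar>"
  by (simp add: ray_def)

lemma ray_lipschitz:
  assumes "ray \<gamma>" "0 \<le> s" "s \<le> t"
  shows "norm (\<gamma> t - \<gamma> s) \<le> (1 / c) * (t - s)"
  using jdist_ge_norm[of "\<gamma> t" "\<gamma> s"] rayD[OF assms(1,2), of t] assms(2,3) c_pos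
  by (simp add: ennreal_le_iff field_simps)

end

context cone_potential begin

abbreviation u where "u x \<equiv> enn2real (U x)"

lemma cone_finite:
  assumes "0 < t" "norm (x - t *\<^sub>R a) \<le> \<delta> * t"
  shows "U x = ennreal (u x)" "0 \<le> u x" "u x \<le> C / t"
proof -
  have le: "U x \<le> ennreal (C / t)" using cone_bound[OF assms] .
  then have "U x < top" by (rule order_le_less_trans) simp
  then show eq: "U x = ennreal (u x)" by simp
  show "0 \<le> u x" by simp
  show "u x \<le> C / t" using le C_pos assms(1) by (subst (asm) eq) (simp add: ennreal_le_iff)
qed

text \<open>Far out in the cone the potential is small, so \<open>d\<close> is nearly \<open>c\<close> times the Euclidean distance, while
  rays are parametrized by \<open>d\<close>.\<close>
lemma ray_asymptotic_speed:
  assumes ray: "ray \<gamma>" and l: "0 < l" and dir: "((\<lambda>s. norm (\<gamma> s - (l * s) *\<^sub>R a) / s) \<longlongrightarrow> 0) at_top"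
  shows "l = 1 / c"
proof -
  have "eventually (\<lambda>s. norm (\<gamma> s - (l * s) *\<^sub>R a) / s < \<delta> * l) at_top"
    by (rule order_tendstoD(2)[OF dir]) (use \<delta>_pos l in simp)
  then obtain s0 where s0: "\<And>s. s0 \<le> s \<Longrightarrow> norm (\<gamma> s - (l * s) *\<^sub>R a) / s < \<delta> * l"
    unfolding eventually_at_top_linorder by blast
  have cone: "norm (\<gamma> s - (l * s) *\<^sub>R a) \<le> \<delta> * (l * s)" if "s0 \<le> s" "0 < s" for s
    using s0[OF that(1)] that(2) by (simp add: field_simps)
  have nl: "((\<lambda>s. norm (\<gamma> s - \<gamma> j) / s) \<longlongrightarrow> l) at_top" for j
  proof (rule LIM_zero_cancel, rule Lim_null_comparison)
    show "((\<lambda>s. norm (\<gamma> s - (l * s) *\<^sub>R a) / s + norm (\<gamma> j) / s) \<longlongrightarrow> 0) at_top"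
    proof (rule tendsto_add_zero[OF dir])
      show "((\<lambda>s. norm (\<gamma> j) / s) \<longlongrightarrow> 0) at_top" by real_asymp
    qed
    show "\<forall>\<^sub>F s in at_top. norm (norm (\<gamma> s - \<gamma> j) / s - l) \<le> norm (\<gamma> s - (l * s) *\<^sub>R a) / s + norm (\<gamma> j) / s"
      using eventually_gt_at_top[of 0]
    proof eventually_elim
      case (elim s)
      have "\<bar>norm (\<gamma> s - \<gamma> j) - norm ((l * s) *\<^sub>R a)\<bar> \<le> norm ((\<gamma> s - (l * s) *\<^sub>R a) - \<gamma> j)"
        using norm_triangle_ineq3[of "\<gamma> s - \<gamma> j" "(l * s) *\<^sub>R a"] by (simp add: algebra_simps)
      also have "\<dots> \<le> norm (\<gamma> s - (l * s) *\<^sub>R a) + norm (\<gamma> j)" by (rule norm_triangle_ineq4)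
      finally have "\<bar>norm (\<gamma> s - \<gamma> j) - l * s\<bar> / s \<le> (norm (\<gamma> s - (l * s) *\<^sub>R a) + norm (\<gamma> j)) / s"
        using elim l a_unit by (intro divide_right_mono) (auto simp: abs_mult)
      moreover have "\<bar>norm (\<gamma> s - \<gamma> j) - l * s\<bar> / s = norm (norm (\<gamma> s - \<gamma> j) / s - l)"
      proof -
        have "norm (\<gamma> s - \<gamma> j) / s - l = (norm (\<gamma> s - \<gamma> j) - l * s) / s" using elim by (simp add: field_simps)
        then show ?thesis using elim by (simp add: abs_divide)
      qed
      ultimately show ?case by (simp add: add_divide_distrib)
    qed
  qed
  have "c * l \<le> 1"
  proof (rule tendsto_upperbound[OF tendsto_mult_left[OF nl[of 0], of c]])
    show "\<forall>\<^sub>F s in at_top. c * (norm (\<gamma> s - \<gamma> 0) / s) \<le> 1"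
      using eventually_gt_at_top[of 0]
      by eventually_elim (use ray_lipschitz[OF ray order_refl] c_pos in \<open>simp add: field_simps\<close>)
  qed simp
  moreover have "1 \<le> c * l"
  proof -
    have j: "1 \<le> (c + C / (l * j) / c) * l" if j: "s0 \<le> j" "0 < j" for j
    proof (rule tendsto_le[OF _ tendsto_mult_left[OF nl[of j], of "c + C / (l * j) / c"]])
      show "((\<lambda>s. (s - j) / s) \<longlongrightarrow> 1) at_top" by real_asymp
      show "\<forall>\<^sub>F s in at_top. (s - j) / s \<le> (c + C / (l * j) / c) * (norm (\<gamma> s - \<gamma> j) / s)"
        using eventually_ge_at_top[of j]
      proof eventually_elim
        case (elim s)
        have "d (\<gamma> j) (\<gamma> s) \<le> ennreal ((c + C / (l * j) / c) * norm (\<gamma> s - \<gamma> j))"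
        proof (rule jdist_bounded_segment)
          show "0 \<le> C / (l * j)" using C_pos l j by simp
          fix z assume "z \<in> closed_segment (\<gamma> j) (\<gamma> s)"
          then obtain \<theta> where \<theta>: "0 \<le> \<theta>" "\<theta> \<le> 1" "z = (1 - \<theta>) *\<^sub>R \<gamma> j + \<theta> *\<^sub>R \<gamma> s" unfolding in_segment by blast
          define t where "t = (1 - \<theta>) * (l * j) + \<theta> * (l * s)"
          have "(1 - \<theta>) * (l * j) + \<theta> * (l * j) \<le> t" unfolding t_def
            using \<theta> l elim by (intro add_left_mono mult_left_mono) auto
          then have t: "l * j \<le> t" by (simp add: algebra_simps)
          have lj: "0 < l * j" using l j by simp
          have "z - t *\<^sub>R a = (1 - \<theta>) *\<^sub>R (\<gamma> j - (l * j) *\<^sub>R a) + \<theta> *\<^sub>R (\<gamma> s - (l * s) *\<^sub>R a)"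
            by (simp add: \<theta>(3) t_def scaleR_add_left scaleR_diff_right)
          then have "norm (z - t *\<^sub>R a) \<le> norm ((1 - \<theta>) *\<^sub>R (\<gamma> j - (l * j) *\<^sub>R a)) + norm (\<theta> *\<^sub>R (\<gamma> s - (l * s) *\<^sub>R a))"
            by (simp only: norm_triangle_ineq)
          also have "\<dots> = (1 - \<theta>) * norm (\<gamma> j - (l * j) *\<^sub>R a) + \<theta> * norm (\<gamma> s - (l * s) *\<^sub>R a)" using \<theta> by simp
          also have "\<dots> \<le> (1 - \<theta>) * (\<delta> * (l * j)) + \<theta> * (\<delta> * (l * s))"
            using \<theta> cone[OF j] cone[of s] j elim by (intro add_mono mult_left_mono) auto
          also have "\<dots> = \<delta> * t" by (simp add: t_def algebra_simps)
          finally have "U z \<le> ennreal (C / t)" using t lj by (intro cone_bound) auto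
          also have "\<dots> \<le> ennreal (C / (l * j))" using t lj C_pos by (intro ennreal_leI divide_left_mono) auto
          finally show "U z \<le> ennreal (C / (l * j))" .
        qed
        also have "d (\<gamma> j) (\<gamma> s) = ennreal (s - j)" using rayD[OF ray, of j s] j elim by simp
        finally have "s - j \<le> (c + C / (l * j) / c) * norm (\<gamma> s - \<gamma> j)"
          using C_pos c_pos l j by (subst (asm) ennreal_le_iff) (auto intro!: mult_nonneg_nonneg add_nonneg_nonneg)
        then have "(s - j) / s \<le> ((c + C / (l * j) / c) * norm (\<gamma> s - \<gamma> j)) / s"
          using elim j by (intro divide_right_mono) auto
        then show ?case by simp
      qed
    qed simp
    have "((\<lambda>j. (c + C / (l * j) / c) * l) \<longlongrightarrow> c * l) at_top"
      using c_pos l C_pos by real_asymp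
    then show ?thesis
    proof (rule tendsto_lowerbound)
      show "\<forall>\<^sub>F x in at_top. 1 \<le> (c + C / (l * x) / c) * l"
        using eventually_gt_at_top[of 0] eventually_ge_at_top[of s0] by eventually_elim (rule j)
    qed simp
  qed
  ultimately have "c * l = 1" by simp
  then show ?thesis using c_pos by (simp add: field_simps)
qed

text \<open>The conformal factor of \<open>d\<close> at \<open>\<gamma> s\<close> is \<open>sqrt (2 * (U + h))\<close>, by continuity of \<open>U\<close>, and \<open>\<gamma>\<close> moves at unit
  speed with respect to \<open>d\<close>.\<close>
lemma ray_derivative_bound:
  assumes ray: "ray \<gamma>" and s: "0 < s" and t: "0 < t" "norm (\<gamma> s - t *\<^sub>R a) \<le> \<delta> / 2 * t"
    and D: "(\<gamma> has_vector_derivative D) (at s)"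
  shows "(norm D)\<^sup>2 * (2 * (u (\<gamma> s) + h)) \<le> 1"
proof -
  define f where "f = 2 * (u (\<gamma> s) + h)"
  have f: "0 < f" using h_pos by (simp add: f_def add_nonneg_pos)
  have qD: "norm D * q \<le> 1" if q: "0 < q" "q < sqrt f" for q
  proof -
    have "q\<^sup>2 < (sqrt f)\<^sup>2" using q by (intro power_strict_mono) auto
    then have qf: "q\<^sup>2 < f" using f by simp
    \<comment> \<open>in this ball the potential varies by at most half of the gap between \<open>q^2\<close> and \<open>f\<close>\<close>
    define r where "r = min (\<delta> / 2 * t) ((f - q\<^sup>2) / 2 * t\<^sup>2 / K)"
    have r: "0 < r" using \<delta>_pos t qf K_pos by (simp add: r_def)
    have Kr: "K * r / t\<^sup>2 \<le> (f - q\<^sup>2) / 2"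
    proof -
      have "r \<le> (f - q\<^sup>2) / 2 * t\<^sup>2 / K" unfolding r_def by simp
      then show ?thesis using K_pos t by (simp add: field_simps)
    qed
    have U: "ennreal (q\<^sup>2 / 2) \<le> U z + ennreal h" if z: "norm (z - \<gamma> s) \<le> r" for z
    proof -
      have "norm (z - t *\<^sub>R a) \<le> norm (z - \<gamma> s) + norm (\<gamma> s - t *\<^sub>R a)"
        using norm_triangle_ineq[of "z - \<gamma> s" "\<gamma> s - t *\<^sub>R a"] by simp
      also have "\<dots> \<le> \<delta> / 2 * t + \<delta> / 2 * t" using z t by (intro add_mono) (auto simp: r_def)
      finally have zc: "norm (z - t *\<^sub>R a) \<le> \<delta> * t" by simp
      have sc: "norm (\<gamma> s - t *\<^sub>R a) \<le> \<delta> * t" using t(2) mult_pos_pos[OF \<delta>_pos t(1)] by linarith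
      have "\<bar>u z - u (\<gamma> s)\<bar> \<le> K * norm (z - \<gamma> s) / t\<^sup>2" by (rule cone_lipschitz[OF t(1) zc sc])
      also have "\<dots> \<le> K * r / t\<^sup>2" using z K_pos by (intro divide_right_mono mult_left_mono) auto
      finally have "u (\<gamma> s) - u z \<le> K * r / t\<^sup>2" by linarith
      from order_trans[OF this Kr] have "u (\<gamma> s) - u z \<le> (f - q\<^sup>2) / 2" .
      then have "2 * (u (\<gamma> s) - u z) \<le> f - q\<^sup>2" by simp
      then have "q\<^sup>2 / 2 \<le> u z + h" by (simp add: f_def)
      then have "ennreal (q\<^sup>2 / 2) \<le> ennreal (u z + h)" by (rule ennreal_leI)
      also have "\<dots> = ennreal (u z) + ennreal h" using h_pos by (intro ennreal_plus) auto
      finally show ?thesis using cone_finite(1)[OF t(1) zc] by simp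
    qed
    have main: "norm D \<le> 1 / q + e" if e: "0 < e" for e
    proof -
      obtain \<eta> where \<eta>: "0 < \<eta>" "\<And>y. norm (y - s) < \<eta> \<Longrightarrow> norm (\<gamma> y - \<gamma> s - (y - s) *\<^sub>R D) \<le> e * norm (y - s)"
        using D e unfolding has_vector_derivative_def has_derivative_at_alt by meson
      define k where "k = min (\<eta> / 2) (c * (c * r / q))"
      have "0 < c * (c * r / q)" using c_pos r q by simp
      then have k0: "0 < k" using \<eta>(1) unfolding k_def by simp
      have "k \<le> \<eta> / 2" unfolding k_def by (rule min.cobounded1)
      then have k: "0 < k" "k < \<eta>" using k0 \<eta>(1) by linarith+
      have lip: "norm (\<gamma> (s + k) - \<gamma> s) \<le> (1 / c) * k" using ray_lipschitz[OF ray, of s "s + k"] s k by simp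
      have "q * norm (\<gamma> (s + k) - \<gamma> s) \<le> q * ((1 / c) * (c * (c * r / q)))"
        using lip q c_pos by (intro mult_left_mono order_trans[OF lip]) (auto simp: k_def)
      also have "\<dots> = c * r" using q c_pos by simp
      finally have "ennreal (q * norm (\<gamma> (s + k) - \<gamma> s)) \<le> d (\<gamma> s) (\<gamma> (s + k))"
        using q U by (intro jdist_local_lower) auto
      also have "\<dots> = ennreal k" using rayD[OF ray, of s "s + k"] s k by simp
      finally have "q * norm (\<gamma> (s + k) - \<gamma> s) \<le> k" using k by (simp add: ennreal_le_iff)
      then have 1: "norm (\<gamma> (s + k) - \<gamma> s) \<le> k / q" using q by (simp add: field_simps)
      have "norm (k *\<^sub>R D) \<le> norm (\<gamma> (s + k) - \<gamma> s) + norm (\<gamma> (s + k) - \<gamma> s - k *\<^sub>R D)"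
        using norm_triangle_ineq4[of "\<gamma> (s + k) - \<gamma> s" "\<gamma> (s + k) - \<gamma> s - k *\<^sub>R D"] by simp
      also have "\<dots> \<le> k / q + e * k" using 1 \<eta>(2)[of "s + k"] k by (intro add_mono) auto
      finally have "k * norm D \<le> k * (1 / q + e)" using k by (simp add: algebra_simps)
      then show ?thesis using k by simp
    qed
    have "norm D \<le> 1 / q" by (rule field_le_epsilon) (rule main)
    then show ?thesis using q by (simp add: field_simps)
  qed
  have "norm D * sqrt f \<le> 1"
  proof (rule ccontr)
    assume "\<not> ?thesis"
    then have gt: "1 < norm D * sqrt f" by simp
    then have Dp: "0 < norm D" using zero_less_norm_iff by fastforce
    then have "1 / norm D < sqrt f" using gt by (simp add: field_simps)
    then obtain q where "1 / norm D < q" "q < sqrt f" using dense by blast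
    moreover from this have "0 < q" using Dp by (meson divide_pos_pos less_trans zero_less_one)
    ultimately show False using qD[of q] Dp by (simp add: field_simps)
  qed
  then have "(norm D * sqrt f)\<^sup>2 \<le> 1" using f by (simp add: power_le_one)
  then show ?thesis using f by (simp add: power_mult_distrib f_def)
qed

end

lemma velocity_add:
  assumes "velocity a b \<gamma> g" "velocity a b \<eta> k"
  shows "velocity a b (\<lambda>t. \<gamma> t + \<eta> t) (\<lambda>t. g t + k t)"
proof -
  obtain N where N: "negligible N" "\<And>t. a < t \<Longrightarrow> t < b \<Longrightarrow> t \<notin> N \<Longrightarrow> (\<gamma> has_vector_derivative g t) (at t)"
    using assms(1) unfolding velocity_def by blast
  obtain M where M: "negligible M" "\<And>t. a < t \<Longrightarrow> t < b \<Longrightarrow> t \<notin> M \<Longrightarrow> (\<eta> has_vector_derivative k t) (at t)"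
    using assms(2) unfolding velocity_def by blast
  have "negligible (N \<union> M)" using N M by simp
  moreover have "((\<lambda>t. \<gamma> t + \<eta> t) has_vector_derivative (g t + k t)) (at t)" if "a < t" "t < b" "t \<notin> N \<union> M" for t
    by (rule has_vector_derivative_add) (use N M that in auto)
  moreover have "(\<lambda>t. g t + k t) absolutely_integrable_on {a..b}"
    using assms unfolding velocity_def by (intro set_integral_add) auto
  moreover have "((\<lambda>t. g t + k t) has_integral (\<gamma> y + \<eta> y - (\<gamma> x + \<eta> x))) {x..y}" if "a \<le> x" "x \<le> y" "y \<le> b" for x y
    using has_integral_add[OF velocity_has_integral[OF assms(1) that] velocity_has_integral[OF assms(2) that]]
    by (simp add: algebra_simps)
  ultimately show ?thesis unfolding velocity_def by blast
qed

lemma velocity_scaleR: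
  assumes "velocity a b \<gamma> g"
  shows "velocity a b (\<lambda>t. r *\<^sub>R \<gamma> t) (\<lambda>t. r *\<^sub>R g t)"
proof -
  obtain N where N: "negligible N" "\<And>t. a < t \<Longrightarrow> t < b \<Longrightarrow> t \<notin> N \<Longrightarrow> (\<gamma> has_vector_derivative g t) (at t)"
    using assms(1) unfolding velocity_def by blast
  have "((\<lambda>t. r *\<^sub>R \<gamma> t) has_vector_derivative (r *\<^sub>R g t)) (at t)" if "a < t" "t < b" "t \<notin> N" for t
    by (rule bounded_linear.has_vector_derivative[OF bounded_linear_scaleR_right]) (use N that in auto)
  moreover have "(\<lambda>t. r *\<^sub>R g t) absolutely_integrable_on {a..b}"
    using assms unfolding velocity_def by (intro absolutely_integrable_scaleR_left) auto
  moreover have "((\<lambda>t. r *\<^sub>R g t) has_integral (r *\<^sub>R \<gamma> y - r *\<^sub>R \<gamma> x)) {x..y}" if "a \<le> x" "x \<le> y" "y \<le> b" for x y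
    using has_integral_cmul[OF velocity_has_integral[OF assms(1) that], of r] by (simp add: scaleR_diff_right)
  ultimately show ?thesis unfolding velocity_def using N(1) by blast
qed

lemma velocity_affine:
  "a \<le> b \<Longrightarrow> velocity a b (\<lambda>t. x + t *\<^sub>R e) (\<lambda>_. e)"
  by (rule velocityI[OF AC_lipschitz[where L="norm e"] _ negligible_empty])
     (auto intro!: derivative_eq_intros simp: dist_norm abs_mult mult.commute simp flip: scaleR_diff_left)

lemma lipschitz_velocity:
  fixes \<gamma> :: "real \<Rightarrow> 'v::euclidean_space"
  assumes lip: "\<And>s t. a \<le> s \<Longrightarrow> s \<le> t \<Longrightarrow> t \<le> b \<Longrightarrow> norm (\<gamma> t - \<gamma> s) \<le> L * (t - s)" and L: "0 \<le> L" and ab: "a \<le> b"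
  obtains g where "velocity a b \<gamma> g" "\<And>t. norm (g t) \<le> L"
proof -
  have ac: "absolutely_continuous_curve a b \<gamma>"
    by (rule AC_lipschitz[OF _ L]) (use lip in \<open>auto simp: dist_norm norm_minus_commute\<close>)
  obtain g where g: "velocity a b \<gamma> g" using AC_velocity[OF ac ab] by blast
  obtain N where N: "negligible N" "\<And>t. a < t \<Longrightarrow> t < b \<Longrightarrow> t \<notin> N \<Longrightarrow> (\<gamma> has_vector_derivative g t) (at t)"
    using g unfolding velocity_def by blast
  define k where "k = (\<lambda>t. if a < t \<and> t < b \<and> t \<notin> N then g t else 0)"
  have "velocity a b \<gamma> k"
    by (rule velocityI[OF ac ab N(1)]) (use N(2) in \<open>auto simp: k_def\<close>)
  moreover have "norm (k t) \<le> L" for t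
  proof (cases "a < t \<and> t < b \<and> t \<notin> N")
    case True
    then have D: "(\<gamma> has_vector_derivative g t) (at t)" using N(2) by blast
    have "norm (g t) \<le> L + e" if e: "0 < e" for e
    proof -
      obtain \<eta> where \<eta>: "0 < \<eta>" "\<And>y. norm (y - t) < \<eta> \<Longrightarrow> norm (\<gamma> y - \<gamma> t - (y - t) *\<^sub>R g t) \<le> e * norm (y - t)"
        using D e unfolding has_vector_derivative_def has_derivative_at_alt by meson
      define r where "r = min (\<eta> / 2) (b - t)"
      have r: "0 < r" "r < \<eta>" "t + r \<le> b" using \<eta> True by (auto simp: r_def)
      have "norm (r *\<^sub>R g t) \<le> norm (\<gamma> (t + r) - \<gamma> t) + norm (\<gamma> (t + r) - \<gamma> t - r *\<^sub>R g t)"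
        using norm_triangle_ineq4[of "\<gamma> (t + r) - \<gamma> t" "\<gamma> (t + r) - \<gamma> t - r *\<^sub>R g t"] by simp
      also have "\<dots> \<le> L * r + e * r"
        using lip[of t "t + r"] \<eta>(2)[of "t + r"] r True by (intro add_mono) auto
      finally have "r * norm (g t) \<le> r * (L + e)" using r by (simp add: algebra_simps)
      then show ?thesis using r by simp
    qed
    then have "norm (g t) \<le> L" by (rule field_le_epsilon)
    then show ?thesis using True by (simp add: k_def)
  qed (use L in \<open>auto simp: k_def\<close>)
  ultimately show thesis using that by blast
qed

context cone_potential begin

text \<open>The time change \<open>\<sigma>' = 2 * (U + h)\<close> turns the unit speed of a ray with respect to \<open>d\<close> into the speed of a
  motion of energy \<open>h\<close>.  By \<open>ray_derivative_bound\<close> the Lagrangian is then at most \<open>\<sigma>'\<close>, so the action is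
  at most the increment of \<open>\<sigma>\<close>, which is the distance: the curve minimizes the action.  Since the
  potential is \<open>O(1 / t)\<close> along it, \<open>\<sigma> t = 2 * h * t + O(ln t)\<close>.\<close>
lemma newton_time:
  assumes ray: "ray \<gamma>" and dir: "((\<lambda>s. norm (\<gamma> s - (s / c) *\<^sub>R a) / s) \<longlongrightarrow> 0) at_top"
  obtains \<sigma> :: "real \<Rightarrow> real" and L where "0 \<le> L" "\<And>t. 0 \<le> t \<Longrightarrow> 0 < \<sigma> t" "\<And>s. \<sigma> 0 \<le> s \<Longrightarrow> \<exists>t\<ge>0. \<sigma> t = s"
    "\<And>t t'. 0 \<le> t \<Longrightarrow> t \<le> t' \<Longrightarrow> \<sigma> t \<le> \<sigma> t'"
    "\<And>t. 0 < t \<Longrightarrow> (\<sigma> has_real_derivative 2 * (u (\<gamma> (\<sigma> t)) + h)) (at t)"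
    "\<And>t t'. 0 \<le> t \<Longrightarrow> t \<le> t' \<Longrightarrow> norm (\<gamma> (\<sigma> t') - \<gamma> (\<sigma> t)) \<le> L * (t' - t)"
    "\<And>T T'. 0 < T \<Longrightarrow> T \<le> T' \<Longrightarrow> act T T' (\<lambda>t. \<gamma> (\<sigma> t)) \<le> d (\<gamma> (\<sigma> T)) (\<gamma> (\<sigma> T'))"
    "((\<lambda>t. norm (\<gamma> (\<sigma> t) - (c * t) *\<^sub>R a) / t) \<longlongrightarrow> 0) at_top"
proof -
  have "eventually (\<lambda>s. norm (\<gamma> s - (s / c) *\<^sub>R a) / s < \<delta> / 2 / c) at_top"
    by (rule order_tendstoD(2)[OF dir]) (use \<delta>_pos c_pos in simp)
  then obtain s0 where s0: "\<And>s. s0 \<le> s \<Longrightarrow> norm (\<gamma> s - (s / c) *\<^sub>R a) / s < \<delta> / 2 / c"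
    unfolding eventually_at_top_linorder by blast
  define s1 where "s1 = max s0 1"
  have s1: "0 < s1" by (simp add: s1_def)
  have cone: "norm (\<gamma> s - (s / c) *\<^sub>R a) \<le> \<delta> / 2 * (s / c)" if "s1 \<le> s" for s
  proof -
    have "s0 \<le> s" "0 < s" using that by (auto simp: s1_def)
    then show ?thesis using s0[of s] by (simp add: field_simps)
  qed
  have sc: "0 < s / c" if "s1 \<le> s" for s using that s1 c_pos by simp
  have half: "\<delta> / 2 * r \<le> \<delta> * r" if "0 < r" for r using mult_pos_pos[OF \<delta>_pos that] by linarith
  have cone1: "norm (\<gamma> s - (s / c) *\<^sub>R a) \<le> \<delta> * (s / c)" if "s1 \<le> s" for s
    using cone[OF that] half[OF sc[OF that]] by linarith
  have fin: "u (\<gamma> s) \<le> C * c / s" if "s1 \<le> s" for s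
    using cone_finite(3)[OF sc[OF that] cone1[OF that]] c_pos by simp
  define g where "g = (\<lambda>s. 2 * (u (\<gamma> s) + h))"
  define M where "M = 2 * (C * c / s1 + h)"
  have gM: "2 * h \<le> g s \<and> g s \<le> M" if "s1 \<le> s" for s
  proof -
    have "C * c / s \<le> C * c / s1" using that s1 C_pos c_pos by (intro divide_left_mono) auto
    then show ?thesis using fin[OF that] by (simp add: g_def M_def)
  qed
  have M: "0 < M" using C_pos c_pos s1 h_pos by (simp add: M_def add_pos_pos)
  have contu: "continuous_on {s1..} (\<lambda>s. u (\<gamma> s))"
    unfolding continuous_on_iff
  proof (intro ballI allI impI)
    fix s and e :: real assume s: "s \<in> {s1..}" and e: "0 < e"
    define t where "t = s / c"
    have t: "0 < t" using sc s by (simp add: t_def)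
    define \<eta> where "\<eta> = min (c * (\<delta> / 2 * t)) (c * (e * t\<^sup>2 / (2 * K)))"
    have \<eta>: "0 < \<eta>" using c_pos \<delta>_pos t e K_pos by (simp add: \<eta>_def)
    have "dist (u (\<gamma> x)) (u (\<gamma> s)) < e" if x: "x \<in> {s1..}" "dist x s < \<eta>" for x
    proof -
      have "norm (\<gamma> x - \<gamma> s) \<le> (1 / c) * \<bar>x - s\<bar>"
        using ray_lipschitz[OF ray, of s x] ray_lipschitz[OF ray, of x s] s x s1
        by (cases "s \<le> x") (auto simp: norm_minus_commute)
      also have "\<dots> \<le> (1 / c) * \<eta>" using x c_pos by (intro mult_left_mono) (auto simp: dist_real_def)
      finally have n: "norm (\<gamma> x - \<gamma> s) \<le> \<eta> / c" by simp
      have "\<eta> / c \<le> c * (\<delta> / 2 * t) / c" "\<eta> / c \<le> c * (e * t\<^sup>2 / (2 * K)) / c"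
        unfolding \<eta>_def using c_pos by (intro divide_right_mono min.cobounded1 min.cobounded2 less_imp_le; simp)+
      then have n1: "norm (\<gamma> x - \<gamma> s) \<le> \<delta> / 2 * t" and n2: "norm (\<gamma> x - \<gamma> s) \<le> e * t\<^sup>2 / (2 * K)"
        using n unfolding nonzero_mult_div_cancel_left[OF less_imp_neq[OF c_pos, symmetric]] by linarith+
      have "norm (\<gamma> x - t *\<^sub>R a) \<le> norm (\<gamma> x - \<gamma> s) + norm (\<gamma> s - t *\<^sub>R a)"
        using norm_triangle_ineq[of "\<gamma> x - \<gamma> s" "\<gamma> s - t *\<^sub>R a"] by simp
      also have "\<dots> \<le> \<delta> / 2 * t + \<delta> / 2 * t" using n1 cone[of s] s by (intro add_mono) (auto simp: t_def)
      finally have xc: "norm (\<gamma> x - t *\<^sub>R a) \<le> \<delta> * t" by simp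
      have "\<bar>u (\<gamma> x) - u (\<gamma> s)\<bar> \<le> K * norm (\<gamma> x - \<gamma> s) / t\<^sup>2"
        by (rule cone_lipschitz[OF t xc]) (use cone1[of s] s in \<open>simp add: t_def\<close>)
      also have "\<dots> \<le> K * (e * t\<^sup>2 / (2 * K)) / t\<^sup>2" using n2 K_pos by (intro divide_right_mono mult_left_mono) auto
      also have "\<dots> = e / 2" using K_pos t by simp
      finally show ?thesis using e by (simp add: dist_real_def)
    qed
    with \<eta> show "\<exists>d>0. \<forall>x'\<in>{s1..}. dist x' s < d \<longrightarrow> dist (u (\<gamma> x')) (u (\<gamma> s)) < e" by blast
  qed
  then have contg: "continuous_on {s1..} g" unfolding g_def by (intro continuous_intros)
  have "0 < 2 * h" using h_pos by simp
  from time_change[OF contg this gM] obtain \<sigma> where *: "(\<forall>t\<ge>0. s1 \<le> \<sigma> t) \<and> \<sigma> 0 = s1 \<and>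
    (\<forall>t>0. (\<sigma> has_real_derivative g (\<sigma> t)) (at t)) \<and>
    (\<forall>t t'. 0 \<le> t \<longrightarrow> t \<le> t' \<longrightarrow> 2 * h * (t' - t) \<le> \<sigma> t' - \<sigma> t \<and> \<sigma> t' - \<sigma> t \<le> M * (t' - t)) \<and>
    (\<forall>s\<ge>s1. \<exists>t\<ge>0. \<sigma> t = s) \<and>
    (\<forall>N. negligible N \<longrightarrow> negligible {t. 0 < t \<and> \<sigma> t \<in> N})" by (rule exE)
  have \<sigma>: "s1 \<le> \<sigma> t" if "0 \<le> t" for t using * that by blast
  have \<sigma>0: "\<sigma> 0 = s1" using * by blast
  have \<sigma>': "(\<sigma> has_real_derivative g (\<sigma> t)) (at t)" if "0 < t" for t using * that by blast
  have \<sigma>b: "2 * h * (t' - t) \<le> \<sigma> t' - \<sigma> t \<and> \<sigma> t' - \<sigma> t \<le> M * (t' - t)" if "0 \<le> t" "t \<le> t'" for t t'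
    using * that by blast
  have \<sigma>onto: "\<exists>t\<ge>0. \<sigma> t = s" if "s1 \<le> s" for s using * that by blast
  have \<sigma>N: "negligible {t. 0 < t \<and> \<sigma> t \<in> N}" if "negligible N" for N using * that by blast
  have \<sigma>mono: "\<sigma> t \<le> \<sigma> t'" if "0 \<le> t" "t \<le> t'" for t t'
  proof -
    have "0 \<le> 2 * h * (t' - t)" using that h_pos by simp
    then show ?thesis using \<sigma>b[OF that] by linarith
  qed
  have \<sigma>pos: "0 < \<sigma> t" if "0 \<le> t" for t using \<sigma>[OF that] s1 by simp
  define X where "X = (\<lambda>t. \<gamma> (\<sigma> t))"
  define L where "L = M / c"
  have L: "0 \<le> L" using M c_pos by (simp add: L_def)
  have lip: "norm (X t' - X t) \<le> L * (t' - t)" if "0 \<le> t" "t \<le> t'" for t t'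
  proof -
    have "norm (X t' - X t) \<le> (1 / c) * (\<sigma> t' - \<sigma> t)"
      unfolding X_def by (rule ray_lipschitz[OF ray]) (use \<sigma>pos[OF that(1)] \<sigma>mono[OF that] in auto)
    also have "\<dots> \<le> (1 / c) * (M * (t' - t))" using \<sigma>b[OF that] c_pos by (intro mult_left_mono) auto
    finally show ?thesis by (simp add: L_def)
  qed
  have min: "act T T' X \<le> d (X T) (X T')" if T: "0 < T" "T \<le> T'" for T T'
  proof -
    have st: "\<sigma> T \<le> \<sigma> T'" "0 < \<sigma> T" using \<sigma>mono \<sigma>pos T by auto
    obtain g' where g': "velocity (\<sigma> T) (\<sigma> T') \<gamma> g'"
      by (rule lipschitz_velocity[OF ray_lipschitz[OF ray], of "\<sigma> T" "\<sigma> T'"]) (use st c_pos in auto)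
    then obtain N where N: "negligible N" "\<And>s. \<sigma> T < s \<Longrightarrow> s < \<sigma> T' \<Longrightarrow> s \<notin> N \<Longrightarrow> (\<gamma> has_vector_derivative g' s) (at s)"
      unfolding velocity_def by blast
    define N' where "N' = {t. 0 < t \<and> \<sigma> t \<in> N}"
    have N': "negligible N'" unfolding N'_def by (rule \<sigma>N[OF N(1)])
    \<comment> \<open>the value 0 at exceptional times makes the bound \<open>V2\<close> hold everywhere\<close>
    define V where "V = (\<lambda>t. if T < t \<and> t < T' \<and> t \<notin> N' then g (\<sigma> t) *\<^sub>R g' (\<sigma> t) else 0)"
    have der: "(\<gamma> has_vector_derivative g' (\<sigma> t)) (at (\<sigma> t))" if t: "T < t" "t < T'" "t \<notin> N'" for t
    proof (rule N(2))
      have "0 < 2 * h * (t - T)" "0 < 2 * h * (T' - t)" using t h_pos by auto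
      then show "\<sigma> T < \<sigma> t" "\<sigma> t < \<sigma> T'" using \<sigma>b[of T t] \<sigma>b[of t T'] t T by auto
      show "\<sigma> t \<notin> N" using t T by (simp add: N'_def)
    qed
    have V: "velocity T T' X V"
    proof (rule velocityI[OF AC_lipschitz[where L=L] T(2) N'])
      fix t assume t: "T < t" "t < T'" "t \<notin> N'"
      have "(\<sigma> has_vector_derivative g (\<sigma> t)) (at t)"
        using \<sigma>'[of t] t T by (simp add: has_real_derivative_iff_has_vector_derivative)
      from vector_diff_chain_at[OF this der[OF t]]
      show "(X has_vector_derivative V t) (at t)" using t by (simp add: V_def X_def o_def)
    qed (use lip L T in \<open>auto simp: dist_norm norm_minus_commute\<close>)
    have V2: "(norm (V t))\<^sup>2 \<le> g (\<sigma> t)" if "T \<le> t" "t \<le> T'" for t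
    proof -
      have ss: "s1 \<le> \<sigma> t" using \<sigma> that T by simp
      have gp: "0 < g (\<sigma> t)" using gM[OF ss] h_pos by linarith
      show ?thesis
      proof (cases "T < t \<and> t < T' \<and> t \<notin> N'")
        case True
        have "(norm (g' (\<sigma> t)))\<^sup>2 * g (\<sigma> t) \<le> 1"
          unfolding g_def
          by (rule ray_derivative_bound[OF ray _ sc[OF ss] cone[OF ss]]) (use der True \<sigma>pos T in auto)
        then have "((norm (g' (\<sigma> t)))\<^sup>2 * g (\<sigma> t)) * g (\<sigma> t) \<le> 1 * g (\<sigma> t)"
          using gp by (intro mult_right_mono) auto
        then show ?thesis using True by (simp add: V_def power_mult_distrib power2_eq_square mult_ac)
      qed (use gp in \<open>auto simp: V_def\<close>)
    qed
    have "((\<lambda>t. g (\<sigma> t)) has_integral (\<sigma> T' - \<sigma> T)) {T..T'}"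
    proof (rule fundamental_theorem_of_calculus[OF T(2)])
      fix t assume "t \<in> {T..T'}"
      then show "(\<sigma> has_vector_derivative g (\<sigma> t)) (at t within {T..T'})"
        using \<sigma>'[of t] T by (simp add: has_real_derivative_iff_has_vector_derivative has_vector_derivative_at_within)
    qed
    have gnn: "0 \<le> g (\<sigma> t)" if "t \<in> {T..T'}" for t using gM[OF \<sigma>[of t]] that T h_pos by auto
    have "act T T' X \<le> (\<integral>\<^sup>+t. ennreal (g (\<sigma> t)) * indicator {T..T'} t \<partial>lebesgue)"
      unfolding action_velocity[OF V]
    proof (rule nn_integral_mono)
      fix t
      show "lagrangian U h X V t * indicator {T..T'} t \<le> ennreal (g (\<sigma> t)) * indicator {T..T'} t"
      proof (cases "t \<in> {T..T'}")
        case True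
        have ss: "s1 \<le> \<sigma> t" using \<sigma> True T by simp
        have "lagrangian U h X V t = ennreal (1/2 * (norm (V t))\<^sup>2) + ennreal (u (X t)) + ennreal h"
          unfolding lagrangian_def using cone_finite(1)[OF sc[OF ss] cone1[OF ss]] by (simp add: X_def)
        also have "\<dots> = ennreal (1/2 * (norm (V t))\<^sup>2 + u (X t) + h)" using h_pos by (simp add: ennreal_plus)
        also have "\<dots> \<le> ennreal (g (\<sigma> t))"
          using V2[of t] True by (intro ennreal_leI) (simp add: g_def X_def)
        finally show ?thesis using True by simp
      qed simp
    qed
    also have "\<dots> = ennreal (\<sigma> T' - \<sigma> T)"
      using nn_integral_has_integral_lebesgue'[OF gnn \<open>((\<lambda>t. g (\<sigma> t)) has_integral (\<sigma> T' - \<sigma> T)) {T..T'}\<close>]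
      by (simp add: nn_integral_completion)
    also have "\<dots> = d (X T) (X T')"
      unfolding X_def using rayD[OF ray, of "\<sigma> T" "\<sigma> T'"] st by simp
    finally show ?thesis .
  qed
  have asym: "((\<lambda>t. norm (X t - (c * t) *\<^sub>R a) / t) \<longlongrightarrow> 0) at_top"
  proof -
    \<comment> \<open>nonincreasing, which bounds the deviation of \<open>\<sigma>\<close> from \<open>2 * h * t\<close> by a logarithm\<close>
    define k where "k = (\<lambda>t. \<sigma> t - 2 * h * t - (C * c / h) * ln t)"
    have k1: "k t \<le> k 1" if t: "1 \<le> t" for t
    proof (rule DERIV_nonpos_imp_nonincreasing[OF t])
      fix x :: real assume x: "1 \<le> x" "x \<le> t"
      have ss: "s1 \<le> \<sigma> x" using \<sigma> x by simp
      have "2 * h * x \<le> \<sigma> x" using \<sigma>b[of 0 x] x \<sigma>0 s1 by simp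
      moreover have hx: "0 < 2 * h * x" using h_pos x by simp
      ultimately have "C * c / \<sigma> x \<le> C * c / (2 * h * x)" using C_pos c_pos h_pos x ss s1 by (intro divide_left_mono mult_pos_pos) auto
      then have "u (\<gamma> (\<sigma> x)) \<le> C * c / (2 * h * x)" using fin[OF ss] by linarith
      then have "g (\<sigma> x) - 2 * h - (C * c / h) * (1 / x) \<le> 0" using h_pos x by (simp add: g_def field_simps)
      moreover have "(k has_real_derivative g (\<sigma> x) - 2 * h - (C * c / h) * (1 / x)) (at x)"
        unfolding k_def using x h_pos by (auto intro!: derivative_eq_intros \<sigma>')
      ultimately show "\<exists>y. (k has_real_derivative y) (at x) \<and> y \<le> 0" by blast
    qed
    have "filterlim \<sigma> at_top at_top"
    proof (rule filterlim_at_top_mono)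
      show "filterlim (\<lambda>t. 2 * h * t) at_top at_top" using h_pos by real_asymp
      show "\<forall>\<^sub>F t in at_top. 2 * h * t \<le> \<sigma> t"
        using eventually_ge_at_top[of 0] by eventually_elim (use \<sigma>b[of 0] \<sigma>0 s1 in force)
    qed
    then have l1: "((\<lambda>t. norm (\<gamma> (\<sigma> t) - (\<sigma> t / c) *\<^sub>R a) / \<sigma> t) \<longlongrightarrow> 0) at_top"
      by (rule filterlim_compose[OF dir])
    have l2: "((\<lambda>t. norm (\<gamma> (\<sigma> t) - (\<sigma> t / c) *\<^sub>R a) / \<sigma> t * (s1 + M) + (\<bar>k 1\<bar> + (C * c / h) * ln t) / t / c) \<longlongrightarrow> 0 * (s1 + M) + 0) at_top"
    proof (intro tendsto_add tendsto_mult_right l1)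
      show "((\<lambda>t. (\<bar>k 1\<bar> + (C * c / h) * ln t) / t / c) \<longlongrightarrow> 0) at_top" using C_pos c_pos h_pos by real_asymp
    qed
    show ?thesis
    proof (rule tendsto_sandwich[OF _ _ tendsto_const l2[unfolded mult_zero_left add_0_right]])
      show "\<forall>\<^sub>F t in at_top. 0 \<le> norm (X t - (c * t) *\<^sub>R a) / t"
        using eventually_ge_at_top[of 0] by eventually_elim simp
      show "\<forall>\<^sub>F t in at_top. norm (X t - (c * t) *\<^sub>R a) / t \<le>
        norm (\<gamma> (\<sigma> t) - (\<sigma> t / c) *\<^sub>R a) / \<sigma> t * (s1 + M) + (\<bar>k 1\<bar> + (C * c / h) * ln t) / t / c"
        using eventually_ge_at_top[of 1]
      proof eventually_elim
        case (elim t)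
        have sp: "0 < \<sigma> t" using \<sigma>pos elim by simp
        have "\<sigma> t \<le> s1 + M * t" using \<sigma>b[of 0 t] \<sigma>0 elim by simp
        also have "\<dots> \<le> s1 * t + M * t" using s1 elim by simp
        finally have st: "\<sigma> t \<le> (s1 + M) * t" by (simp add: algebra_simps)
        have lo: "0 \<le> \<sigma> t - 2 * h * t" using \<sigma>b[of 0 t] \<sigma>0 elim s1 by simp
        have hi: "\<sigma> t - 2 * h * t \<le> \<bar>k 1\<bar> + (C * c / h) * ln t" using k1[OF elim] by (simp add: k_def)
        have "X t - (c * t) *\<^sub>R a = (\<gamma> (\<sigma> t) - (\<sigma> t / c) *\<^sub>R a) + ((\<sigma> t - 2 * h * t) / c) *\<^sub>R a"
        proof -
          have "(\<sigma> t - 2 * h * t) / c = \<sigma> t / c - c * t" using c_sq[symmetric] c_pos by (simp add: field_simps)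
          then show ?thesis by (simp add: X_def scaleR_diff_left)
        qed
        then have "norm (X t - (c * t) *\<^sub>R a) \<le> norm (\<gamma> (\<sigma> t) - (\<sigma> t / c) *\<^sub>R a) + (\<sigma> t - 2 * h * t) / c"
          using norm_triangle_ineq[of "\<gamma> (\<sigma> t) - (\<sigma> t / c) *\<^sub>R a" "((\<sigma> t - 2 * h * t) / c) *\<^sub>R a"] lo c_pos a_unit by simp
        also have "norm (\<gamma> (\<sigma> t) - (\<sigma> t / c) *\<^sub>R a) = norm (\<gamma> (\<sigma> t) - (\<sigma> t / c) *\<^sub>R a) / \<sigma> t * \<sigma> t" using sp by simp
        also have "\<dots> \<le> norm (\<gamma> (\<sigma> t) - (\<sigma> t / c) *\<^sub>R a) / \<sigma> t * ((s1 + M) * t)"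
          using st sp by (intro mult_left_mono) auto
        finally have "norm (X t - (c * t) *\<^sub>R a) \<le> norm (\<gamma> (\<sigma> t) - (\<sigma> t / c) *\<^sub>R a) / \<sigma> t * ((s1 + M) * t) + (\<bar>k 1\<bar> + (C * c / h) * ln t) / c"
          using divide_right_mono[OF hi, of c] c_pos by linarith
        then have "norm (X t - (c * t) *\<^sub>R a) / t \<le> (norm (\<gamma> (\<sigma> t) - (\<sigma> t / c) *\<^sub>R a) / \<sigma> t * ((s1 + M) * t) + (\<bar>k 1\<bar> + (C * c / h) * ln t) / c) / t"
          using elim by (intro divide_right_mono) auto
        also have "\<dots> = norm (\<gamma> (\<sigma> t) - (\<sigma> t / c) *\<^sub>R a) / \<sigma> t * (s1 + M) + (\<bar>k 1\<bar> + (C * c / h) * ln t) / t / c"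
          using elim by (simp add: add_divide_distrib)
        finally show ?case .
      qed
    qed
  qed
  show thesis
    by (rule that[of L \<sigma>]) (use L \<sigma>pos \<sigma>0 \<sigma>onto \<sigma>' \<sigma>mono lip min asym in \<open>simp_all add: X_def g_def\<close>)
qed

end

section \<open>Rays with the same direction\<close>

lemma velocity_bounded_lipschitz:
  assumes "velocity a b Y g" "\<And>t. norm (g t) \<le> B" "a \<le> s" "s \<le> t" "t \<le> b"
  shows "norm (Y t - Y s) \<le> B * (t - s)"
proof -
  have "0 \<le> B" using order_trans[OF norm_ge_zero assms(2)] .
  then have "norm (Y t - Y s) \<le> B * measure lborel (cbox s t)"
    using velocity_has_integral[OF assms(1,3,4,5)] assms(2) by (intro has_integral_bound[of B g]) auto
  then show ?thesis using assms(4) by simp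
qed

lemma velocity_bounded_AC:
  assumes "velocity a b Y g" "\<And>t. norm (g t) \<le> B"
  shows "absolutely_continuous_curve a b Y"
  by (rule AC_lipschitz[where L=B])
     (use velocity_bounded_lipschitz[OF assms] order_trans[OF norm_ge_zero assms(2)] in \<open>auto simp: dist_norm norm_minus_commute\<close>)

lemma velocity_norm_square_integrable:
  assumes "velocity a b Y g" "\<And>t. norm (g t) \<le> B"
  shows "(\<lambda>t. (norm (g t))\<^sup>2) integrable_on {a..b}"
proof (rule measurable_bounded_by_integrable_imp_integrable)
  have [measurable]: "g \<in> borel_measurable (lebesgue_on {a..b})"
    using assms(1) unfolding velocity_def by (subst (asm) absolutely_integrable_measurable) auto
  show "(\<lambda>t. (norm (g t))\<^sup>2) \<in> borel_measurable (lebesgue_on {a..b})" by measurable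
  show "(\<lambda>t. B\<^sup>2) integrable_on {a..b}" by (rule integrable_const_ivl)
  show "norm ((norm (g t))\<^sup>2) \<le> B\<^sup>2" for t using assms(2)[of t] by (simp add: power_mono)
qed simp

context cone_potential begin

text \<open>In the cone the potential is finite and bounded, so actions are real integrals and can be
  subtracted from one another.\<close>
lemma action_as_integral:
  assumes T: "0 < T" and V: "velocity T T' Y V" "\<And>t. norm (V t) \<le> L"
    and cone: "\<And>t. T \<le> t \<Longrightarrow> t \<le> T' \<Longrightarrow> norm (Y t - (c * t) *\<^sub>R a) \<le> \<delta> * (c * t)"
  shows "(\<lambda>t. 1/2 * (norm (V t))\<^sup>2 + u (Y t) + h) integrable_on {T..T'}"
    and "act T T' Y = ennreal (integral {T..T'} (\<lambda>t. 1/2 * (norm (V t))\<^sup>2 + u (Y t) + h))"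
proof -
  let ?f = "\<lambda>t. 1/2 * (norm (V t))\<^sup>2 + u (Y t) + h"
  have lagr: "lagrangian U h Y V t * indicator {T..T'} t = ennreal (?f t) * indicator {T..T'} t" for t
  proof (cases "t \<in> {T..T'}")
    case True
    then have "U (Y t) = ennreal (u (Y t))" using T c_pos by (intro cone_finite(1)[OF _ cone]) auto
    then have "lagrangian U h Y V t = ennreal (1/2 * (norm (V t))\<^sup>2) + ennreal (u (Y t)) + ennreal h"
      by (simp add: lagrangian_def)
    also have "\<dots> = ennreal (?f t)" using h_pos by (simp add: ennreal_plus)
    finally show ?thesis by simp
  qed simp
  have fnn: "0 \<le> ?f t" for t using h_pos by (simp add: add_nonneg_nonneg)
  show int: "?f integrable_on {T..T'}"
  proof (rule measurable_bounded_by_integrable_imp_integrable)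
    have "(\<lambda>t. enn2real (lagrangian U h Y V t * indicator {T..T'} t)) \<in> borel_measurable lebesgue"
      using lagrangian_measurable[OF V(1)] by measurable
    also have "(\<lambda>t. enn2real (lagrangian U h Y V t * indicator {T..T'} t)) = (\<lambda>t. indicator {T..T'} t *\<^sub>R ?f t)"
      unfolding lagr using fnn by (auto simp: indicator_def fun_eq_iff)
    finally show "?f \<in> borel_measurable (lebesgue_on {T..T'})"
      by (subst borel_measurable_restrict_space_iff) auto
    show "(\<lambda>t. 1/2 * L\<^sup>2 + C / (c * T) + h) integrable_on {T..T'}" by (rule integrable_const_ivl)
    fix t assume t: "t \<in> {T..T'}"
    have ct: "0 < c * T" "c * T \<le> c * t" using t T c_pos by auto
    have "u (Y t) \<le> C / (c * t)" using t ct by (intro cone_finite(3)[OF _ cone]) auto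
    also have "\<dots> \<le> C / (c * T)" using ct C_pos by (intro divide_left_mono) auto
    finally have "u (Y t) \<le> C / (c * T)" .
    moreover have "(norm (V t))\<^sup>2 \<le> L\<^sup>2" using V(2)[of t] by (intro power_mono) auto
    ultimately show "norm (?f t) \<le> 1/2 * L\<^sup>2 + C / (c * T) + h" using fnn[of t] by simp
  qed simp
  show "act T T' Y = ennreal (integral {T..T'} ?f)"
    unfolding action_velocity[OF V(1)] lagr
    using nn_integral_has_integral_lebesgue'[OF fnn integrable_integral[OF int]] by (simp add: nn_integral_completion)
qed

text \<open>With \<open>w = X2 - X1\<close> and \<open>z\<close> its deviation from the chord, add up the two inequalities that express the
  minimality of \<open>X1\<close> against \<open>X1 + z/2\<close> and of \<open>X2\<close> against \<open>X2 - z/2\<close>.  The kinetic terms give minus a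
  quarter of the integral of the squared velocity of \<open>z\<close>, as \<open>z\<close> vanishes at both ends.  The
  potential terms form a second difference with increments \<open>z/2\<close> and \<open>w - z/2\<close>.\<close>
lemma pair_comparison:
  assumes T: "0 < T" "T < T'" and L: "0 \<le> L"
    and lip1: "\<And>s t. T \<le> s \<Longrightarrow> s \<le> t \<Longrightarrow> t \<le> T' \<Longrightarrow> norm (X1 t - X1 s) \<le> L * (t - s)"
    and lip2: "\<And>s t. T \<le> s \<Longrightarrow> s \<le> t \<Longrightarrow> t \<le> T' \<Longrightarrow> norm (X2 t - X2 s) \<le> L * (t - s)"
    and min1: "act T T' X1 \<le> d (X1 T) (X1 T')" and min2: "act T T' X2 \<le> d (X2 T) (X2 T')"
    and cone1: "\<And>t. T \<le> t \<Longrightarrow> t \<le> T' \<Longrightarrow> norm (X1 t - (c * t) *\<^sub>R a) \<le> \<delta> / 2 * (c * t)"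
    and cone2: "\<And>t. T \<le> t \<Longrightarrow> t \<le> T' \<Longrightarrow> norm (X2 t - (c * t) *\<^sub>R a) \<le> \<delta> / 2 * (c * t)"
    and W: "\<And>t. T \<le> t \<Longrightarrow> t \<le> T' \<Longrightarrow> norm (X2 t - X1 t) \<le> W" "W \<le> \<delta> / 2 * (c * T)"
    and t: "T \<le> t" "t \<le> T'"
  shows "norm ((X2 t - X1 t) - (X2 T - X1 T) - ((t - T) / (T' - T)) *\<^sub>R ((X2 T' - X1 T') - (X2 T - X1 T)))
    \<le> 2 * (T' - T)\<^sup>2 * K * W / (c * T)^3"
proof -
  define \<Delta> where "\<Delta> = T' - T"
  have \<Delta>: "0 < \<Delta>" using T by (simp add: \<Delta>_def)
  define w where "w = (\<lambda>t. X2 t - X1 t)"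
  define e where "e = (1 / \<Delta>) *\<^sub>R (w T' - w T)"
  define z where "z = (\<lambda>t. (X2 t + (-1) *\<^sub>R X1 t) + ((T *\<^sub>R e - w T) + t *\<^sub>R (- e)))"
  have z: "z t = w t - w T - (t - T) *\<^sub>R e" for t by (simp add: z_def w_def algebra_simps)
  have T'0: "T \<le> T'" using T by simp
  obtain V1 where V1: "velocity T T' X1 V1" "\<And>t. norm (V1 t) \<le> L" using lipschitz_velocity[OF lip1 L T'0] by blast
  obtain V2 where V2: "velocity T T' X2 V2" "\<And>t. norm (V2 t) \<le> L" using lipschitz_velocity[OF lip2 L T'0] by blast
  define zv where "zv = (\<lambda>t. (V2 t + (-1) *\<^sub>R V1 t) + (- e))"
  have zv: "velocity T T' z zv"
    unfolding z_def zv_def by (intro velocity_add velocity_scaleR velocity_affine V1 V2 T'0)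
  define B where "B = 2 * L + norm e"
  have zvB: "norm (zv t) \<le> B" for t
  proof -
    have "norm (zv t) \<le> norm (V2 t - V1 t) + norm e" unfolding zv_def by (simp add: norm_triangle_ineq4)
    also have "norm (V2 t - V1 t) \<le> L + L" using norm_triangle_ineq4[of "V2 t" "V1 t"] V1(2)[of t] V2(2)[of t] by linarith
    finally show ?thesis by (simp add: B_def)
  qed
  have B0: "0 \<le> B" using L by (simp add: B_def)
  have zT: "z T = 0" "z T' = 0" using \<Delta> by (simp_all add: z e_def flip: \<Delta>_def)
  have W0: "0 \<le> W" using order_trans[OF norm_ge_zero W(1)[of T]] T by simp
  have chord: "norm (w t - z t) \<le> W" if t: "T \<le> t" "t \<le> T'" for t
  proof -
    define \<theta> where "\<theta> = (t - T) / \<Delta>"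
    have \<theta>: "0 \<le> \<theta>" "\<theta> \<le> 1" using t \<Delta> by (auto simp: \<theta>_def \<Delta>_def)
    have "w t - z t = (1 - \<theta>) *\<^sub>R w T + \<theta> *\<^sub>R w T'" by (simp add: z e_def \<theta>_def algebra_simps)
    then have "norm (w t - z t) \<le> (1 - \<theta>) * norm (w T) + \<theta> * norm (w T')"
      using norm_triangle_ineq[of "(1 - \<theta>) *\<^sub>R w T" "\<theta> *\<^sub>R w T'"] \<theta> by simp
    also have "\<dots> \<le> (1 - \<theta>) * W + \<theta> * W" using \<theta> W(1) T by (intro add_mono mult_left_mono) (auto simp: w_def)
    finally show ?thesis by (simp add: algebra_simps)
  qed
  have zW: "norm ((1/2) *\<^sub>R z t) \<le> W" if t: "T \<le> t" "t \<le> T'" for t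
    using norm_triangle_ineq4[of "w t" "w t - z t"] chord[OF t] W(1)[OF t] by (simp add: w_def)
  have ct: "0 < c * t" "c * T \<le> c * t" if "T \<le> t" for t using that T c_pos by auto
  have WT: "W \<le> \<delta> / 2 * (c * t)" if "T \<le> t" for t
  proof -
    have "\<delta> / 2 * (c * T) \<le> \<delta> / 2 * (c * t)" by (rule mult_left_mono[OF ct(2)[OF that]]) (use \<delta>_pos in simp)
    with W(2) show ?thesis by (rule order_trans)
  qed
  define Y1 where "Y1 = (\<lambda>t. X1 t + (1/2) *\<^sub>R z t)"
  define Y2 where "Y2 = (\<lambda>t. X2 t + (-1/2) *\<^sub>R z t)"
  define v1 where "v1 = (\<lambda>t. V1 t + (1/2) *\<^sub>R zv t)"
  define v2 where "v2 = (\<lambda>t. V2 t + (-1/2) *\<^sub>R zv t)"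
  have vY1: "velocity T T' Y1 v1" unfolding Y1_def v1_def by (intro velocity_add velocity_scaleR V1 zv)
  have vY2: "velocity T T' Y2 v2" unfolding Y2_def v2_def by (intro velocity_add velocity_scaleR V2 zv)
  have v1B: "norm (v1 t) \<le> L + B" for t
    using norm_triangle_ineq[of "V1 t" "(1/2) *\<^sub>R zv t"] V1(2)[of t] zvB[of t] B0 by (simp add: v1_def)
  have v2B: "norm (v2 t) \<le> L + B" for t
    using norm_triangle_ineq[of "V2 t" "(-1/2) *\<^sub>R zv t"] V2(2)[of t] zvB[of t] B0 by (simp add: v2_def)
  have cY1: "norm (Y1 t - (c * t) *\<^sub>R a) \<le> \<delta> * (c * t)" if t: "T \<le> t" "t \<le> T'" for t
  proof -
    have "norm (Y1 t - (c * t) *\<^sub>R a) \<le> norm (X1 t - (c * t) *\<^sub>R a) + norm ((1/2) *\<^sub>R z t)"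
      using norm_triangle_ineq[of "X1 t - (c * t) *\<^sub>R a" "(1/2) *\<^sub>R z t"] by (simp add: Y1_def algebra_simps)
    then show ?thesis using cone1[OF t] zW[OF t] WT[OF t(1)] by linarith
  qed
  have cY2: "norm (Y2 t - (c * t) *\<^sub>R a) \<le> \<delta> * (c * t)" if t: "T \<le> t" "t \<le> T'" for t
  proof -
    have "norm (Y2 t - (c * t) *\<^sub>R a) \<le> norm (X2 t - (c * t) *\<^sub>R a) + norm ((1/2) *\<^sub>R z t)"
      using norm_triangle_ineq4[of "X2 t - (c * t) *\<^sub>R a" "(1/2) *\<^sub>R z t"] by (simp add: Y2_def algebra_simps)
    then show ?thesis using cone2[OF t] zW[OF t] WT[OF t(1)] by linarith
  qed
  have half: "\<delta> / 2 * (c * t) \<le> \<delta> * (c * t)" if "T \<le> t" for t using mult_pos_pos[OF \<delta>_pos ct(1)[OF that]] by linarith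
  have cX1: "norm (X1 t - (c * t) *\<^sub>R a) \<le> \<delta> * (c * t)" if t: "T \<le> t" "t \<le> T'" for t
    using cone1[OF t] half[OF t(1)] by linarith
  have cX2: "norm (X2 t - (c * t) *\<^sub>R a) \<le> \<delta> * (c * t)" if t: "T \<le> t" "t \<le> T'" for t
    using cone2[OF t] half[OF t(1)] by linarith
  let ?f = "\<lambda>V Y t. 1/2 * (norm (V t))\<^sup>2 + u (Y t) + h"
  have aX1: "?f V1 X1 integrable_on {T..T'}" "act T T' X1 = ennreal (integral {T..T'} (?f V1 X1))"
    by (rule action_as_integral[OF T(1) V1]; use cX1 in blast)+
  have aX2: "?f V2 X2 integrable_on {T..T'}" "act T T' X2 = ennreal (integral {T..T'} (?f V2 X2))"
    by (rule action_as_integral[OF T(1) V2]; use cX2 in blast)+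
  have aY1: "?f v1 Y1 integrable_on {T..T'}" "act T T' Y1 = ennreal (integral {T..T'} (?f v1 Y1))"
    by (rule action_as_integral[OF T(1) vY1 v1B]; use cY1 in blast)+
  have aY2: "?f v2 Y2 integrable_on {T..T'}" "act T T' Y2 = ennreal (integral {T..T'} (?f v2 Y2))"
    by (rule action_as_integral[OF T(1) vY2 v2B]; use cY2 in blast)+
  have nn: "0 \<le> integral {T..T'} (?f V Y)" if "?f V Y integrable_on {T..T'}" for V Y
    by (rule integral_nonneg[OF that]) (use h_pos in \<open>auto intro!: add_nonneg_nonneg\<close>)
  have I1: "integral {T..T'} (?f V1 X1) \<le> integral {T..T'} (?f v1 Y1)"
  proof -
    have "act T T' X1 \<le> d (Y1 T) (Y1 T')" using min1 zT by (simp add: Y1_def)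
    also have "\<dots> \<le> act T T' Y1" by (rule jdist_le_action[OF velocity_bounded_AC[OF vY1 v1B] T(2)])
    finally have le: "act T T' X1 \<le> act T T' Y1" .
    show ?thesis by (rule iffD1[OF ennreal_le_iff[OF nn[OF aY1(1)]] le[unfolded aX1(2) aY1(2)]])
  qed
  have I2: "integral {T..T'} (?f V2 X2) \<le> integral {T..T'} (?f v2 Y2)"
  proof -
    have "act T T' X2 \<le> d (Y2 T) (Y2 T')" using min2 zT by (simp add: Y2_def)
    also have "\<dots> \<le> act T T' Y2" by (rule jdist_le_action[OF velocity_bounded_AC[OF vY2 v2B] T(2)])
    finally have le: "act T T' X2 \<le> act T T' Y2" .
    show ?thesis by (rule iffD1[OF ennreal_le_iff[OF nn[OF aY2(1)]] le[unfolded aX2(2) aY2(2)]])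
  qed
  have contz: "continuous_on {T..T'} z" by (rule AC_imp_continuous[OF velocity_bounded_AC[OF zv zvB]])
  obtain t0 where t0: "t0 \<in> {T..T'}" "\<And>t. t \<in> {T..T'} \<Longrightarrow> norm (z t) \<le> norm (z t0)"
    using continuous_attains_sup[OF compact_Icc _ continuous_on_norm[OF contz]] T by fastforce
  define Z where "Z = norm (z t0)"
  define Q where "Q = K * W / (c * T)^3"
  have cT: "0 < c * T" using ct(1)[of T] by simp
  have Q0: "0 \<le> Q" using K_pos W0 cT by (simp add: Q_def)
  have pw: "?f v1 Y1 t + ?f v2 Y2 t - ?f V1 X1 t - ?f V2 X2 t \<le> - 1/4 * (norm (zv t))\<^sup>2 - 1/2 * (e \<bullet> zv t) + Q * Z / 2"
    if t: "t \<in> {T..T'}" for t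
  proof -
    have t': "T \<le> t" "t \<le> T'" using t by auto
    have d: "V2 t = V1 t + zv t + e" by (simp add: zv_def)
    have kin: "1/2 * (norm (v1 t))\<^sup>2 + 1/2 * (norm (v2 t))\<^sup>2 - 1/2 * (norm (V1 t))\<^sup>2 - 1/2 * (norm (V2 t))\<^sup>2
      = - 1/4 * (norm (zv t))\<^sup>2 - 1/2 * (e \<bullet> zv t)"
      unfolding v1_def v2_def d power2_norm_eq_inner
      by (simp add: inner_add_left inner_add_right inner_commute algebra_simps)
    have X2Y: "Y2 t + (1/2) *\<^sub>R z t = X2 t" by (simp add: Y2_def)
    have "(u (X1 t + (1/2) *\<^sub>R z t) - u (X1 t)) - (u (Y2 t + (1/2) *\<^sub>R z t) - u (Y2 t))
      \<le> K * norm ((1/2) *\<^sub>R z t) * norm (X1 t - Y2 t) / (c * t)^3"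
      by (rule cone_second_difference[OF ct(1)[OF t'(1)]])
         (use cX1[OF t'] cY2[OF t'] cY1[OF t'] cX2[OF t'] X2Y in \<open>simp_all add: Y1_def\<close>)
    also have "\<dots> \<le> K * (Z / 2) * W / (c * T)^3"
    proof (rule frac_le)
      have "X1 t - Y2 t = - ((1/2) *\<^sub>R w t + (1/2) *\<^sub>R (w t - z t))"
      proof -
        have hw: "(1/2) *\<^sub>R w t + (1/2) *\<^sub>R w t = w t" by (simp flip: scaleR_add_left)
        have "X1 t - Y2 t = - (w t - (1/2) *\<^sub>R z t)" by (simp add: Y2_def w_def)
        also have "\<dots> = - ((1/2) *\<^sub>R w t + (1/2) *\<^sub>R w t - (1/2) *\<^sub>R z t)" by (simp only: hw)
        also have "\<dots> = - ((1/2) *\<^sub>R w t + (1/2) *\<^sub>R (w t - z t))" by (simp add: scaleR_diff_right)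
        finally show ?thesis .
      qed
      then have "norm (X1 t - Y2 t) \<le> 1/2 * norm (w t) + 1/2 * norm (w t - z t)"
        using norm_triangle_ineq[of "(1/2) *\<^sub>R w t" "(1/2) *\<^sub>R (w t - z t)"] by (simp add: norm_minus_cancel del: minus_add_distrib)
      also have "\<dots> \<le> W" using W(1)[OF t'] chord[OF t'] by (simp add: w_def)
      finally have nW: "norm (X1 t - Y2 t) \<le> W" .
      have nZ: "norm ((1/2) *\<^sub>R z t) \<le> Z / 2" using t0(2)[OF t] by (simp add: Z_def)
      show "K * norm ((1/2) *\<^sub>R z t) * norm (X1 t - Y2 t) \<le> K * (Z / 2) * W"
        by (rule mult_mono[OF mult_left_mono[OF nZ] nW]) (use K_pos in \<open>auto simp: Z_def\<close>)
      show "0 \<le> K * (Z / 2) * W" using K_pos W0 by (simp add: Z_def)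
      show "0 < (c * T)^3" using cT by simp
      show "(c * T)^3 \<le> (c * t)^3" using ct(2)[OF t'(1)] cT by (intro power_mono) auto
    qed
    also have "\<dots> = Q * Z / 2" by (simp add: Q_def mult_ac)
    finally have pot: "(u (Y1 t) - u (X1 t)) - (u (X2 t) - u (Y2 t)) \<le> Q * Z / 2" unfolding X2Y Y1_def .
    show ?thesis using kin pot by linarith
  qed
  have sq: "(\<lambda>t. (norm (zv t))\<^sup>2) integrable_on {T..T'}" by (rule velocity_norm_square_integrable[OF zv zvB])
  define I where "I = integral {T..T'} (\<lambda>t. (norm (zv t))\<^sup>2)"
  have "(zv has_integral 0) {T..T'}" using velocity_has_integral[OF zv order_refl T'0 order_refl] zT by simp
  from has_integral_linear[OF this bounded_linear_inner_right[of e]]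
  have ez: "((\<lambda>t. e \<bullet> zv t) has_integral 0) {T..T'}" by (simp add: o_def)
  have R: "((\<lambda>t. - 1/4 * (norm (zv t))\<^sup>2 - 1/2 * (e \<bullet> zv t) + Q * Z / 2) has_integral (- 1/4 * I - 1/2 * 0 + \<Delta> * (Q * Z / 2))) {T..T'}"
  proof (intro has_integral_add has_integral_diff has_integral_mult_right)
    show "((\<lambda>t. (norm (zv t))\<^sup>2) has_integral I) {T..T'}" unfolding I_def by (rule integrable_integral[OF sq])
    show "((\<lambda>t. e \<bullet> zv t) has_integral 0) {T..T'}" by (rule ez)
    show "((\<lambda>t. Q * Z / 2) has_integral \<Delta> * (Q * Z / 2)) {T..T'}"
      using has_integral_const_real[of "Q * Z / 2" T T'] T by (simp add: \<Delta>_def)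
  qed
  have Lh: "((\<lambda>t. ?f v1 Y1 t + ?f v2 Y2 t - ?f V1 X1 t - ?f V2 X2 t) has_integral
    (integral {T..T'} (?f v1 Y1) + integral {T..T'} (?f v2 Y2) - integral {T..T'} (?f V1 X1) - integral {T..T'} (?f V2 X2))) {T..T'}"
    by (intro has_integral_add has_integral_diff integrable_integral aX1(1) aX2(1) aY1(1) aY2(1))
  have "0 \<le> - 1/4 * I - 1/2 * 0 + \<Delta> * (Q * Z / 2)"
    using has_integral_le[OF Lh R pw] I1 I2 by linarith
  then have I: "I \<le> 2 * \<Delta> * Q * Z" by (simp add: algebra_simps)
  have ZQ: "Z \<le> 2 * \<Delta>\<^sup>2 * Q"
  proof (cases "Z = 0")
    case True
    then show ?thesis using Q0 by simp
  next
    case False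
    then have Z: "0 < Z" by (simp add: Z_def)
    \<comment> \<open>the weight in Young's inequality that balances the two terms\<close>
    define \<kappa> where "\<kappa> = Z / \<Delta>"
    have \<kappa>: "0 < \<kappa>" using Z \<Delta> by (simp add: \<kappa>_def)
    let ?g = "\<lambda>t. \<kappa> / 2 + (norm (zv t))\<^sup>2 / (2 * \<kappa>)"
    have gi: "(?g has_integral (\<Delta> * (\<kappa> / 2) + I / (2 * \<kappa>))) {T..T'}"
    proof (intro has_integral_add has_integral_divide)
      show "((\<lambda>t. (norm (zv t))\<^sup>2) has_integral I) {T..T'}" unfolding I_def by (rule integrable_integral[OF sq])
      show "((\<lambda>t. \<kappa> / 2) has_integral \<Delta> * (\<kappa> / 2)) {T..T'}"
        using has_integral_const_real[of "\<kappa> / 2" T T'] T by (simp add: \<Delta>_def)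
    qed
    then have gint: "?g integrable_on {T..T'}" by blast
    have gint0: "?g integrable_on {T..t0}" by (rule integrable_subinterval_real[OF gint]) (use t0 in auto)
    have zi: "(zv has_integral (z t0 - z T)) {T..t0}" by (rule velocity_has_integral[OF zv]) (use t0 in auto)
    have "Z = norm (integral {T..t0} zv)" using integral_unique[OF zi] zT by (simp add: Z_def)
    also have "\<dots> \<le> integral {T..t0} ?g"
    proof (rule integral_norm_bound_integral)
      show "zv integrable_on {T..t0}" using zi by blast
      show "?g integrable_on {T..t0}" by (rule gint0)
      fix t
      have "0 \<le> (\<kappa> - norm (zv t))\<^sup>2" by simp
      then have "2 * \<kappa> * norm (zv t) \<le> \<kappa>\<^sup>2 + (norm (zv t))\<^sup>2" by (simp add: power2_diff)
      then show "norm (zv t) \<le> ?g t" using \<kappa> by (simp add: field_simps power2_eq_square)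
    qed
    also have "\<dots> \<le> integral {T..T'} ?g"
      by (rule integral_subset_le[OF _ gint0 gint]) (use t0 \<kappa> in auto)
    also have "\<dots> = \<Delta> * (\<kappa> / 2) + I / (2 * \<kappa>)" using gi by (rule integral_unique)
    also have "\<dots> = Z / 2 + I * \<Delta> / (2 * Z)" using \<Delta> Z by (simp add: \<kappa>_def)
    also have "\<dots> \<le> Z / 2 + (2 * \<Delta> * Q * Z) * \<Delta> / (2 * Z)"
      using I \<Delta> Z by (intro add_left_mono divide_right_mono mult_right_mono) auto
    also have "\<dots> = Z / 2 + \<Delta>\<^sup>2 * Q" using Z by (simp add: power2_eq_square)
    finally show ?thesis by simp
  qed
  have "norm (z t) \<le> 2 * \<Delta>\<^sup>2 * Q" using t0(2)[of t] t ZQ by (simp add: Z_def)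
  moreover have "z t = (X2 t - X1 t) - (X2 T - X1 T) - ((t - T) / (T' - T)) *\<^sub>R ((X2 T' - X1 T') - (X2 T - X1 T))"
    by (simp add: z e_def w_def \<Delta>_def)
  ultimately show ?thesis by (simp add: Q_def \<Delta>_def mult.assoc)
qed

text \<open>In Newtonian time the two rays stay at bounded Euclidean distance.  The potentials along them then
  differ by \<open>O(1 / t^2)\<close>, which is integrable, so the two time changes differ by a bounded amount and
  the bound persists when both rays are parametrized by \<open>d\<close>.\<close>
lemma rays_bounded_distance:
  assumes ray1: "ray \<gamma>1" and ray2: "ray \<gamma>2"
    and dir1: "((\<lambda>s. norm (\<gamma>1 s - (s / c) *\<^sub>R a) / s) \<longlongrightarrow> 0) at_top"
    and dir2: "((\<lambda>s. norm (\<gamma>2 s - (s / c) *\<^sub>R a) / s) \<longlongrightarrow> 0) at_top"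
  shows "\<exists>B. \<forall>t\<ge>0. d (\<gamma>1 t) (\<gamma>2 t) \<le> ennreal B"
proof (rule newton_time[OF ray1 dir1], rule newton_time[OF ray2 dir2])
  fix \<sigma>1 \<sigma>2 :: "real \<Rightarrow> real" and L1 L2 :: real
  assume L1: "0 \<le> L1" and pos1: "\<And>t. 0 \<le> t \<Longrightarrow> 0 < \<sigma>1 t" and onto1: "\<And>s. \<sigma>1 0 \<le> s \<Longrightarrow> \<exists>t\<ge>0. \<sigma>1 t = s"
    and mono1: "\<And>t t'. 0 \<le> t \<Longrightarrow> t \<le> t' \<Longrightarrow> \<sigma>1 t \<le> \<sigma>1 t'"
    and der1: "\<And>t. 0 < t \<Longrightarrow> (\<sigma>1 has_real_derivative 2 * (u (\<gamma>1 (\<sigma>1 t)) + h)) (at t)"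
    and lip1: "\<And>t t'. 0 \<le> t \<Longrightarrow> t \<le> t' \<Longrightarrow> norm (\<gamma>1 (\<sigma>1 t') - \<gamma>1 (\<sigma>1 t)) \<le> L1 * (t' - t)"
    and min1: "\<And>T T'. 0 < T \<Longrightarrow> T \<le> T' \<Longrightarrow> act T T' (\<lambda>t. \<gamma>1 (\<sigma>1 t)) \<le> d (\<gamma>1 (\<sigma>1 T)) (\<gamma>1 (\<sigma>1 T'))"
    and asym1: "((\<lambda>t. norm (\<gamma>1 (\<sigma>1 t) - (c * t) *\<^sub>R a) / t) \<longlongrightarrow> 0) at_top"
  assume L2: "0 \<le> L2" and pos2: "\<And>t. 0 \<le> t \<Longrightarrow> 0 < \<sigma>2 t" and onto2: "\<And>s. \<sigma>2 0 \<le> s \<Longrightarrow> \<exists>t\<ge>0. \<sigma>2 t = s"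
    and mono2: "\<And>t t'. 0 \<le> t \<Longrightarrow> t \<le> t' \<Longrightarrow> \<sigma>2 t \<le> \<sigma>2 t'"
    and der2: "\<And>t. 0 < t \<Longrightarrow> (\<sigma>2 has_real_derivative 2 * (u (\<gamma>2 (\<sigma>2 t)) + h)) (at t)"
    and lip2: "\<And>t t'. 0 \<le> t \<Longrightarrow> t \<le> t' \<Longrightarrow> norm (\<gamma>2 (\<sigma>2 t') - \<gamma>2 (\<sigma>2 t)) \<le> L2 * (t' - t)"
    and min2: "\<And>T T'. 0 < T \<Longrightarrow> T \<le> T' \<Longrightarrow> act T T' (\<lambda>t. \<gamma>2 (\<sigma>2 t)) \<le> d (\<gamma>2 (\<sigma>2 T)) (\<gamma>2 (\<sigma>2 T'))"
    and asym2: "((\<lambda>t. norm (\<gamma>2 (\<sigma>2 t) - (c * t) *\<^sub>R a) / t) \<longlongrightarrow> 0) at_top"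
  define X1 where "X1 = (\<lambda>t. \<gamma>1 (\<sigma>1 t))"
  define X2 where "X2 = (\<lambda>t. \<gamma>2 (\<sigma>2 t))"
  define w where "w = (\<lambda>t. X2 t - X1 t)"
  \<comment> \<open>then \<open>w\<close> is at most \<open>\<delta> / 8 * (c * t)\<close>, hence at most \<open>\<delta> / 2 * (c * T)\<close> on \<open>[T, 4 T]\<close>\<close>
  have e: "0 < \<delta> / 16 * c" using \<delta>_pos c_pos by simp
  have "\<forall>\<^sub>F t in at_top. norm (X1 t - (c * t) *\<^sub>R a) / t < \<delta> / 16 * c \<and> norm (X2 t - (c * t) *\<^sub>R a) / t < \<delta> / 16 * c"
    unfolding X1_def X2_def by (intro eventually_conj order_tendstoD(2)[OF asym1 e] order_tendstoD(2)[OF asym2 e])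
  then obtain T1 where T1: "\<And>t. T1 \<le> t \<Longrightarrow> norm (X1 t - (c * t) *\<^sub>R a) / t < \<delta> / 16 * c \<and> norm (X2 t - (c * t) *\<^sub>R a) / t < \<delta> / 16 * c"
    unfolding eventually_at_top_linorder by blast
  define T0 where "T0 = max T1 1"
  have T0: "0 < T0" by (simp add: T0_def)
  have near: "norm (X1 t - (c * t) *\<^sub>R a) \<le> \<delta> / 16 * (c * t)" "norm (X2 t - (c * t) *\<^sub>R a) \<le> \<delta> / 16 * (c * t)" if "T0 \<le> t" for t
  proof -
    have "T1 \<le> t" "0 < t" using that by (auto simp: T0_def)
    then show "norm (X1 t - (c * t) *\<^sub>R a) \<le> \<delta> / 16 * (c * t)" "norm (X2 t - (c * t) *\<^sub>R a) \<le> \<delta> / 16 * (c * t)"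
      using T1[of t] by (auto simp: field_simps)
  qed
  have ct: "0 < c * t" if "T0 \<le> t" for t using that T0 c_pos by simp
  have scale: "\<delta> / 16 * (c * t) \<le> \<delta> / 2 * (c * t)" if "T0 \<le> t" for t
    using mult_pos_pos[OF \<delta>_pos ct[OF that]] by linarith
  have wlin: "norm (w t) \<le> \<delta> / 8 * (c * t)" if "T0 \<le> t" for t
    using norm_triangle_ineq4[of "X2 t - (c * t) *\<^sub>R a" "X1 t - (c * t) *\<^sub>R a"] near[OF that] by (simp add: w_def)
  define A where "A = 54 * K / c^3"
  have A: "0 \<le> A" using K_pos c_pos by (simp add: A_def)
  have block: "norm (3 *\<^sub>R w (2 * T) - 2 *\<^sub>R w T - w (4 * T)) \<le> A * W / T"
    if T: "T0 \<le> T" and W: "\<And>t. T \<le> t \<Longrightarrow> t \<le> 4 * T \<Longrightarrow> norm (w t) \<le> W" for T W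
  proof -
    have Tp: "0 < T" using T T0 by simp
    \<comment> \<open>the comparison needs \<open>W' \<le> \<delta> / 2 * (c * T)\<close>, which the cone provides up to time \<open>4 * T\<close>\<close>
    define W' where "W' = min W (\<delta> / 2 * (c * T))"
    define L where "L = max L1 L2"
    have LL: "0 \<le> L" "L1 \<le> L" "L2 \<le> L" using L1 by (auto simp: L_def)
    have l1: "norm (X1 t - X1 s) \<le> L * (t - s)" if "T \<le> s" "s \<le> t" "t \<le> 4 * T" for s t
      using lip1[of s t] mult_right_mono[OF LL(2), of "t - s"] that Tp by (simp add: X1_def)
    have l2: "norm (X2 t - X2 s) \<le> L * (t - s)" if "T \<le> s" "s \<le> t" "t \<le> 4 * T" for s t
      using lip2[of s t] mult_right_mono[OF LL(3), of "t - s"] that Tp by (simp add: X2_def)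
    have c1: "norm (X1 t - (c * t) *\<^sub>R a) \<le> \<delta> / 2 * (c * t)" if "T \<le> t" "t \<le> 4 * T" for t
      using near(1)[of t] scale[of t] that T by linarith
    have c2: "norm (X2 t - (c * t) *\<^sub>R a) \<le> \<delta> / 2 * (c * t)" if "T \<le> t" "t \<le> 4 * T" for t
      using near(2)[of t] scale[of t] that T by linarith
    have wW: "norm (X2 t - X1 t) \<le> W'" if "T \<le> t" "t \<le> 4 * T" for t
    proof -
      have "\<delta> / 8 * (c * t) \<le> \<delta> / 8 * (c * (4 * T))"
        using that \<delta>_pos c_pos by (intro mult_left_mono) auto
      also have "\<delta> / 8 * (c * (4 * T)) = \<delta> / 2 * (c * T)" by simp
      finally have "norm (w t) \<le> \<delta> / 2 * (c * T)" using wlin[of t] that T by linarith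
      then show ?thesis using W[OF that] by (simp add: W'_def w_def)
    qed
    have "norm ((X2 (2 * T) - X1 (2 * T)) - (X2 T - X1 T) - ((2 * T - T) / (4 * T - T)) *\<^sub>R ((X2 (4 * T) - X1 (4 * T)) - (X2 T - X1 T)))
      \<le> 2 * (4 * T - T)\<^sup>2 * K * W' / (c * T)^3"
    proof (rule pair_comparison[OF Tp _ LL(1) l1 l2 _ _ c1 c2 wW])
      show "act T (4 * T) X1 \<le> d (X1 T) (X1 (4 * T))" unfolding X1_def by (rule min1) (use Tp in auto)
      show "act T (4 * T) X2 \<le> d (X2 T) (X2 (4 * T))" unfolding X2_def by (rule min2) (use Tp in auto)
    qed (use Tp in \<open>simp_all add: W'_def\<close>)
    also have "(2 * T - T) / (4 * T - T) = 1 / 3" using Tp by simp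
    also have "2 * (4 * T - T)\<^sup>2 * K * W' / (c * T)^3 = A / 3 * W' / T"
      using Tp c_pos by (simp add: A_def power2_eq_square power3_eq_cube)
    finally have z: "norm (w (2 * T) - w T - (1/3) *\<^sub>R (w (4 * T) - w T)) \<le> A / 3 * W' / T" by (simp add: w_def)
    have "3 *\<^sub>R (w (2 * T) - w T - (1/3) *\<^sub>R (w (4 * T) - w T)) = 3 *\<^sub>R w (2 * T) - 2 *\<^sub>R w T - w (4 * T)"
    proof -
      have "3 *\<^sub>R w T = 2 *\<^sub>R w T + w T" using scaleR_add_left[of 2 1 "w T"] by simp
      then show ?thesis by (simp add: scaleR_diff_right)
    qed
    then have "norm (3 *\<^sub>R w (2 * T) - 2 *\<^sub>R w T - w (4 * T)) = 3 * norm (w (2 * T) - w T - (1/3) *\<^sub>R (w (4 * T) - w T))"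
      by (metis abs_numeral norm_scaleR)
    also have "\<dots> \<le> 3 * (A / 3 * W' / T)" using z by simp
    also have "\<dots> = A * W' / T" by simp
    also have "\<dots> \<le> A * W / T" using A Tp by (intro divide_right_mono mult_left_mono) (auto simp: W'_def)
    finally show ?thesis .
  qed
  have sub: "((\<lambda>t. norm (w t) / t) \<longlongrightarrow> 0) at_top"
  proof (rule tendsto_sandwich[OF _ _ tendsto_const tendsto_add_zero[OF asym2 asym1]])
    show "\<forall>\<^sub>F t in at_top. 0 \<le> norm (w t) / t" using eventually_ge_at_top[of 0] by eventually_elim simp
    show "\<forall>\<^sub>F t in at_top. norm (w t) / t \<le> norm (\<gamma>2 (\<sigma>2 t) - (c * t) *\<^sub>R a) / t + norm (\<gamma>1 (\<sigma>1 t) - (c * t) *\<^sub>R a) / t"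
      using eventually_gt_at_top[of 0]
    proof eventually_elim
      case (elim t)
      have "norm (w t) \<le> norm (\<gamma>2 (\<sigma>2 t) - (c * t) *\<^sub>R a) + norm (\<gamma>1 (\<sigma>1 t) - (c * t) *\<^sub>R a)"
        using norm_triangle_ineq4[of "X2 t - (c * t) *\<^sub>R a" "X1 t - (c * t) *\<^sub>R a"] by (simp add: w_def X1_def X2_def)
      then show ?case unfolding add_divide_distrib[symmetric] using elim by (intro divide_right_mono) auto
    qed
  qed
  have lin: "norm (w t) \<le> (\<delta> / 8 * c) * t" if "T0 \<le> t" for t using wlin[OF that] by simp
  from sublinear_bounded[OF T0 A block sub lin]
  have "\<exists>B. \<forall>t\<ge>T0. norm (w t) \<le> B" by blast
  then obtain B where B: "\<And>t. T0 \<le> t \<Longrightarrow> norm (w t) \<le> B" by blast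
  have B0: "0 \<le> B" using order_trans[OF norm_ge_zero B[OF order_refl]] .
  have full: "\<delta> / 16 * (c * t) \<le> \<delta> * (c * t)" if "T0 \<le> t" for t
    using mult_pos_pos[OF \<delta>_pos ct[OF that]] by linarith
  have cone: "norm (X1 t - (c * t) *\<^sub>R a) \<le> \<delta> * (c * t)" "norm (X2 t - (c * t) *\<^sub>R a) \<le> \<delta> * (c * t)" if "T0 \<le> t" for t
    using near[OF that] full[OF that] by linarith+
  \<comment> \<open>up to the sign, \<open>k / t\<close> is a primitive of the bound on the derivative of \<open>D\<close>\<close>
  define k where "k = 2 * K * B / c\<^sup>2"
  have k: "0 \<le> k" using K_pos B0 by (simp add: k_def)
  have du: "\<bar>2 * (u (X1 t) + h) - 2 * (u (X2 t) + h)\<bar> \<le> k / t\<^sup>2" if t: "T0 \<le> t" for t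
  proof -
    have "\<bar>u (X1 t) - u (X2 t)\<bar> \<le> K * norm (X1 t - X2 t) / (c * t)\<^sup>2"
      by (rule cone_lipschitz[OF ct[OF t] cone[OF t]])
    also have "\<dots> \<le> K * B / (c * t)\<^sup>2"
      using B[OF t] K_pos by (intro divide_right_mono mult_left_mono) (auto simp: w_def norm_minus_commute)
    finally have "2 * \<bar>u (X1 t) - u (X2 t)\<bar> \<le> 2 * (K * B / (c * t)\<^sup>2)" by simp
    moreover have "2 * (u (X1 t) + h) - 2 * (u (X2 t) + h) = 2 * (u (X1 t) - u (X2 t))" by simp
    moreover have "k / t\<^sup>2 = 2 * (K * B / (c * t)\<^sup>2)" by (simp add: k_def power_mult_distrib)
    ultimately show ?thesis by (simp only: abs_mult abs_numeral)
  qed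
  define D where "D = (\<lambda>t. \<sigma>1 t - \<sigma>2 t)"
  have derD: "(D has_real_derivative 2 * (u (X1 t) + h) - 2 * (u (X2 t) + h)) (at t)" if "T0 \<le> t" for t
    unfolding D_def X1_def X2_def by (rule DERIV_diff) (use der1 der2 that T0 in auto)
  have derk: "((\<lambda>t. k / t) has_real_derivative - (k / t\<^sup>2)) (at t)" if "T0 \<le> t" for t
    using that T0 by (auto intro!: derivative_eq_intros simp: power2_eq_square)
  have Dbound: "\<bar>D t\<bar> \<le> \<bar>D T0\<bar> + k / T0" if t: "T0 \<le> t" for t
  proof -
    have "D t + k / t \<le> D T0 + k / T0"
    proof (rule DERIV_nonpos_imp_nonincreasing[OF t])
      fix x assume x: "T0 \<le> x" "x \<le> t"
      show "\<exists>y. ((\<lambda>t. D t + k / t) has_real_derivative y) (at x) \<and> y \<le> 0"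
        by (rule exI, rule conjI, rule DERIV_add[OF derD[OF x(1)] derk[OF x(1)]]) (use du[OF x(1)] in linarith)
    qed
    moreover have "D T0 - k / T0 \<le> D t - k / t"
    proof (rule DERIV_nonneg_imp_nondecreasing[OF t])
      fix x assume x: "T0 \<le> x" "x \<le> t"
      show "\<exists>y. ((\<lambda>t. D t - k / t) has_real_derivative y) (at x) \<and> 0 \<le> y"
        by (rule exI, rule conjI, rule DERIV_diff[OF derD[OF x(1)] derk[OF x(1)]]) (use du[OF x(1)] in linarith)
    qed
    moreover have "0 \<le> k / t" using k t T0 by simp
    ultimately show ?thesis by linarith
  qed
  define B1 where "B1 = (c + C / (c * T0) / c) * B"
  have B1: "0 \<le> B1" using C_pos c_pos T0 B0 by (simp add: B1_def)
  have dX: "d (X1 t) (X2 t) \<le> ennreal B1" if t: "T0 \<le> t" for t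
  proof -
    have "d (X1 t) (X2 t) \<le> ennreal ((c + C / (c * T0) / c) * norm (X2 t - X1 t))"
    proof (rule jdist_bounded_segment)
      show "0 \<le> C / (c * T0)" using C_pos c_pos T0 by simp
      fix x assume "x \<in> closed_segment (X1 t) (X2 t)"
      moreover have "closed_segment (X1 t) (X2 t) \<subseteq> cball ((c * t) *\<^sub>R a) (\<delta> * (c * t))"
        by (rule closed_segment_subset) (use cone[OF t] in \<open>auto simp: dist_norm norm_minus_commute\<close>)
      ultimately have "norm (x - (c * t) *\<^sub>R a) \<le> \<delta> * (c * t)" by (auto simp: dist_norm norm_minus_commute)
      then have "U x \<le> ennreal (C / (c * t))" by (rule cone_bound[OF ct[OF t]])
      also have "\<dots> \<le> ennreal (C / (c * T0))"
        using C_pos c_pos T0 t by (intro ennreal_leI divide_left_mono) auto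
      finally show "U x \<le> ennreal (C / (c * T0))" .
    qed
    also have "\<dots> \<le> ennreal B1"
      unfolding B1_def using B[OF t] C_pos c_pos T0 by (intro ennreal_leI mult_left_mono) (auto simp: w_def)
    finally show ?thesis .
  qed
  define B2 where "B2 = B1 + (\<bar>D T0\<bar> + k / T0)"
  have kT: "0 \<le> \<bar>D T0\<bar> + k / T0" using k T0 by simp
  have B2: "0 \<le> B2" using B1 kT by (simp add: B2_def)
  define S where "S = \<sigma>1 T0"
  have S: "0 < S" using pos1 T0 by (simp add: S_def)
  have far: "d (\<gamma>1 s) (\<gamma>2 s) \<le> ennreal B2" if s: "S \<le> s" for s
  proof -
    have "\<exists>t\<ge>T0. \<sigma>1 t = s"
    proof (cases "s = S")
      case True
      then show ?thesis by (auto simp: S_def)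
    next
      case False
      obtain t where t: "0 \<le> t" "\<sigma>1 t = s" using onto1[of s] mono1[of 0 T0] T0 s by (auto simp: S_def)
      have "T0 \<le> t" using mono1[OF t(1), of T0] t(2) False s by (cases "T0 \<le> t") (auto simp: S_def)
      then show ?thesis using t by blast
    qed
    then obtain t where t: "T0 \<le> t" "\<sigma>1 t = s" by blast
    have "d (\<gamma>1 s) (\<gamma>2 s) \<le> d (\<gamma>1 s) (\<gamma>2 (\<sigma>2 t)) + d (\<gamma>2 (\<sigma>2 t)) (\<gamma>2 s)" by (rule jdist_triangle)
    also have "d (\<gamma>1 s) (\<gamma>2 (\<sigma>2 t)) = d (X1 t) (X2 t)" using t by (simp add: X1_def X2_def)
    also have "d (\<gamma>2 (\<sigma>2 t)) (\<gamma>2 s) = ennreal \<bar>D t\<bar>"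
      using rayD[OF ray2, of "\<sigma>2 t" s] pos2[of t] t T0 s S by (simp add: D_def)
    also have "d (X1 t) (X2 t) + ennreal \<bar>D t\<bar> \<le> ennreal B1 + ennreal (\<bar>D T0\<bar> + k / T0)"
      using dX[OF t(1)] Dbound[OF t(1)] by (intro add_mono ennreal_leI)
    also have "\<dots> = ennreal B2" using B1 kT by (simp add: B2_def ennreal_plus)
    finally show ?thesis .
  qed
  show ?thesis
  proof (intro exI allI impI)
    fix s :: real assume s: "0 \<le> s"
    show "d (\<gamma>1 s) (\<gamma>2 s) \<le> ennreal (S + B2 + S)"
    proof (cases "S \<le> s")
      case True
      then show ?thesis using far[OF True] S B2 by (meson ennreal_leI order_trans add_increasing add_increasing2 less_imp_le order_refl)
    next
      case False
      have "d (\<gamma>1 s) (\<gamma>2 s) \<le> d (\<gamma>1 s) (\<gamma>1 S) + (d (\<gamma>1 S) (\<gamma>2 S) + d (\<gamma>2 S) (\<gamma>2 s))"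
        by (rule order_trans[OF jdist_triangle add_left_mono[OF jdist_triangle]])
      also have "\<dots> \<le> ennreal S + (ennreal B2 + ennreal S)"
        using rayD[OF ray1, of s S] rayD[OF ray2, of S s] far[of S] s S False
        by (intro add_mono) (auto intro!: ennreal_leI)
      also have "\<dots> = ennreal (S + B2 + S)" using S B2 by (simp flip: ennreal_plus add: add.assoc)
      finally show ?thesis .
    qed
  qed
qed

end

section \<open>The Newtonian potential near a direction without collisions\<close>

text \<open>The field is the gradient of the kernel \<open>1 / norm r\<close> up to the sign.\<close>
lemma inverse_cube_lipschitz:
  fixes r q :: "'e::euclidean_space"
  assumes \<rho>: "0 < \<rho>" "\<rho> \<le> norm r" "\<rho> \<le> norm q"
  shows "norm ((1 / norm r ^ 3) *\<^sub>R r - (1 / norm q ^ 3) *\<^sub>R q) \<le> 4 * norm (r - q) / \<rho> ^ 3"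
proof -
  define x y where "x = norm r" and "y = norm q"
  have xy: "\<rho> \<le> x" "\<rho> \<le> y" "0 < x" "0 < y" using \<rho> by (auto simp: x_def y_def)
  have "(1 / x ^ 3) *\<^sub>R r - (1 / y ^ 3) *\<^sub>R q = (1 / x ^ 3) *\<^sub>R (r - q) + (1 / x ^ 3 - 1 / y ^ 3) *\<^sub>R q"
    by (simp add: algebra_simps)
  then have "norm ((1 / x ^ 3) *\<^sub>R r - (1 / y ^ 3) *\<^sub>R q) \<le> norm ((1 / x ^ 3) *\<^sub>R (r - q)) + norm ((1 / x ^ 3 - 1 / y ^ 3) *\<^sub>R q)"
    by (metis norm_triangle_ineq)
  also have "norm ((1 / x ^ 3) *\<^sub>R (r - q)) = norm (r - q) * (1 / x ^ 3)" using xy by simp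
  also have "\<dots> \<le> norm (r - q) * (1 / \<rho> ^ 3)"
    using xy \<rho> by (intro mult_left_mono divide_left_mono power_mono) auto
  also have "norm ((1 / x ^ 3 - 1 / y ^ 3) *\<^sub>R q) = \<bar>1 / x ^ 3 - 1 / y ^ 3\<bar> * y" by (simp add: y_def)
  also have "1 / x ^ 3 - 1 / y ^ 3 = (y - x) * ((y * y + y * x + x * x) / (x ^ 3 * y ^ 3))"
    using xy by (simp add: field_simps power3_eq_cube)
  also have "\<bar>(y - x) * ((y * y + y * x + x * x) / (x ^ 3 * y ^ 3))\<bar> * y
    = \<bar>y - x\<bar> * ((y * y + y * x + x * x) / (x ^ 3 * y ^ 3) * y)"
    using xy by (simp add: abs_mult)
  also have "(y * y + y * x + x * x) / (x ^ 3 * y ^ 3) * y = 1 / (x * x * x) + 1 / (x * x * y) + 1 / (x * y * y)"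
    using xy by (simp add: field_simps power3_eq_cube)
  also have "\<bar>y - x\<bar> * (1 / (x * x * x) + 1 / (x * x * y) + 1 / (x * y * y)) \<le> norm (r - q) * (1 / \<rho> ^ 3 + 1 / \<rho> ^ 3 + 1 / \<rho> ^ 3)"
  proof (rule mult_mono)
    show "\<bar>y - x\<bar> \<le> norm (r - q)" unfolding x_def y_def using norm_triangle_ineq3[of q r] by (simp add: norm_minus_commute)
    have le: "1 / (p * p' * p'') \<le> 1 / \<rho> ^ 3" if "\<rho> \<le> p" "\<rho> \<le> p'" "\<rho> \<le> p''" for p p' p''
    proof -
      have "\<rho> * \<rho> * \<rho> \<le> p * p' * p''" using that \<rho> by (intro mult_mono) auto
      then show ?thesis using \<rho> that by (intro divide_left_mono) (auto simp: power3_eq_cube intro!: mult_pos_pos)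
    qed
    show "1 / (x * x * x) + 1 / (x * x * y) + 1 / (x * y * y) \<le> 1 / \<rho> ^ 3 + 1 / \<rho> ^ 3 + 1 / \<rho> ^ 3"
      using xy by (intro add_mono le)
  qed (use xy in auto)
  finally show ?thesis by (simp add: x_def y_def)
qed

text \<open>Mean value theorem along the segments in direction \<open>v\<close>, which have to avoid the singularity.\<close>
lemma newton_kernel_second_difference:
  fixes r q v :: "'e::euclidean_space"
  assumes \<rho>: "0 < \<rho>" and far: "\<And>\<theta>. 0 \<le> \<theta> \<Longrightarrow> \<theta> \<le> 1 \<Longrightarrow> \<rho> \<le> norm (r + \<theta> *\<^sub>R v) \<and> \<rho> \<le> norm (q + \<theta> *\<^sub>R v)"
  shows "(1 / norm (r + v) - 1 / norm r) - (1 / norm (q + v) - 1 / norm q) \<le> 4 * norm v * norm (r - q) / \<rho> ^ 3"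
proof -
  define F where "F = (\<lambda>\<theta>. 1 / norm (r + \<theta> *\<^sub>R v) - 1 / norm (q + \<theta> *\<^sub>R v))"
  define F' where "F' = (\<lambda>\<theta>. - ((1 / norm (r + \<theta> *\<^sub>R v) ^ 3) *\<^sub>R (r + \<theta> *\<^sub>R v) - (1 / norm (q + \<theta> *\<^sub>R v) ^ 3) *\<^sub>R (q + \<theta> *\<^sub>R v)) \<bullet> v)"
  have der1: "((\<lambda>\<theta>. 1 / norm (p + \<theta> *\<^sub>R v)) has_real_derivative - (((1 / norm (p + \<theta> *\<^sub>R v) ^ 3) *\<^sub>R (p + \<theta> *\<^sub>R v)) \<bullet> v)) (at \<theta>)"
    if p: "0 < norm (p + \<theta> *\<^sub>R v)" for p \<theta>
  proof -
    define n where "n = (\<lambda>\<theta>. p \<bullet> p + 2 * \<theta> * (p \<bullet> v) + \<theta> * \<theta> * (v \<bullet> v))"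
    have n: "n \<theta> = (norm (p + \<theta> *\<^sub>R v))\<^sup>2" for \<theta>
      by (simp add: n_def power2_norm_eq_inner inner_add_left inner_add_right inner_commute algebra_simps)
    have sq: "norm (p + \<theta> *\<^sub>R v) = sqrt (n \<theta>)" for \<theta> by (simp add: n)
    have np: "0 < n \<theta>" using p by (simp add: n)
    have "((\<lambda>\<theta>. sqrt (n \<theta>)) has_real_derivative (inverse (sqrt (n \<theta>)) / 2) * (2 * (p \<bullet> v) + 2 * \<theta> * (v \<bullet> v))) (at \<theta>)"
    proof (rule DERIV_chain2[where f=sqrt and g=n, OF DERIV_real_sqrt[OF np]])
      show "(n has_real_derivative 2 * (p \<bullet> v) + 2 * \<theta> * (v \<bullet> v)) (at \<theta>)"
        unfolding n_def by (auto intro!: derivative_eq_intros)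
    qed
    then have "((\<lambda>\<theta>. norm (p + \<theta> *\<^sub>R v)) has_real_derivative ((p + \<theta> *\<^sub>R v) \<bullet> v) / norm (p + \<theta> *\<^sub>R v)) (at \<theta>)"
      unfolding sq
    proof (rule DERIV_cong)
      have *: "2 * (p \<bullet> v) + 2 * \<theta> * (v \<bullet> v) = 2 * ((p + \<theta> *\<^sub>R v) \<bullet> v)"
        by (simp only: inner_add_left inner_scaleR_left distrib_left mult.assoc)
      have **: "inverse s / 2 * (2 * y) = y / s" for s y :: real by (cases "s = 0") (auto simp: field_simps)
      show "inverse (sqrt (n \<theta>)) / 2 * (2 * (p \<bullet> v) + 2 * \<theta> * (v \<bullet> v)) = ((p + \<theta> *\<^sub>R v) \<bullet> v) / sqrt (n \<theta>)"
        unfolding * by (rule **)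
    qed
    then have "((\<lambda>\<theta>. 1 / norm (p + \<theta> *\<^sub>R v)) has_real_derivative
      (0 * norm (p + \<theta> *\<^sub>R v) - 1 * (((p + \<theta> *\<^sub>R v) \<bullet> v) / norm (p + \<theta> *\<^sub>R v))) / (norm (p + \<theta> *\<^sub>R v) * norm (p + \<theta> *\<^sub>R v))) (at \<theta>)"
      by (intro DERIV_divide DERIV_const) (use p in auto)
    moreover have "(0 * x - 1 * (y / x)) / (x * x) = - (1 / x ^ 3 * y)" if "0 < x" for x y :: real
      using that by (simp add: field_simps power3_eq_cube)
    ultimately show ?thesis unfolding inner_scaleR_left using p by (simp only: )
  qed
  have der: "(F has_real_derivative F' \<theta>) (at \<theta>)" if "0 \<le> \<theta>" "\<theta> \<le> 1" for \<theta>
  proof -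
    have "0 < norm (r + \<theta> *\<^sub>R v)" "0 < norm (q + \<theta> *\<^sub>R v)" using far[OF that] \<rho> by linarith+
    from DERIV_diff[OF der1[OF this(1)] der1[OF this(2)]] show ?thesis
      unfolding F_def by (rule DERIV_cong) (simp add: F'_def inner_diff_left)
  qed
  obtain \<xi> where \<xi>: "0 < \<xi>" "\<xi> < 1" "F 1 - F 0 = (1 - 0) * F' \<xi>"
    using MVT2[of 0 1 F F'] der by auto
  have "F' \<xi> \<le> norm ((1 / norm (r + \<xi> *\<^sub>R v) ^ 3) *\<^sub>R (r + \<xi> *\<^sub>R v) - (1 / norm (q + \<xi> *\<^sub>R v) ^ 3) *\<^sub>R (q + \<xi> *\<^sub>R v)) * norm v"
    unfolding F'_def by (rule order_trans[OF norm_cauchy_schwarz]) (simp only: norm_minus_cancel order_refl)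
  also have "\<dots> \<le> (4 * norm ((r + \<xi> *\<^sub>R v) - (q + \<xi> *\<^sub>R v)) / \<rho> ^ 3) * norm v"
    by (intro mult_right_mono inverse_cube_lipschitz) (use far[of \<xi>] \<xi> \<rho> in auto)
  finally show ?thesis using \<xi>(3) by (simp add: F_def mult_ac)
qed

text \<open>An isometry from the mass norm to the library norm; \<open>mass_unscale\<close> is its inverse for positive masses.\<close>
definition mass_scale :: "('n::finite \<Rightarrow> real) \<Rightarrow> ('e::euclidean_space, 'n) config \<Rightarrow> ('e, 'n) config"
  where "mass_scale m x = (\<chi> i. sqrt (m i) *\<^sub>R x $ i)"

definition mass_unscale :: "('n::finite \<Rightarrow> real) \<Rightarrow> ('e::euclidean_space, 'n) config \<Rightarrow> ('e, 'n) config"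
  where "mass_unscale m y = (\<chi> i. (1 / sqrt (m i)) *\<^sub>R y $ i)"

definition scaled_potential :: "('n::{finite,linorder} \<Rightarrow> real) \<Rightarrow> ('e::euclidean_space, 'n) config \<Rightarrow> ennreal"
  where "scaled_potential m y = newton_potential m (mass_unscale m y)"

lemma bounded_linear_mass_scale: "bounded_linear (mass_scale m)" "bounded_linear (mass_unscale m)"
  by (simp_all add: linear_conv_bounded_linear[symmetric] linear_iff mass_scale_def mass_unscale_def vec_eq_iff scaleR_add_right)

lemma mass_scale_inverse:
  assumes "\<And>i. m i > 0"
  shows "mass_unscale m (mass_scale m x) = x" "mass_scale m (mass_unscale m y) = y"
  using assms by (simp_all add: mass_scale_def mass_unscale_def vec_eq_iff less_imp_neq[symmetric])

lemma mass_norm_scale: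
  assumes "\<And>i. m i > 0"
  shows "mass_norm m x = norm (mass_scale m x)"
proof -
  have "m i * (x $ i \<bullet> x $ i) = (norm (mass_scale m x $ i))\<^sup>2" for i
    using assms[of i] by (simp add: mass_scale_def power_mult_distrib power2_norm_eq_inner)
  then show ?thesis by (simp add: mass_norm_def mass_inner_def norm_vec_def L2_set_def)
qed

lemma newton_potential_measurable: "newton_potential m \<in> borel_measurable (borel :: ('e::euclidean_space, 'n::{finite,linorder}) config measure)"
proof -
  have [measurable]: "(\<lambda>x :: ('e, 'n) config. x $ i) \<in> borel_measurable borel" for i
    by (intro borel_measurable_continuous_onI continuous_intros)
  show ?thesis unfolding newton_potential_def split_beta by measurable
qed

lemma scaled_potential_measurable: "scaled_potential m \<in> borel_measurable borel"
proof -
  have "mass_unscale m \<in> borel_measurable borel"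
    by (rule borel_measurable_continuous_onI[OF linear_continuous_on[OF bounded_linear_mass_scale(2)]])
  then show ?thesis unfolding scaled_potential_def by (rule measurable_compose[OF _ newton_potential_measurable])
qed

lemma AC_bounded_linear:
  assumes "bounded_linear f" "absolutely_continuous_curve a b \<gamma>"
  shows "absolutely_continuous_curve a b (\<lambda>t. f (\<gamma> t))"
proof -
  obtain L where L: "0 < L" "\<And>x. norm (f x) \<le> norm x * L"
    using bounded_linear.pos_bounded[OF assms(1)] by blast
  show ?thesis
  proof (rule AC_dominated[OF assms(2), of L])
    fix s t :: real assume "s \<le> t"
    have "dist (f (\<gamma> s)) (f (\<gamma> t)) \<le> dist (\<gamma> s) (\<gamma> t) * L"
      using L(2)[of "\<gamma> s - \<gamma> t"] by (simp add: dist_norm linear_diff[OF bounded_linear.linear[OF assms(1)]])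
    also have "\<dots> \<le> L * (dist (\<gamma> s) (\<gamma> t) + (t - s))" using L(1) \<open>s \<le> t\<close> by (simp add: algebra_simps)
    finally show "dist (f (\<gamma> s)) (f (\<gamma> t)) \<le> L * (dist (\<gamma> s) (\<gamma> t) + (t - s))" .
  qed (use L in simp)
qed

text \<open>At times without derivative the two integrands are unrelated, but these times form a null set.\<close>
lemma JM_action_scaled:
  fixes \<gamma> :: "real \<Rightarrow> ('e::euclidean_space, 'n::{finite,linorder}) config"
  assumes m: "\<And>i. m i > 0" and ac: "absolutely_continuous_curve a b \<gamma>" and ab: "a \<le> b"
  shows "JM_action m h a b \<gamma> = action (scaled_potential m) h a b (\<lambda>t. mass_scale m (\<gamma> t))"
proof -
  obtain g where g: "velocity a b \<gamma> g" using AC_velocity[OF ac ab] by blast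
  then obtain N where N: "negligible N" "\<And>t. a < t \<Longrightarrow> t < b \<Longrightarrow> t \<notin> N \<Longrightarrow> (\<gamma> has_vector_derivative g t) (at t)"
    unfolding velocity_def by blast
  have v: "velocity a b (\<lambda>t. mass_scale m (\<gamma> t)) (\<lambda>t. mass_scale m (g t))"
    by (rule velocityI[OF AC_bounded_linear[OF bounded_linear_mass_scale(1) ac] ab N(1)])
       (rule bounded_linear.has_vector_derivative[OF bounded_linear_mass_scale(1) N(2)])
  have "negligible (insert a (insert b N))" using N(1) by simp
  then have "AE t in lebesgue. t \<notin> insert a (insert b N)"
    by (intro AE_not_in) (simp only: negligible_iff_null_sets)
  then have "AE t in lebesgue. (ennreal (1/2 * (mass_norm m (vector_derivative \<gamma> (at t within {a..b})))\<^sup>2) + newton_potential m (\<gamma> t) + ennreal h) * indicator {a..b} t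
    = lagrangian (scaled_potential m) h (\<lambda>t. mass_scale m (\<gamma> t)) (\<lambda>t. mass_scale m (g t)) t * indicator {a..b} t"
  proof eventually_elim
    case (elim t)
    show ?case
    proof (cases "t \<in> {a..b}")
      case True
      then have t: "a < t" "t < b" "t \<notin> N" using elim by auto
      have "vector_derivative \<gamma> (at t within {a..b}) = g t"
        using vector_derivative_at[OF N(2)[OF t]] t by (simp add: at_within_Icc_at)
      then show ?thesis
        by (simp add: lagrangian_def scaled_potential_def mass_scale_inverse[OF m] mass_norm_scale[OF m])
    qed simp
  qed
  then show ?thesis
    unfolding JM_action_def action_velocity[OF v]
    by (subst nn_integral_restrict_space) (auto intro!: nn_integral_cong_AE)
qed

lemma JM_dist_scaled:
  fixes x y :: "('e::euclidean_space, 'n::{finite,linorder}) config"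
  assumes m: "\<And>i. m i > 0"
  shows "JM_dist m h x y = jdist (scaled_potential m) h (mass_scale m x) (mass_scale m y)"
  unfolding JM_dist_def jdist_def
proof (rule arg_cong[where f=Inf], intro equalityI subsetI)
  fix r assume "r \<in> {JM_action m h a b \<gamma> | a b \<gamma>. a < b \<and> absolutely_continuous_curve a b \<gamma> \<and> \<gamma> a = x \<and> \<gamma> b = y}"
  then obtain a b \<gamma> where A: "r = JM_action m h a b \<gamma>" "a < b" "absolutely_continuous_curve a b \<gamma>" "\<gamma> a = x" "\<gamma> b = y" by blast
  have "r = action (scaled_potential m) h a b (\<lambda>t. mass_scale m (\<gamma> t))"
    unfolding A(1) by (rule JM_action_scaled[OF m A(3)]) (use A in simp)
  then show "r \<in> {action (scaled_potential m) h a b \<gamma> | a b \<gamma>. a < b \<and> absolutely_continuous_curve a b \<gamma> \<and> \<gamma> a = mass_scale m x \<and> \<gamma> b = mass_scale m y}"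
    using A AC_bounded_linear[OF bounded_linear_mass_scale(1) A(3)] by blast
next
  fix r assume "r \<in> {action (scaled_potential m) h a b \<gamma> | a b \<gamma>. a < b \<and> absolutely_continuous_curve a b \<gamma> \<and> \<gamma> a = mass_scale m x \<and> \<gamma> b = mass_scale m y}"
  then obtain a b \<gamma> where A: "r = action (scaled_potential m) h a b \<gamma>" "a < b" "absolutely_continuous_curve a b \<gamma>" "\<gamma> a = mass_scale m x" "\<gamma> b = mass_scale m y" by blast
  define \<eta> where "\<eta> = (\<lambda>t. mass_unscale m (\<gamma> t))"
  have ac: "absolutely_continuous_curve a b \<eta>" unfolding \<eta>_def by (rule AC_bounded_linear[OF bounded_linear_mass_scale(2) A(3)])
  have "JM_action m h a b \<eta> = r"
    unfolding A(1) by (subst JM_action_scaled[OF m ac]) (use A in \<open>simp_all add: \<eta>_def mass_scale_inverse[OF m]\<close>)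
  moreover have "\<eta> a = x" "\<eta> b = y" using A by (simp_all add: \<eta>_def mass_scale_inverse[OF m])
  ultimately show "r \<in> {JM_action m h a b \<gamma> | a b \<gamma>. a < b \<and> absolutely_continuous_curve a b \<gamma> \<and> \<gamma> a = x \<and> \<gamma> b = y}"
    using A(2) ac by blast
qed

lemma newton_potential_real:
  fixes x :: "('e::euclidean_space, 'n::{finite,linorder}) config"
  assumes m: "\<And>i. m i > 0" and far: "\<And>i j. i < j \<Longrightarrow> x $ i \<noteq> x $ j"
  shows "newton_potential m x = ennreal (\<Sum>(i, j) | i < j. m i * m j / norm (x $ i - x $ j))"
proof -
  have "newton_potential m x = (\<Sum>(i, j) | i < j. ennreal (m i * m j / norm (x $ i - x $ j)))"
    unfolding newton_potential_def
  proof (rule sum.cong[OF refl])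
    fix p :: "'n \<times> 'n" assume "p \<in> {(i, j). i < j}"
    then obtain i j where p: "p = (i, j)" "i < j" by auto
    have n: "0 < norm (x $ i - x $ j)" using far[OF p(2)] by simp
    have "ennreal (m i * m j) * inverse (ennreal (norm (x $ i - x $ j))) = ennreal (m i * m j) * ennreal (inverse (norm (x $ i - x $ j)))"
      using n by (simp add: inverse_ennreal)
    also have "\<dots> = ennreal (m i * m j * inverse (norm (x $ i - x $ j)))"
      using m[of i] m[of j] by (subst ennreal_mult) auto
    finally show "(case p of (i, j) \<Rightarrow> ennreal (m i * m j) * inverse (ennreal (norm (x $ i - x $ j)))) =
      (case p of (i, j) \<Rightarrow> ennreal (m i * m j / norm (x $ i - x $ j)))"
      by (simp add: p divide_inverse)
  qed
  also have "\<dots> = (\<Sum>p\<in>{(i, j). i < j}. ennreal (case p of (i, j) \<Rightarrow> m i * m j / norm (x $ i - x $ j)))"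
    by (rule sum.cong) auto
  also have "\<dots> = ennreal (\<Sum>(i, j) | i < j. m i * m j / norm (x $ i - x $ j))"
    by (rule sum_ennreal) (use mult_nonneg_nonneg[OF less_imp_le[OF m] less_imp_le[OF m]] in auto)
  finally show ?thesis .
qed

lemma collision_free_distinct:
  fixes x :: "('e::euclidean_space, 'n::{finite,linorder}) config"
  assumes m: "\<And>i. m i > 0" and x: "x \<in> collision_free m" and ij: "i < j"
  shows "x $ i \<noteq> x $ j"
proof
  assume eq: "x $ i = x $ j"
  have "ennreal (m i * m j) * inverse (ennreal (norm (x $ i - x $ j))) \<le> newton_potential m x"
    unfolding newton_potential_def
    using member_le_sum[of "(i, j)" "{(i, j). i < j}" "\<lambda>(i, j). ennreal (m i * m j) * inverse (ennreal (norm (x $ i - x $ j)))"] ij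
    by simp
  moreover have "ennreal (m i * m j) * inverse (ennreal (norm (x $ i - x $ j))) = \<infinity>"
    using eq m[of i] m[of j] by (simp add: ennreal_mult_top)
  ultimately show False using x by (simp add: collision_free_def top_unique)
qed

text \<open>In a small enough cone about a direction without collisions the mutual distances grow at least
  linearly in \<open>t\<close>, which gives the powers of \<open>t\<close>.\<close>
lemma newton_potential_cone:
  fixes x0 :: "('e::euclidean_space, 'n::{finite,linorder}) config"
  assumes N: "CARD('n) \<ge> 2" and m: "\<And>i. m i > 0" and h: "h > 0" and x0: "x0 \<in> collision_free m"
  obtains \<delta> C K where "mass_scale m x0 \<noteq> 0"
    "cone_potential (scaled_potential m) h ((1 / norm (mass_scale m x0)) *\<^sub>R mass_scale m x0) \<delta> C K"
proof -
  let ?P = "{(i, j). i < (j :: 'n)}"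
  let ?S = "mass_unscale m :: ('e, 'n) config \<Rightarrow> ('e, 'n) config"
  have P: "finite ?P" by simp
  obtain i0 j0 :: 'n where ij0: "i0 < j0"
  proof -
    have "\<not> card (UNIV :: 'n set) \<le> Suc 0" using N by simp
    then have "\<exists>x y :: 'n. x \<noteq> y" by (subst (asm) card_le_Suc0_iff_eq) auto
    then show thesis using that neqE by blast
  qed
  have x0ne: "x0 $ i \<noteq> x0 $ j" if "i < j" for i j by (rule collision_free_distinct[OF m x0 that])
  have s0: "mass_scale m x0 \<noteq> 0"
  proof
    assume "mass_scale m x0 = 0"
    then have "x0 = mass_unscale m 0" using mass_scale_inverse(1)[where m=m and x=x0, OF m] by simp
    then show False using x0ne[OF ij0] by (simp add: mass_unscale_def)
  qed
  define a where "a = (1 / norm (mass_scale m x0)) *\<^sub>R mass_scale m x0"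
  have a1: "norm a = 1" using s0 by (simp add: a_def)
  have Sa: "?S a $ i - ?S a $ j \<noteq> 0" if "i < j" for i j
  proof -
    have "?S a = (1 / norm (mass_scale m x0)) *\<^sub>R x0"
      unfolding a_def using linear_scale[OF bounded_linear.linear[OF bounded_linear_mass_scale(2)]] mass_scale_inverse(1)[where m=m and x=x0, OF m]
      by metis
    then show ?thesis using x0ne[OF that] s0 by simp
  qed
  define \<kappa> where "\<kappa> = Min ((\<lambda>(i, j). norm (?S a $ i - ?S a $ j)) ` ?P) / 2"
  have \<kappa>min: "2 * \<kappa> \<le> norm (?S a $ i - ?S a $ j)" if "i < j" for i j
  proof -
    have "Min ((\<lambda>(i, j). norm (?S a $ i - ?S a $ j)) ` ?P) \<le> norm (?S a $ i - ?S a $ j)"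
      by (rule Min_le) (use that P in \<open>auto intro!: image_eqI[of _ _ "(i, j)"]\<close>)
    then show ?thesis by (simp add: \<kappa>_def)
  qed
  have \<kappa>: "0 < \<kappa>"
  proof -
    have "Min ((\<lambda>(i, j). norm (?S a $ i - ?S a $ j)) ` ?P) \<in> (\<lambda>(i, j). norm (?S a $ i - ?S a $ j)) ` ?P"
      by (rule Min_in) (use ij0 P in auto)
    then show ?thesis using Sa by (auto simp: \<kappa>_def)
  qed
  define \<beta> where "\<beta> = (\<Sum>i\<in>UNIV. 1 / sqrt (m i))"
  have \<beta>i: "1 / sqrt (m i) \<le> \<beta>" for i
    unfolding \<beta>_def by (rule member_le_sum) (use m in \<open>auto intro!: less_imp_le\<close>)
  have \<beta>: "0 < \<beta>" using \<beta>i[of i0] m[of i0] by (smt (verit) divide_pos_pos real_sqrt_gt_zero)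
  have Sn: "norm (?S z $ i - ?S z $ j) \<le> 2 * \<beta> * norm z" for z i j
  proof -
    have 1: "norm (?S z $ i) \<le> \<beta> * norm z" for i
    proof -
      have "norm (?S z $ i) = 1 / sqrt (m i) * norm (z $ i)" using m[of i] by (simp add: mass_unscale_def)
      also have "\<dots> \<le> \<beta> * norm z" using \<beta>i[of i] \<beta> by (intro mult_mono Finite_Cartesian_Product.norm_nth_le) auto
      finally show ?thesis .
    qed
    show ?thesis using norm_triangle_ineq4[of "?S z $ i" "?S z $ j"] 1[of i] 1[of j] by linarith
  qed
  have Sdiff: "(?S x $ i - ?S x $ j) - (?S y $ i - ?S y $ j) = ?S (x - y) $ i - ?S (x - y) $ j" for x y i j
    by (simp add: mass_unscale_def scaleR_diff_right)
  \<comment> \<open>moving by \<open>\<delta> * t\<close> changes mutual distances by at most \<open>\<kappa> * t\<close>, at most half of the smallest one on the axis\<close>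
  define \<delta> where "\<delta> = \<kappa> / (2 * \<beta>)"
  have \<delta>: "0 < \<delta>" "2 * \<beta> * \<delta> = \<kappa>" using \<kappa> \<beta> by (auto simp: \<delta>_def)
  have far: "\<kappa> * t \<le> norm (?S x $ i - ?S x $ j)" if t: "0 < t" "norm (x - t *\<^sub>R a) \<le> \<delta> * t" and ij: "i < j" for t x i j
  proof -
    have "?S (t *\<^sub>R a) $ i - ?S (t *\<^sub>R a) $ j = t *\<^sub>R (?S a $ i - ?S a $ j)"
      by (simp add: mass_unscale_def scaleR_diff_right)
    then have "norm (?S (t *\<^sub>R a) $ i - ?S (t *\<^sub>R a) $ j) = t * norm (?S a $ i - ?S a $ j)" using t by simp
    moreover have "t * (2 * \<kappa>) \<le> t * norm (?S a $ i - ?S a $ j)" using \<kappa>min[OF ij] t by (intro mult_left_mono) auto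
    moreover have "norm ((?S x $ i - ?S x $ j) - (?S (t *\<^sub>R a) $ i - ?S (t *\<^sub>R a) $ j)) \<le> \<kappa> * t"
    proof -
      have "norm ((?S x $ i - ?S x $ j) - (?S (t *\<^sub>R a) $ i - ?S (t *\<^sub>R a) $ j)) \<le> 2 * \<beta> * norm (x - t *\<^sub>R a)"
        unfolding Sdiff by (rule Sn)
      also have "\<dots> \<le> 2 * \<beta> * (\<delta> * t)" using t \<beta> by (intro mult_left_mono) auto
      also have "\<dots> = \<kappa> * t" using \<delta>(2) by (simp flip: mult.assoc)
      finally show ?thesis .
    qed
    moreover have "norm (?S (t *\<^sub>R a) $ i - ?S (t *\<^sub>R a) $ j) - norm (?S x $ i - ?S x $ j)
      \<le> norm ((?S x $ i - ?S x $ j) - (?S (t *\<^sub>R a) $ i - ?S (t *\<^sub>R a) $ j))"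
      using norm_triangle_ineq2[of "?S (t *\<^sub>R a) $ i - ?S (t *\<^sub>R a) $ j" "?S x $ i - ?S x $ j"] by (simp add: norm_minus_commute)
    moreover have "t * (2 * \<kappa>) = 2 * (\<kappa> * t)" by simp
    ultimately show ?thesis by linarith
  qed
  define M where "M = (\<Sum>(i, j)\<in>?P. m i * m j)"
  have mm: "0 \<le> m i * m j" for i j using m[of i] m[of j] by simp
  have M: "0 < M"
  proof -
    have "(case (i0, j0) of (i, j) \<Rightarrow> m i * m j) \<le> M"
      unfolding M_def by (rule member_le_sum) (use ij0 mm P in auto)
    then show ?thesis using mult_pos_pos[OF m[of i0] m[of j0]] by simp
  qed
  have Msum: "(\<Sum>(i, j)\<in>?P. m i * m j * f) = M * f" for f
    unfolding M_def sum_distrib_right by (rule sum.cong) auto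
  let ?U = "scaled_potential m :: ('e, 'n) config \<Rightarrow> ennreal"
  have Ureal: "?U x = ennreal (\<Sum>(i, j)\<in>?P. m i * m j / norm (?S x $ i - ?S x $ j))"
    and ureal: "enn2real (?U x) = (\<Sum>(i, j)\<in>?P. m i * m j / norm (?S x $ i - ?S x $ j))"
    if t: "0 < t" "norm (x - t *\<^sub>R a) \<le> \<delta> * t" for t x
  proof -
    show eq: "?U x = ennreal (\<Sum>(i, j)\<in>?P. m i * m j / norm (?S x $ i - ?S x $ j))"
      unfolding scaled_potential_def
    proof (rule newton_potential_real[OF m])
      fix i j :: 'n assume "i < j"
      have "0 < \<kappa> * t" using \<kappa> t by simp
      then have "0 < norm (?S x $ i - ?S x $ j)" using far[OF t \<open>i < j\<close>] by linarith
      then show "?S x $ i \<noteq> ?S x $ j" by auto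
    qed
    have "0 \<le> (\<Sum>(i, j)\<in>?P. m i * m j / norm (?S x $ i - ?S x $ j))"
      by (rule sum_nonneg) (use mm in auto)
    then show "enn2real (?U x) = (\<Sum>(i, j)\<in>?P. m i * m j / norm (?S x $ i - ?S x $ j))" unfolding eq by simp
  qed
  define K where "K = M * (2 * \<beta> / \<kappa>\<^sup>2) + M * (16 * \<beta>\<^sup>2 / \<kappa> ^ 3)"
  have K: "0 < K" "M * (2 * \<beta> / \<kappa>\<^sup>2) \<le> K" "M * (16 * \<beta>\<^sup>2 / \<kappa> ^ 3) \<le> K"
    using M \<beta> \<kappa> by (auto simp: K_def intro!: add_pos_pos)
  have "cone_potential ?U h a \<delta> (M / \<kappa>) K"
  proof (unfold_locales)
    show "?U \<in> borel_measurable borel" by (rule scaled_potential_measurable)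
    show "0 < h" "norm a = 1" "0 < \<delta>" "0 < K" by fact+
    show "0 < M / \<kappa>" using M \<kappa> by simp
  next
    fix t x assume t: "0 < t" "norm (x - t *\<^sub>R a) \<le> \<delta> * t"
    have kt: "0 < \<kappa> * t" using \<kappa> t by simp
    have "(\<Sum>(i, j)\<in>?P. m i * m j / norm (?S x $ i - ?S x $ j)) \<le> (\<Sum>(i, j)\<in>?P. m i * m j * (1 / (\<kappa> * t)))"
    proof (rule sum_mono, clarify)
      fix i j :: 'n assume ij: "i < j"
      have "1 / norm (?S x $ i - ?S x $ j) \<le> 1 / (\<kappa> * t)"
        using far[OF t ij] kt by (intro frac_le) simp_all
      from mult_left_mono[OF this mm]
      show "m i * m j / norm (?S x $ i - ?S x $ j) \<le> m i * m j * (1 / (\<kappa> * t))" by simp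
    qed
    also have "\<dots> = M / \<kappa> / t" unfolding Msum by simp
    finally show "?U x \<le> ennreal (M / \<kappa> / t)" unfolding Ureal[OF t] by (rule ennreal_leI)
  next
    fix t x y assume t: "0 < t" and x: "norm (x - t *\<^sub>R a) \<le> \<delta> * t" and y: "norm (y - t *\<^sub>R a) \<le> \<delta> * t"
    have kt: "0 < \<kappa> * t" using \<kappa> t by simp
    have "\<bar>enn2real (?U x) - enn2real (?U y)\<bar> = \<bar>\<Sum>(i, j)\<in>?P. m i * m j / norm (?S x $ i - ?S x $ j) - m i * m j / norm (?S y $ i - ?S y $ j)\<bar>"
      unfolding ureal[OF t x] ureal[OF t y] sum_subtractf[symmetric] by (simp add: split_beta)
    also have "\<dots> \<le> (\<Sum>(i, j)\<in>?P. m i * m j * (2 * \<beta> * norm (x - y) / (\<kappa> * t)\<^sup>2))"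
    proof (rule order_trans[OF sum_abs sum_mono], clarify)
      fix i j :: 'n assume ij: "i < j"
      define r where "r = ?S x $ i - ?S x $ j"
      define q where "q = ?S y $ i - ?S y $ j"
      have r: "\<kappa> * t \<le> norm r" and q: "\<kappa> * t \<le> norm q" using far[OF t x ij] far[OF t y ij] by (auto simp: r_def q_def)
      then have pos: "0 < norm r" "0 < norm q" using kt by linarith+
      have "\<bar>1 / norm r - 1 / norm q\<bar> = \<bar>norm q - norm r\<bar> / (norm r * norm q)"
        using pos by (simp add: field_simps abs_mult[symmetric] abs_divide)
      also have "\<dots> \<le> (2 * \<beta> * norm (x - y)) / (\<kappa> * t)\<^sup>2"
      proof (rule frac_le)
        have "\<bar>norm q - norm r\<bar> \<le> norm (r - q)" using norm_triangle_ineq3[of q r] by (simp add: norm_minus_commute)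
        also have "\<dots> \<le> 2 * \<beta> * norm (x - y)" unfolding r_def q_def Sdiff by (rule Sn)
        finally show "\<bar>norm q - norm r\<bar> \<le> 2 * \<beta> * norm (x - y)" .
        show "(\<kappa> * t)\<^sup>2 \<le> norm r * norm q" unfolding power2_eq_square using r q kt by (intro mult_mono) auto
      qed (use \<beta> kt in auto)
      finally have "m i * m j * \<bar>1 / norm r - 1 / norm q\<bar> \<le> m i * m j * (2 * \<beta> * norm (x - y) / (\<kappa> * t)\<^sup>2)"
        by (rule mult_left_mono[OF _ mm])
      moreover have "\<bar>m i * m j / norm r - m i * m j / norm q\<bar> = m i * m j * \<bar>1 / norm r - 1 / norm q\<bar>"
      proof -
        have "m i * m j / norm r - m i * m j / norm q = m i * m j * (1 / norm r - 1 / norm q)"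
          by (simp add: right_diff_distrib)
        then show ?thesis by (simp only: abs_mult[of "m i * m j"] abs_of_nonneg[OF mm])
      qed
      ultimately show "\<bar>m i * m j / norm (?S x $ i - ?S x $ j) - m i * m j / norm (?S y $ i - ?S y $ j)\<bar>
        \<le> m i * m j * (2 * \<beta> * norm (x - y) / (\<kappa> * t)\<^sup>2)" by (simp add: r_def q_def)
    qed
    also have "\<dots> = M * (2 * \<beta> / \<kappa>\<^sup>2) * norm (x - y) / t\<^sup>2" unfolding Msum by (simp add: power_mult_distrib)
    also have "\<dots> \<le> K * norm (x - y) / t\<^sup>2" using K(2) by (intro divide_right_mono mult_right_mono) auto
    finally show "\<bar>enn2real (?U x) - enn2real (?U y)\<bar> \<le> K * norm (x - y) / t\<^sup>2" .
  next
    fix t x y v assume t: "0 < t" and x: "norm (x - t *\<^sub>R a) \<le> \<delta> * t" and y: "norm (y - t *\<^sub>R a) \<le> \<delta> * t"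
      and xv: "norm (x + v - t *\<^sub>R a) \<le> \<delta> * t" and yv: "norm (y + v - t *\<^sub>R a) \<le> \<delta> * t"
    have kt: "0 < \<kappa> * t" using \<kappa> t by simp
    have conv: "norm (z + \<theta> *\<^sub>R v - t *\<^sub>R a) \<le> \<delta> * t"
      if "norm (z - t *\<^sub>R a) \<le> \<delta> * t" "norm (z + v - t *\<^sub>R a) \<le> \<delta> * t" "0 \<le> \<theta>" "\<theta> \<le> 1" for z \<theta>
    proof -
      have "z + \<theta> *\<^sub>R v - t *\<^sub>R a = (1 - \<theta>) *\<^sub>R (z - t *\<^sub>R a) + \<theta> *\<^sub>R (z + v - t *\<^sub>R a)" by (simp add: algebra_simps)
      then have "norm (z + \<theta> *\<^sub>R v - t *\<^sub>R a) \<le> (1 - \<theta>) * norm (z - t *\<^sub>R a) + \<theta> * norm (z + v - t *\<^sub>R a)"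
        using norm_triangle_ineq[of "(1 - \<theta>) *\<^sub>R (z - t *\<^sub>R a)" "\<theta> *\<^sub>R (z + v - t *\<^sub>R a)"] that(3,4) by simp
      also have "\<dots> \<le> (1 - \<theta>) * (\<delta> * t) + \<theta> * (\<delta> * t)" using that by (intro add_mono mult_left_mono) auto
      finally show ?thesis by (simp add: algebra_simps)
    qed
    have "(enn2real (?U (x + v)) - enn2real (?U x)) - (enn2real (?U (y + v)) - enn2real (?U y))
      = (\<Sum>(i, j)\<in>?P. (m i * m j / norm (?S (x + v) $ i - ?S (x + v) $ j) - m i * m j / norm (?S x $ i - ?S x $ j))
        - (m i * m j / norm (?S (y + v) $ i - ?S (y + v) $ j) - m i * m j / norm (?S y $ i - ?S y $ j)))"
      unfolding ureal[OF t x] ureal[OF t y] ureal[OF t xv] ureal[OF t yv] sum_subtractf[symmetric] by (simp add: split_beta)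
    also have "\<dots> \<le> (\<Sum>(i, j)\<in>?P. m i * m j * (4 * (2 * \<beta> * norm v) * (2 * \<beta> * norm (x - y)) / (\<kappa> * t) ^ 3))"
    proof (rule sum_mono, clarify)
      fix i j :: 'n assume ij: "i < j"
      define r where "r = ?S x $ i - ?S x $ j"
      define q where "q = ?S y $ i - ?S y $ j"
      define p where "p = ?S v $ i - ?S v $ j"
      have line: "?S (z + \<theta> *\<^sub>R v) $ i - ?S (z + \<theta> *\<^sub>R v) $ j = (?S z $ i - ?S z $ j) + \<theta> *\<^sub>R p" for z \<theta>
        by (simp add: mass_unscale_def p_def scaleR_diff_right scaleR_add_right mult.commute)
      have rp: "?S (x + v) $ i - ?S (x + v) $ j = r + p" "?S (y + v) $ i - ?S (y + v) $ j = q + p"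
        using line[of x 1] line[of y 1] by (auto simp: r_def q_def)
      have "(1 / norm (r + p) - 1 / norm r) - (1 / norm (q + p) - 1 / norm q) \<le> 4 * norm p * norm (r - q) / (\<kappa> * t) ^ 3"
      proof (rule newton_kernel_second_difference[OF kt])
        fix \<theta> :: real assume th: "0 \<le> \<theta>" "\<theta> \<le> 1"
        show "\<kappa> * t \<le> norm (r + \<theta> *\<^sub>R p) \<and> \<kappa> * t \<le> norm (q + \<theta> *\<^sub>R p)"
          using far[OF t conv[OF x xv th] ij] far[OF t conv[OF y yv th] ij] unfolding line r_def q_def by blast
      qed
      also have "\<dots> \<le> 4 * (2 * \<beta> * norm v) * (2 * \<beta> * norm (x - y)) / (\<kappa> * t) ^ 3"
      proof (rule divide_right_mono)
        have "norm (r - q) \<le> 2 * \<beta> * norm (x - y)" unfolding r_def q_def Sdiff by (rule Sn)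
        moreover have "norm p \<le> 2 * \<beta> * norm v" unfolding p_def by (rule Sn)
        ultimately show "4 * norm p * norm (r - q) \<le> 4 * (2 * \<beta> * norm v) * (2 * \<beta> * norm (x - y))"
          using \<beta> by (intro mult_mono) auto
      qed (use kt in simp)
      finally have le: "m i * m j * ((1 / norm (r + p) - 1 / norm r) - (1 / norm (q + p) - 1 / norm q))
        \<le> m i * m j * (4 * (2 * \<beta> * norm v) * (2 * \<beta> * norm (x - y)) / (\<kappa> * t) ^ 3)"
        by (rule mult_left_mono[OF _ mm])
      then show "(m i * m j / norm (?S (x + v) $ i - ?S (x + v) $ j) - m i * m j / norm (?S x $ i - ?S x $ j))
        - (m i * m j / norm (?S (y + v) $ i - ?S (y + v) $ j) - m i * m j / norm (?S y $ i - ?S y $ j))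
        \<le> m i * m j * (4 * (2 * \<beta> * norm v) * (2 * \<beta> * norm (x - y)) / (\<kappa> * t) ^ 3)"
        unfolding rp r_def[symmetric] q_def[symmetric] by (simp only: right_diff_distrib) simp
    qed
    also have "\<dots> = M * (16 * \<beta>\<^sup>2 / \<kappa> ^ 3) * norm v * norm (x - y) / t ^ 3"
      unfolding Msum by (simp add: power_mult_distrib power2_eq_square)
    also have "\<dots> \<le> K * norm v * norm (x - y) / t ^ 3"
      using K(3) t by (intro divide_right_mono mult_right_mono) auto
    finally show "(enn2real (?U (x + v)) - enn2real (?U x)) - (enn2real (?U (y + v)) - enn2real (?U y))
      \<le> K * norm v * norm (x - y) / t ^ 3" .
  qed
  then show thesis using that[OF s0] unfolding a_def by blast
qed

section \<open>Directions as points of the Gromov boundary\<close>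

theorem corollary1p8:
  fixes m :: "'n::{finite,linorder} \<Rightarrow> real" and h :: real
    and \<omega> :: "('e::euclidean_space, 'n) config set"
  assumes "CARD('n) \<ge> 2" and "DIM('e) \<ge> 2"
    and "\<And>i. m i > 0" and "h > 0"
    and "\<omega> \<in> collision_free_directions m"
  shows "{\<gamma>. geodesic_ray m h \<gamma> \<and> (\<exists>a\<in>\<omega>. has_asymptotic_direction m \<gamma> a)} \<in> gromov_boundary m h"
proof -
  note m = assms(3)
  let ?F = "mass_scale m :: ('e, 'n) config \<Rightarrow> ('e, 'n) config"
  obtain x0 where x0: "x0 \<in> collision_free m" and \<omega>: "\<omega> = direction_rel m `` {x0}"
    using assms(5) unfolding collision_free_directions_def by (rule quotientE)
  obtain \<delta> C K where s0: "?F x0 \<noteq> 0" and cone: "cone_potential (scaled_potential m) h ((1 / norm (?F x0)) *\<^sub>R ?F x0) \<delta> C K"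
    using newton_potential_cone[OF assms(1) m assms(4) x0] by blast
  define a where "a = (1 / norm (?F x0)) *\<^sub>R ?F x0"
  interpret cone_potential "scaled_potential m :: ('e, 'n) config \<Rightarrow> ennreal" h a \<delta> C K
    using cone unfolding a_def .
  have Fx0: "?F x0 = norm (?F x0) *\<^sub>R a" using s0 by (simp add: a_def)
  have x0\<omega>: "x0 \<in> \<omega>" using x0 by (auto simp: \<omega> direction_rel_def intro!: exI[of _ 1])
  have ray_iff: "geodesic_ray m h \<gamma> \<longleftrightarrow> ray (\<lambda>t. ?F (\<gamma> t))" for \<gamma>
    unfolding geodesic_ray_def ray_def JM_dist_scaled[OF m] ..
  have Fdiff: "?F (x - y) = ?F x - ?F y" and Fscale: "?F (r *\<^sub>R x) = r *\<^sub>R ?F x" for x y r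
    using linear_diff linear_scale bounded_linear.linear[OF bounded_linear_mass_scale(1)] by blast+
  have dir_iff: "has_asymptotic_direction m \<gamma> x0 \<longleftrightarrow>
    (\<exists>l>0. ((\<lambda>s. norm (?F (\<gamma> s) - (l * s) *\<^sub>R a) / s) \<longlongrightarrow> 0) at_top)" for \<gamma>
  proof -
    have *: "(\<lambda>s. mass_norm m (\<gamma> s - (r * s) *\<^sub>R x0)) \<in> o[at_top](\<lambda>s. s) \<longleftrightarrow>
      ((\<lambda>s. norm (?F (\<gamma> s) - (r * norm (?F x0) * s) *\<^sub>R a) / s) \<longlongrightarrow> 0) at_top" for r
    proof -
      have "mass_norm m (\<gamma> s - (r * s) *\<^sub>R x0) = norm (?F (\<gamma> s) - (r * norm (?F x0) * s) *\<^sub>R a)" for s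
      proof -
        have "(r * s) *\<^sub>R ?F x0 = (r * norm (?F x0) * s) *\<^sub>R a" by (subst Fx0) (simp add: mult_ac)
        then show ?thesis by (simp add: mass_norm_scale[OF m] Fdiff Fscale)
      qed
      moreover have "\<forall>\<^sub>F s::real in at_top. s \<noteq> 0" using eventually_gt_at_top[of 0] by eventually_elim simp
      ultimately show ?thesis using smalloI_tendsto[of _ "\<lambda>s::real. s" at_top] smalloD_tendsto[of _ at_top "\<lambda>s::real. s"] by auto
    qed
    show ?thesis
    proof
      assume "has_asymptotic_direction m \<gamma> x0"
      then obtain r where "0 < r" "((\<lambda>s. norm (?F (\<gamma> s) - (r * norm (?F x0) * s) *\<^sub>R a) / s) \<longlongrightarrow> 0) at_top"
        unfolding has_asymptotic_direction_def * by blast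
      then show "\<exists>l>0. ((\<lambda>s. norm (?F (\<gamma> s) - (l * s) *\<^sub>R a) / s) \<longlongrightarrow> 0) at_top"
        using s0 by (intro exI[of _ "r * norm (?F x0)"]) auto
    next
      assume "\<exists>l>0. ((\<lambda>s. norm (?F (\<gamma> s) - (l * s) *\<^sub>R a) / s) \<longlongrightarrow> 0) at_top"
      then obtain l where l: "0 < l" "((\<lambda>s. norm (?F (\<gamma> s) - (l * s) *\<^sub>R a) / s) \<longlongrightarrow> 0) at_top" by blast
      then show "has_asymptotic_direction m \<gamma> x0"
        unfolding has_asymptotic_direction_def * using s0 by (intro exI[of _ "l / norm (?F x0)"]) auto
    qed
  qed
  have dir_class: "(\<exists>x\<in>\<omega>. has_asymptotic_direction m \<gamma> x) \<longleftrightarrow> has_asymptotic_direction m \<gamma> x0" for \<gamma>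
  proof
    assume "\<exists>x\<in>\<omega>. has_asymptotic_direction m \<gamma> x"
    then obtain x r where x: "x \<in> \<omega>" "0 < r" "(\<lambda>s. mass_norm m (\<gamma> s - (r * s) *\<^sub>R x)) \<in> o[at_top](\<lambda>s. s)"
      unfolding has_asymptotic_direction_def by blast
    from x(1) obtain k where k: "0 < k" "x = k *\<^sub>R x0" unfolding \<omega> direction_rel_def by auto
    have "(\<lambda>s. mass_norm m (\<gamma> s - (r * k * s) *\<^sub>R x0)) \<in> o[at_top](\<lambda>s. s)"
      using x(3) unfolding k(2) by (simp add: mult_ac)
    then show "has_asymptotic_direction m \<gamma> x0"
      unfolding has_asymptotic_direction_def using x(2) k(1) by (intro exI[of _ "r * k"]) auto
  qed (use x0\<omega> in blast)
  obtain \<eta> :: "real \<Rightarrow> ('e, 'n) config" where \<eta>: "\<And>s t. 0 \<le> s \<Longrightarrow> 0 \<le> t \<Longrightarrow> d (\<eta> s) (\<eta> t) = ennreal \<bar>t - s\<bar>"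
    "((\<lambda>s. norm (\<eta> s - (s / c) *\<^sub>R a) / s) \<longlongrightarrow> 0) at_top"
    by (rule ray_exists) blast
  have \<eta>ray: "ray \<eta>" using \<eta>(1) by (simp add: ray_def)
  define \<gamma>0 where "\<gamma>0 = (\<lambda>t. mass_unscale m (\<eta> t))"
  have F\<gamma>0: "?F (\<gamma>0 t) = \<eta> t" for t by (simp add: \<gamma>0_def mass_scale_inverse[OF m])
  have \<gamma>0: "geodesic_ray m h \<gamma>0" unfolding ray_iff F\<gamma>0 by (rule \<eta>ray)
  have "{\<gamma>. geodesic_ray m h \<gamma> \<and> (\<exists>a\<in>\<omega>. has_asymptotic_direction m \<gamma> a)} = ray_rel m h `` {\<gamma>0}"
  proof (intro equalityI subsetI)
    fix \<gamma> assume "\<gamma> \<in> {\<gamma>. geodesic_ray m h \<gamma> \<and> (\<exists>a\<in>\<omega>. has_asymptotic_direction m \<gamma> a)}"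
    then have g: "geodesic_ray m h \<gamma>" and "has_asymptotic_direction m \<gamma> x0" using dir_class by auto
    then obtain l where l: "0 < l" "((\<lambda>s. norm (?F (\<gamma> s) - (l * s) *\<^sub>R a) / s) \<longlongrightarrow> 0) at_top" unfolding dir_iff by blast
    have ray: "ray (\<lambda>t. ?F (\<gamma> t))" using g ray_iff by simp
    have "l = 1 / c" by (rule ray_asymptotic_speed[OF ray l])
    with l(2) have "((\<lambda>s. norm (?F (\<gamma> s) - (s / c) *\<^sub>R a) / s) \<longlongrightarrow> 0) at_top" by simp
    from rays_bounded_distance[OF \<eta>ray ray \<eta>(2) this]
    have "\<exists>B. \<forall>t\<ge>0. JM_dist m h (\<gamma>0 t) (\<gamma> t) \<le> ennreal B" unfolding JM_dist_scaled[OF m] F\<gamma>0 .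
    then show "\<gamma> \<in> ray_rel m h `` {\<gamma>0}" using g \<gamma>0 by (simp add: ray_rel_def)
  next
    fix \<gamma> assume "\<gamma> \<in> ray_rel m h `` {\<gamma>0}"
    then obtain B where g: "geodesic_ray m h \<gamma>" and B: "\<And>t. 0 \<le> t \<Longrightarrow> d (\<eta> t) (?F (\<gamma> t)) \<le> ennreal B"
      unfolding ray_rel_def JM_dist_scaled[OF m] by (auto simp: F\<gamma>0)
    define B' where "B' = max B 0 / c"
    have near: "norm (?F (\<gamma> t) - \<eta> t) \<le> B'" if "0 \<le> t" for t
    proof -
      have "ennreal (c * norm (?F (\<gamma> t) - \<eta> t)) \<le> ennreal (max B 0)"
        using order_trans[OF jdist_ge_norm B[OF that]] by (rule order_trans) (simp add: ennreal_leI)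
      then have "c * norm (?F (\<gamma> t) - \<eta> t) \<le> max B 0" by (subst (asm) ennreal_le_iff) auto
      then show ?thesis using c_pos by (simp add: B'_def field_simps)
    qed
    have "((\<lambda>s. norm (?F (\<gamma> s) - (1 / c * s) *\<^sub>R a) / s) \<longlongrightarrow> 0) at_top"
    proof (rule tendsto_sandwich[OF _ _ tendsto_const])
      show "((\<lambda>s. norm (\<eta> s - (s / c) *\<^sub>R a) / s + B' / s) \<longlongrightarrow> 0) at_top"
      proof (rule tendsto_add_zero[OF \<eta>(2)])
        show "((\<lambda>s. B' / s) \<longlongrightarrow> 0) at_top" by real_asymp
      qed
      show "\<forall>\<^sub>F s in at_top. 0 \<le> norm (?F (\<gamma> s) - (1 / c * s) *\<^sub>R a) / s"
        using eventually_ge_at_top[of 0] by eventually_elim simp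
      show "\<forall>\<^sub>F s in at_top. norm (?F (\<gamma> s) - (1 / c * s) *\<^sub>R a) / s \<le> norm (\<eta> s - (s / c) *\<^sub>R a) / s + B' / s"
        using eventually_gt_at_top[of 0]
      proof eventually_elim
        case (elim s)
        have "norm (?F (\<gamma> s) - (1 / c * s) *\<^sub>R a) \<le> norm (\<eta> s - (s / c) *\<^sub>R a) + B'"
          using norm_triangle_ineq[of "?F (\<gamma> s) - \<eta> s" "\<eta> s - (s / c) *\<^sub>R a"] near[of s] elim by simp
        then show ?case unfolding add_divide_distrib[symmetric] using elim by (intro divide_right_mono) auto
      qed
    qed
    then have "has_asymptotic_direction m \<gamma> x0" unfolding dir_iff using c_pos by (intro exI[of _ "1 / c"]) auto
    then show "\<gamma> \<in> {\<gamma>. geodesic_ray m h \<gamma> \<and> (\<exists>a\<in>\<omega>. has_asymptotic_direction m \<gamma> a)}" using g dir_class by simp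
  qed
  then show ?thesis unfolding gromov_boundary_def using \<gamma>0 by (auto intro: quotientI)
qed

end
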